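(* Let $\mathbf{k}$ be an algebraically closed field of characteristic $0$. Let $(V,c)$ be a $2$-dimensional braided pair of finite group type (and thus of diagonal group type), with basis $\{x_1,x_2\}$ and matrix $(q_{ij})$, so that $c(x_i\otimes x_j)=q_{ij}x_j\otimes x_i$ for $i,j\in\{1,2\}$, and let $N_j=N(q_{jj})$ for $j=1,2$. Let $r+1$ be the nilpotency order of $\mathrm{Ad}_{x_2}$ on $x_1$ (in $\mathfrak{B}(V)$). For $1\le i\le r$ let $M_i=N\big(q_{11}(q_{12}q_{21})^iq_{22}^{i^2}\big)$. Then $$\dim\mathfrak{B}(V)\ \ge\ N_1N_2\prod_{1\le i\le r}M_i .\qquad( * )$$ Furthermore, suppose that the nilpotency order of $\mathrm{Ad}_{x_1}$ on $x_2$ is $2$. Then: \begin{enumerate} \item If $r=1$, then the equality holds in $( * )$. \item If $r=2$, and $N(q_{11})\neq2$ or $N(q_{22})\neq3$, then the equality holds in $( * )$. \item If $r=2$, $N(q_{11})=2$ and $N(q_{22})=3$, then the equality holds in $( * )$ if and only if $$q_{12}q_{21}=-1,\quad\text{or}\quad q_{12}q_{21}=q_{22},\quad\text{or}\quad q_{12}q_{21}=-q_{22}.$$ \end{enumerate}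
   Context: A braided pair (BP) is a pair $(V,c)$ with $V$ a vector space over $\mathbf{k}$ and $c:V\otimes V\to V\otimes V$ a bijective solution of the braid equation. It is of group type if $V$ has a basis $\{y_1,\dots,y_n\}$ and there are $g_i\in\mathrm{GL}(V)$ with $c(y_i\otimes y_j)=g_i(y_j)\otimes y_i$ for all $i,j$; of finite group type if moreover the group generated by the $g_i$ is finite; of diagonal group type if there are a basis $\{x_i\}$ and a matrix $(q_{ij})$ with entries in $\mathbf{k}^\times$ with $c(x_i\otimes x_j)=q_{ij}x_j\otimes x_i$; these are called the basis and the matrix of $(V,c)$. For $q\in\mathbf{k}^\times$, $N(q)$ is the order of $q$ if $q\neq1$ is a root of unity, and $N(q)=\infty$ if $q=1$ or $q$ is not a root of unity. Nichols algebra. The braid group $\mathbb{B}_n$ (generators $\sigma_1,\dots,\sigma_{n-1}$) acts on $V^{\otimes n}$, $\sigma_i$ acting by $c$ in positions $i,i+1$. Let $s:\mathbb{S}_n\to\mathbb{B}_n$ be the set-theoretic section sending a reduced expression $\tau_{i_1}\cdots\tau_{i_l}$ ($\tau_i=(i\ i{+}1)$) to $\sigma_{i_1}\cdots\sigma_{i_l}$, and $\mathbf{S}^n=\sum_{x\in\mathbb{S}_n}s(x)$. The Nichols algebra $\mathfrak{B}(V)$ is the image of the graded map $\bigoplus_n\mathbf{S}^n$ from the tensor algebra of $V$ to the tensor coalgebra of $V$ (a map of braided Hopf algebras); as an algebra it is the quotient of the tensor algebra by $\bigoplus_n\ker\mathbf{S}^n$. For a primitive element $x\in\mathfrak{B}(V)$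 (e.g. $x\in V$), the braided adjoint is $\mathrm{Ad}_x(y)=xy-m(c(x\otimes y))$, with $m$ and $c$ the multiplication and braiding of $\mathfrak{B}(V)$. For an endomorphism $T$ of a vector space and a vector $y\neq0$ such that $T^n(y)=0$ for some $n$, the nilpotency order of $T$ in (or on) $y$ is the number $r+1$ with $T^r(y)\neq0$ and $T^{r+1}(y)=0$.
   Formalization: "Equality holds in ( * )" is read as: both sides are finite and equal. If infinite sides counted as equal, item 3 would fail, e.g. for q11 = -1, q22 a primitive cube root of 1, q12q21 = -q22^2, where M_1 = N(1) is infinite. *)

theory Defs
  imports
    "HOL-Computational_Algebra.Polynomial"
    "HOL-Library.Function_Algebras"
    "HOL-Library.Extended_Nat"
    "HOL-Combinatorics.Permutations"
    "HOL-Algebra.Generated_Groups"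
begin

text \<open>
  The vector space $V$ is a whole type with a scalar multiplication \<open>scale\<close>, as in the
  locale \<^locale>\<open>vector_space\<close>.

  The tensor power $V^{\otimes n}$ is realised inside the functions on words of linear forms:
  $v_1 \otimes \dots \otimes v_n$ is the function
  $(\phi_1, \dots, \phi_n) \mapsto \prod_i \phi_i(v_i)$, extended by $0$ to all other lists.
  Since $V^*$ separates the points of $V$, the map from the abstract tensor power to the span of
  these functions is an isomorphism.  The grading of $T(V)$ is by the length of the argument list.
\<close>

type_synonym ('v, 'k) tensor = "('v \<Rightarrow> 'k) list \<Rightarrow> 'k"

definition tscale :: "'k::field \<Rightarrow> ('a \<Rightarrow> 'k) \<Rightarrow> ('a \<Rightarrow> 'k)" where
  "tscale a f = (\<lambda>x. a * f x)"

interpretation tens: vector_space "tscale :: 'k::field \<Rightarrow> ('a \<Rightarrow> 'k) \<Rightarrow> ('a \<Rightarrow> 'k)"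
  by unfold_locales (auto simp: tscale_def fun_eq_iff algebra_simps)

context
  fixes scale :: "'k::field \<Rightarrow> 'v::ab_group_add \<Rightarrow> 'v"
begin

definition pure_tensor :: "'v list \<Rightarrow> ('v, 'k) tensor" where
  "pure_tensor vs = (\<lambda>\<phi>s.
     if length \<phi>s = length vs \<and> (\<forall>\<phi>\<in>set \<phi>s. Vector_Spaces.linear scale (*) \<phi>)
     then \<Prod>i<length vs. (\<phi>s ! i) (vs ! i) else 0)"

definition tensor_power :: "nat \<Rightarrow> ('v, 'k) tensor set" where
  "tensor_power n = tens.span {pure_tensor vs | vs. length vs = n}"

definition tensor_algebra :: "('v, 'k) tensor set" where
  "tensor_algebra = tens.span (range pure_tensor)"

end

definition degree_part :: "nat \<Rightarrow> ('v, 'k::field) tensor \<Rightarrow> ('v, 'k) tensor" where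
  "degree_part n t = (\<lambda>\<phi>s. if length \<phi>s = n then t \<phi>s else 0)"

text \<open>
  The product of $T(V)$ (concatenation of pure tensors).
\<close>

definition tensor_mult :: "('v, 'k::field) tensor \<Rightarrow> ('v, 'k) tensor \<Rightarrow> ('v, 'k) tensor" where
  "tensor_mult s t = (\<lambda>\<phi>s. \<Sum>m\<le>length \<phi>s. s (take m \<phi>s) * t (drop m \<phi>s))"

text \<open>
  \<open>braid_gen c i\<close> is the action of the generator $\sigma_{i+1}$: positions are counted from $0$,
  and $c$ is applied in positions $i$, $i+1$.  Only the values of $c$ on $V \otimes V$ matter:
  for $t \in V^{\otimes n}$ the inner function is the contraction of $t$ with all the forms
  other than those in positions $i$, $i+1$, which is an element of $V \otimes V$.
\<close>

definition braid_gen ::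
  "(('v, 'k::field) tensor \<Rightarrow> ('v, 'k) tensor) \<Rightarrow> nat \<Rightarrow> ('v, 'k) tensor \<Rightarrow> ('v, 'k) tensor" where
  "braid_gen c i t = (\<lambda>\<phi>s.
     if i + 2 \<le> length \<phi>s
     then c (\<lambda>\<psi>s. if length \<psi>s = 2 then t (take i \<phi>s @ \<psi>s @ drop (i + 2) \<phi>s) else 0)
            [\<phi>s ! i, \<phi>s ! (i + 1)]
     else t \<phi>s)"

definition braid_word ::
  "(('v, 'k::field) tensor \<Rightarrow> ('v, 'k) tensor) \<Rightarrow> nat list \<Rightarrow> ('v, 'k) tensor \<Rightarrow> ('v, 'k) tensor" where
  "braid_word c is t = foldr (braid_gen c) is t"

definition braided_pair ::
  "('k::field \<Rightarrow> 'v::ab_group_add \<Rightarrow> 'v) \<Rightarrow> (('v, 'k) tensor \<Rightarrow> ('v, 'k) tensor) \<Rightarrow> bool" where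
  "braided_pair scale c \<longleftrightarrow>
     vector_space scale \<and>
     (\<forall>s\<in>tensor_power scale 2. \<forall>t\<in>tensor_power scale 2. c (s + t) = c s + c t) \<and>
     (\<forall>a. \<forall>t\<in>tensor_power scale 2. c (tscale a t) = tscale a (c t)) \<and>
     bij_betw c (tensor_power scale 2) (tensor_power scale 2) \<and>
     (\<forall>t\<in>tensor_power scale 3. braid_word c [0, 1, 0] t = braid_word c [1, 0, 1] t)"

definition is_basis :: "('k::field \<Rightarrow> 'v::ab_group_add \<Rightarrow> 'v) \<Rightarrow> nat \<Rightarrow> (nat \<Rightarrow> 'v) \<Rightarrow> bool" where
  "is_basis scale n x \<longleftrightarrow>
     inj_on x {1..n} \<and>
     \<not> module.dependent scale (x ` {1..n}) \<and>
     module.span scale (x ` {1..n}) = UNIV"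

definition GL :: "('k::field \<Rightarrow> 'v::ab_group_add \<Rightarrow> 'v) \<Rightarrow> ('v \<Rightarrow> 'v) monoid" where
  "GL scale = \<lparr>carrier = {g. Vector_Spaces.linear scale scale g \<and> bij g},
               monoid.mult = (\<circ>), one = id\<rparr>"

definition group_type_data ::
  "('k::field \<Rightarrow> 'v::ab_group_add \<Rightarrow> 'v) \<Rightarrow> (('v, 'k) tensor \<Rightarrow> ('v, 'k) tensor) \<Rightarrow>
   nat \<Rightarrow> (nat \<Rightarrow> 'v) \<Rightarrow> (nat \<Rightarrow> 'v \<Rightarrow> 'v) \<Rightarrow> bool" where
  "group_type_data scale c n y g \<longleftrightarrow>
     is_basis scale n y \<and> (\<forall>i\<in>{1..n}. g i \<in> carrier (GL scale)) \<and>
     (\<forall>i\<in>{1..n}. \<forall>j\<in>{1..n}.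
        c (pure_tensor scale [y i, y j]) = pure_tensor scale [g i (y j), y i])"

definition finite_group_type ::
  "('k::field \<Rightarrow> 'v::ab_group_add \<Rightarrow> 'v) \<Rightarrow> (('v, 'k) tensor \<Rightarrow> ('v, 'k) tensor) \<Rightarrow> bool" where
  "finite_group_type scale c \<longleftrightarrow>
     (\<exists>n y g. group_type_data scale c n y g \<and> finite (generate (GL scale) (g ` {1..n})))"

definition diagonal_type_data ::
  "('k::field \<Rightarrow> 'v::ab_group_add \<Rightarrow> 'v) \<Rightarrow> (('v, 'k) tensor \<Rightarrow> ('v, 'k) tensor) \<Rightarrow>
   nat \<Rightarrow> (nat \<Rightarrow> 'v) \<Rightarrow> (nat \<Rightarrow> nat \<Rightarrow> 'k) \<Rightarrow> bool" where
  "diagonal_type_data scale c n x q \<longleftrightarrow>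
     is_basis scale n x \<and> (\<forall>i\<in>{1..n}. \<forall>j\<in>{1..n}. q i j \<noteq> 0) \<and>
     (\<forall>i\<in>{1..n}. \<forall>j\<in>{1..n}.
        c (pure_tensor scale [x i, x j]) = tscale (q i j) (pure_tensor scale [x j, x i]))"

text \<open>
  The section $s$ of the projection from the braid group to the symmetric group (here on
  \<open>{..<n}\<close>), composed with the action on $V^{\otimes n}$.  By Matsumoto's theorem and the braid
  equation, the choice of the reduced expression is immaterial.
\<close>

definition word_perm :: "nat list \<Rightarrow> nat \<Rightarrow> nat" where
  "word_perm is = foldr (\<lambda>i p. transpose i (Suc i) \<circ> p) is id"

definition reduced_expression :: "nat \<Rightarrow> (nat \<Rightarrow> nat) \<Rightarrow> nat list \<Rightarrow> bool" where
  "reduced_expression n p is \<longleftrightarrow>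
     (\<forall>i\<in>set is. Suc i < n) \<and> word_perm is = p \<and>
     (\<forall>js. (\<forall>j\<in>set js. Suc j < n) \<longrightarrow> word_perm js = p \<longrightarrow> length is \<le> length js)"

definition matsumoto_section ::
  "(('v, 'k::field) tensor \<Rightarrow> ('v, 'k) tensor) \<Rightarrow> nat \<Rightarrow> (nat \<Rightarrow> nat) \<Rightarrow>
   ('v, 'k) tensor \<Rightarrow> ('v, 'k) tensor" where
  "matsumoto_section c n p = braid_word c (SOME is. reduced_expression n p is)"

definition quantum_symmetrizer ::
  "(('v, 'k::field) tensor \<Rightarrow> ('v, 'k) tensor) \<Rightarrow> nat \<Rightarrow> ('v, 'k) tensor \<Rightarrow> ('v, 'k) tensor" where
  "quantum_symmetrizer c n t = (\<Sum>p | p permutes {..<n}. matsumoto_section c n p t)"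

text \<open>The graded map $\bigoplus_n \mathbf{S}^n$; its image is the Nichols algebra.\<close>

definition graded_symmetrizer ::
  "(('v, 'k::field) tensor \<Rightarrow> ('v, 'k) tensor) \<Rightarrow> ('v, 'k) tensor \<Rightarrow> ('v, 'k) tensor" where
  "graded_symmetrizer c t = (\<lambda>\<phi>s.
     quantum_symmetrizer c (length \<phi>s) (degree_part (length \<phi>s) t) \<phi>s)"

definition nichols ::
  "('k::field \<Rightarrow> 'v::ab_group_add \<Rightarrow> 'v) \<Rightarrow> (('v, 'k) tensor \<Rightarrow> ('v, 'k) tensor) \<Rightarrow>
   ('v, 'k) tensor set" where
  "nichols scale c = graded_symmetrizer c ` tensor_algebra scale"

text \<open>
  The braiding of $T(V)$ has components
  $c_{m,n} \colon V^{\otimes m} \otimes V^{\otimes n} \to V^{\otimes n} \otimes V^{\otimes m}$ given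
  on $V^{\otimes (m+n)}$ (generators numbered from $0$) by
  $(\sigma_{n-1} \cdots \sigma_0)(\sigma_n \cdots \sigma_1) \cdots (\sigma_{m+n-2} \cdots \sigma_{m-1})$.
  Hence \<open>tensor_mult_braid\<close> is $m(c(s \otimes t))$.
\<close>

definition block_braid ::
  "(('v, 'k::field) tensor \<Rightarrow> ('v, 'k) tensor) \<Rightarrow> nat \<Rightarrow> nat \<Rightarrow> ('v, 'k) tensor \<Rightarrow> ('v, 'k) tensor" where
  "block_braid c m n = braid_word c (concat (map (\<lambda>k. rev [k..<k + n]) [0..<m]))"

definition tensor_mult_braid ::
  "(('v, 'k::field) tensor \<Rightarrow> ('v, 'k) tensor) \<Rightarrow> ('v, 'k) tensor \<Rightarrow> ('v, 'k) tensor \<Rightarrow>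
   ('v, 'k) tensor" where
  "tensor_mult_braid c s t = (\<lambda>\<phi>s. \<Sum>m\<le>length \<phi>s.
     block_braid c m (length \<phi>s - m)
       (tensor_mult (degree_part m s) (degree_part (length \<phi>s - m) t)) \<phi>s)"

text \<open>
  The multiplication $m$ and the composite $m \circ c$ of the Nichols algebra: it carries the unique
  structure for which the graded symmetrizer from $T(V)$ onto it is a map of braided algebras.  The
  kernel is a two-sided ideal compatible with the braiding, so the preimages chosen by
  \<^const>\<open>inv_into\<close> do not matter.
\<close>

definition nichols_mult ::
  "('k::field \<Rightarrow> 'v::ab_group_add \<Rightarrow> 'v) \<Rightarrow> (('v, 'k) tensor \<Rightarrow> ('v, 'k) tensor) \<Rightarrow>
   ('v, 'k) tensor \<Rightarrow> ('v, 'k) tensor \<Rightarrow> ('v, 'k) tensor" where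
  "nichols_mult scale c u v = graded_symmetrizer c
     (tensor_mult (inv_into (tensor_algebra scale) (graded_symmetrizer c) u)
                  (inv_into (tensor_algebra scale) (graded_symmetrizer c) v))"

definition nichols_mult_braid ::
  "('k::field \<Rightarrow> 'v::ab_group_add \<Rightarrow> 'v) \<Rightarrow> (('v, 'k) tensor \<Rightarrow> ('v, 'k) tensor) \<Rightarrow>
   ('v, 'k) tensor \<Rightarrow> ('v, 'k) tensor \<Rightarrow> ('v, 'k) tensor" where
  "nichols_mult_braid scale c u v = graded_symmetrizer c
     (tensor_mult_braid c (inv_into (tensor_algebra scale) (graded_symmetrizer c) u)
                          (inv_into (tensor_algebra scale) (graded_symmetrizer c) v))"

definition nichols_Ad ::
  "('k::field \<Rightarrow> 'v::ab_group_add \<Rightarrow> 'v) \<Rightarrow> (('v, 'k) tensor \<Rightarrow> ('v, 'k) tensor) \<Rightarrow>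
   ('v, 'k) tensor \<Rightarrow> ('v, 'k) tensor \<Rightarrow> ('v, 'k) tensor" where
  "nichols_Ad scale c u v = nichols_mult scale c u v - nichols_mult_braid scale c u v"

definition nichols_of_vector ::
  "('k::field \<Rightarrow> 'v::ab_group_add \<Rightarrow> 'v) \<Rightarrow> (('v, 'k) tensor \<Rightarrow> ('v, 'k) tensor) \<Rightarrow>
   'v \<Rightarrow> ('v, 'k) tensor" where
  "nichols_of_vector scale c v = graded_symmetrizer c (pure_tensor scale [v])"

definition nichols_dim ::
  "('k::field \<Rightarrow> 'v::ab_group_add \<Rightarrow> 'v) \<Rightarrow> (('v, 'k) tensor \<Rightarrow> ('v, 'k) tensor) \<Rightarrow> enat" where
  "nichols_dim scale c =
     (if \<exists>B. finite B \<and> tens.span B = nichols scale c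
      then enat (tens.dim (nichols scale c)) else \<infinity>)"

definition nilpotency_order :: "('a::zero \<Rightarrow> 'a) \<Rightarrow> 'a \<Rightarrow> nat \<Rightarrow> bool" where
  "nilpotency_order T y m \<longleftrightarrow>
     y \<noteq> 0 \<and> (\<exists>r. m = r + 1 \<and> (T ^^ r) y \<noteq> 0 \<and> (T ^^ (r + 1)) y = 0)"

definition root_order :: "'k::field \<Rightarrow> enat" where
  "root_order q =
     (if q \<noteq> 1 \<and> (\<exists>n>0. q ^ n = 1) then enat (LEAST n. n > 0 \<and> q ^ n = 1) else \<infinity>)"

text \<open>
  \<open>finite_eq d b\<close> expresses that equality holds in an estimate $d \ge b$ between numbers: both sides
  are finite and equal.  The formal identity $\infty = \infty$ is not counted as equality.  For
  $N(q_{11}) = 2$, $N(q_{22}) = 3$, $q_{12} q_{21} = -q_{22}^2$ one gets $r = 2$ and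
  $q_{11} q_{12} q_{21} q_{22} = 1$, so $M_1 = \infty$ and both sides of the estimate are infinite,
  yet this value of $q_{12} q_{21}$ is not among the three for which equality is asserted.
\<close>

definition finite_eq :: "enat \<Rightarrow> enat \<Rightarrow> bool" where
  "finite_eq d b \<longleftrightarrow> d = b \<and> b \<noteq> \<infinity>"

end

theory Submission imports Defs begin

text \<open>
  Write \<open>s = q 1 1\<close>, \<open>t = q 2 2\<close>, \<open>p = q 1 2 * q 2 1\<close>, and \<open>z j\<close> for the \<open>j\<close>-th power of the braided adjoint of
  \<open>x 2\<close> applied to \<open>x 1\<close>.

  In the basis of pure tensors the quantum symmetrizer sends a word to the quantum shuffle product
  of its letters.  The Nichols algebra of a diagonal braiding is therefore the subalgebra, generated
  by the letters, of the quantum shuffle algebra: functions on words with an explicit product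
  (\<open>mon_eq_sum_permutations\<close>, \<open>coord_S_P\<close>, \<open>coord_nichols_Ad\<close>).  There, removing the first letter
  \<open>i\<close> is a skew derivation \<open>D i\<close>, and a function without constant term that is killed by all of
  them is zero.  Every relation below is proved by differentiating it.

  The derivations act on the \<open>z j\<close> in the simplest possible way: \<open>D 1\<close> kills \<open>z (j + 1)\<close>, and
  \<open>D 2\<close> sends it to \<open>c j\<close> times \<open>z j\<close>, where \<open>c j\<close> is the quantum integer of \<open>j + 1\<close> at \<open>t\<close> times
  \<open>1 - p * t ^ j\<close>.  So \<open>r\<close> is the first zero of \<open>c\<close>.

  Lower bound.  The operator \<open>E j\<close>, which applies \<open>D 2\<close> \<open>j\<close> times and then \<open>D 1\<close>, is not a twisted
  derivation in general, but it becomes one on the subalgebra killed by \<open>E 0, \<dots>, E (j - 1)\<close>.  It sends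
  \<open>z j\<close> to a nonzero scalar and kills \<open>z (j + 1), \<dots>, z r\<close> and \<open>x 2\<close>.  Hence it lowers the exponent
  of \<open>z j\<close> in a product \<open>(z 0) ^ e0 \<cdots> (z r) ^ er * (x 2) ^ d\<close> whose exponents before \<open>ej\<close> are zero,
  and the factor is a quantum integer that is nonzero as long as \<open>ej < M j\<close>.  Consequently the
  monomials with exponents below \<open>N 1, M 1, \<dots>, M r, N 2\<close> are linearly independent
  (\<open>pbw_independent\<close>).

  Equality.  Let \<open>r \<le> 2\<close>.  If \<open>z 1, z 0\<close> and \<open>z 2, z 1\<close> commute up to scalars, then the powers \<open>z j ^ M j\<close>
  vanish and left multiplication by \<open>x 1\<close> and \<open>x 2\<close> preserves the span of the same monomials
  (\<open>pbw_spanning\<close>).  The first relation follows from the hypothesis on the adjoint of \<open>x 1\<close>.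
  For the second one, let \<open>y\<close> be the braided commutator of \<open>z 2\<close> and \<open>z 1\<close>.  Then \<open>E 0\<close> and \<open>E 1\<close> kill
  \<open>y\<close>, the operator \<open>E 2\<close> sends it to \<open>c 0 * c 1 * kappa s p t\<close> times \<open>z 1\<close>, and the remaining
  derivative vanishes in all cases that occur.  If \<open>kappa s p t = 0\<close> then \<open>y = 0\<close> and the bound is
  attained.  If not, \<open>E 1 \<circ> E 2\<close> kills the products of powers of \<open>z 2\<close> and \<open>x 2\<close> but not \<open>y\<close>, so \<open>y\<close> can
  be added to them and the dimension exceeds the bound (\<open>pbw_independent_strict\<close>).

  What remains is elementary (\<open>scalars_r1\<close>, \<open>scalars_r2\<close>).  The hypotheses force \<open>s = -1\<close> or
  \<open>s * p = 1\<close>, and, for \<open>r = 2\<close>, that \<open>t\<close> is a primitive cube root of unity or \<open>p * t\<^sup>2 = 1\<close>.  Then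
  \<open>kappa s p t = 0\<close> except possibly when \<open>s = -1\<close> and \<open>t\<close> is a primitive cube root of unity; in that
  case it equals \<open>(1 + p) * (1 - p\<^sup>2 * t)\<close>, with the zeros \<open>p = -1, t, - t\<close>.  Finite group type makes
  all \<open>q i j\<close> roots of unity (\<open>root_of_unity\<close>), so an order is finite as soon as its argument differs
  from \<open>1\<close>.
\<close>

section \<open>The quantum shuffle algebra\<close>

text \<open>
  As rewrite rules these facts turn sums and differences of functions into abstractions.  The
  calculations below treat functions as elements of an algebra, and pass to values only through
  \<open>pointwise\<close>.
\<close>

declare zero_fun_apply [simp del] plus_fun_apply [simp del] minus_apply [simp del] uminus_apply [simp del]

lemmas pointwise = fun_eq_iff zero_fun_apply plus_fun_apply minus_apply uminus_apply

text \<open>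
  The left skew derivation dual to the letter \<open>i\<close>: on the basis \<open>word w\<close> it deletes a leading \<open>i\<close>.
\<close>

definition D :: "'a \<Rightarrow> ('a list \<Rightarrow> 'k) \<Rightarrow> 'a list \<Rightarrow> 'k" where
  "D i f = (\<lambda>u. f (i # u))"

text \<open>
  The algebra automorphism that multiplies the letter \<open>i\<close> by \<open>g i\<close>.  With \<open>g k = q k i\<close> or
  \<open>g k = q i k\<close> it records the scalars of the braiding between words and the letter \<open>i\<close>.
\<close>

definition tw :: "('a \<Rightarrow> 'k::field) \<Rightarrow> ('a list \<Rightarrow> 'k) \<Rightarrow> 'a list \<Rightarrow> 'k" where
  "tw g f = (\<lambda>u. prod_list (map g u) * f u)"

definition word :: "'a list \<Rightarrow> 'a list \<Rightarrow> 'k::field" where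
  "word w = (\<lambda>u. if u = w then 1 else 0)"

abbreviation X :: "'a \<Rightarrow> 'a list \<Rightarrow> 'k::field" where
  "X i \<equiv> word [i]"

lemma D_zero [simp]: "D i 0 = 0"
  by (simp add: D_def pointwise)

lemma D_add [simp]: "D i (f + g) = D i f + D i g"
  by (simp add: D_def pointwise)

lemma D_diff [simp]: "D i (f - g) = D i f - (D i g :: _ \<Rightarrow> 'k::field)"
  by (simp add: D_def pointwise)

lemma D_scale [simp]: "D i (tscale a f) = tscale a (D i f)"
  by (simp add: D_def tscale_def pointwise)

lemma D_word_Nil [simp]: "D i (word []) = 0"
  by (simp add: D_def word_def pointwise)

lemma D_word_Cons: "D i (word (j # w)) = (if i = j then word w else 0)"
  by (auto simp add: D_def word_def pointwise)

text \<open>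
  This replaces the usual argument with the ideal of relations of the Nichols algebra: a relation is
  proved by showing that all of its derivatives vanish.
\<close>

lemma eq_zero_if_D_zero:
  assumes "f [] = 0" "\<And>i. D i f = 0"
  shows "f = 0"
proof
  fix u show "f u = 0 u"
    using assms by (cases u) (auto simp: D_def pointwise)
qed

lemma eq_if_D_eq:
  fixes f g :: "'a list \<Rightarrow> 'k::field"
  assumes "f [] = g []" "\<And>i. D i f = D i g"
  shows "f = g"
  using eq_zero_if_D_zero[of "f - g"] assms by (simp add: minus_apply)

lemma word_at_Nil [simp]: "word (i # w) [] = 0"
  by (simp add: word_def)

lemma tw_zero [simp]: "tw g 0 = 0"
  by (simp add: tw_def pointwise)

lemma tw_add [simp]: "tw g (f + h) = tw g f + tw g h"
  by (simp add: tw_def pointwise algebra_simps)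

lemma tw_diff [simp]: "tw g (f - h) = tw g f - tw g h"
  by (simp add: tw_def pointwise algebra_simps)

lemma tw_scale [simp]: "tw g (tscale a f) = tscale a (tw g f)"
  by (simp add: tw_def tscale_def pointwise algebra_simps)

lemma tw_word: "tw g (word w) = tscale (prod_list (map g w)) (word w)"
  by (simp add: tw_def word_def tscale_def pointwise)

lemma D_tw: "D i (tw g f) = tscale (g i) (tw g (D i f))"
  by (simp add: tw_def D_def tscale_def pointwise)

lemma tw_commute: "tw g (tw h f) = tw h (tw g f)"
  by (simp add: tw_def pointwise)

lemma tw_tw: "tw g (tw h f) = tw (\<lambda>k. g k * h k) f"
proof
  have *: "prod_list (map (\<lambda>k. g k * h k) u) = prod_list (map g u) * prod_list (map h u)" for u
    by (induction u) (simp_all add: mult_ac)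
  show "tw g (tw h f) u = tw (\<lambda>k. g k * h k) f u" for u
    by (simp add: tw_def * mult_ac)
qed

lemma tw_at_Nil [simp]: "tw g f [] = f []"
  by (simp add: tw_def)

lemma tscale_apply: "tscale a f u = a * f u"
  by (simp add: tscale_def)

lemma sum_fun_apply: "(sum f A) u = (\<Sum>i\<in>A. f i u)"
  by (induction A rule: infinite_finite_induct) (auto simp: pointwise)

locale quantum_shuffle =
  fixes q :: "'a \<Rightarrow> 'a \<Rightarrow> 'k::field"
begin

abbreviation \<sigma> :: "'a \<Rightarrow> ('a list \<Rightarrow> 'k) \<Rightarrow> 'a list \<Rightarrow> 'k" where
  "\<sigma> i \<equiv> tw (\<lambda>k. q k i)"

text \<open>
  The quantum shuffle product, given by its skew Leibniz rule: a letter \<open>i\<close> of the second factor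
  that comes first in the shuffle has passed all letters \<open>k\<close> of the first factor, at the cost of
  \<open>q k i\<close> for each of them.
\<close>

fun shuf :: "('a list \<Rightarrow> 'k) \<Rightarrow> ('a list \<Rightarrow> 'k) \<Rightarrow> 'a list \<Rightarrow> 'k" (infixr "\<odot>" 70) where
  "(f \<odot> g) [] = f [] * g []"
| "(f \<odot> g) (i # u) = (D i f \<odot> g) u + (\<sigma> i f \<odot> D i g) u"

lemma D_shuf: "D i (f \<odot> g) = D i f \<odot> g + \<sigma> i f \<odot> D i g"
  by (simp add: D_def pointwise)

lemma shuf_add_left: "(f + g) \<odot> h = f \<odot> h + g \<odot> h"
proof
  fix u show "((f + g) \<odot> h) u = (f \<odot> h + g \<odot> h) u"
    by (induction u arbitrary: f g h) (auto simp: plus_fun_apply algebra_simps)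
qed

lemma shuf_add_right: "f \<odot> (g + h) = f \<odot> g + f \<odot> h"
proof
  fix u show "(f \<odot> (g + h)) u = (f \<odot> g + f \<odot> h) u"
    by (induction u arbitrary: f g h) (auto simp: plus_fun_apply algebra_simps)
qed

lemma shuf_scale_left: "tscale a f \<odot> g = tscale a (f \<odot> g)"
proof
  fix u show "(tscale a f \<odot> g) u = tscale a (f \<odot> g) u"
    by (induction u arbitrary: f g) (auto simp: plus_fun_apply algebra_simps tscale_apply)
qed

lemma shuf_scale_right: "f \<odot> tscale a g = tscale a (f \<odot> g)"
proof
  fix u show "(f \<odot> tscale a g) u = tscale a (f \<odot> g) u"
    by (induction u arbitrary: f g) (auto simp: plus_fun_apply algebra_simps tscale_apply)
qed

lemma shuf_zero_left [simp]: "0 \<odot> g = 0"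
  using shuf_scale_left[of 0 0 g] by simp

lemma shuf_zero_right [simp]: "g \<odot> 0 = 0"
  using shuf_scale_right[of g 0 0] by simp

lemma shuf_diff_left: "(f - g) \<odot> h = f \<odot> h - g \<odot> h"
  using shuf_add_left[of "f - g" g h] by simp

lemma shuf_diff_right: "f \<odot> (g - h) = f \<odot> g - f \<odot> h"
  using shuf_add_right[of f "g - h" h] by simp

lemma shuf_sum_right: "h \<odot> (\<Sum>i\<in>I. f i) = (\<Sum>i\<in>I. h \<odot> f i)"
  by (induction I rule: infinite_finite_induct) (simp_all add: shuf_add_right)

lemmas shuf_linear = shuf_add_left shuf_add_right shuf_scale_left shuf_scale_right
  shuf_diff_left shuf_diff_right

lemma shuf_one_left [simp]: "word [] \<odot> g = g"
proof
  fix u show "(word [] \<odot> g) u = g u"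
  proof (induction u arbitrary: g)
    case (Cons i u)
    have "(word [] \<odot> g) (i # u) = (word [] \<odot> D i g) u"
      by (simp add: tw_word zero_fun_apply)
    also have "\<dots> = g (i # u)"
      unfolding Cons by (simp add: D_def)
    finally show ?case .
  qed (simp add: word_def)
qed

lemma shuf_one_right [simp]: "g \<odot> word [] = g"
proof
  fix u show "(g \<odot> word []) u = g u"
  proof (induction u arbitrary: g)
    case (Cons i u)
    have "(g \<odot> word []) (i # u) = (D i g \<odot> word []) u"
      by (simp add: zero_fun_apply)
    also have "\<dots> = g (i # u)"
      unfolding Cons by (simp add: D_def)
    finally show ?case .
  qed (simp add: word_def)
qed

lemma tw_shuf: "tw g (f \<odot> h) = tw g f \<odot> tw g h"
proof
  fix u show "tw g (f \<odot> h) u = (tw g f \<odot> tw g h) u"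
  proof (induction u arbitrary: f h)
    case (Cons i u)
    have "tw g (f \<odot> h) (i # u) = g i * (tw g (D i f \<odot> h) u + tw g (\<sigma> i f \<odot> D i h) u)"
      by (simp add: tw_def plus_fun_apply algebra_simps)
    also have "\<dots> = (tw g f \<odot> tw g h) (i # u)"
      unfolding Cons
      by (simp add: D_tw tw_commute[of g] shuf_linear tscale_apply plus_fun_apply algebra_simps)
    finally show ?case .
  qed simp
qed

lemma shuf_assoc: "(f \<odot> g) \<odot> h = f \<odot> g \<odot> h"
proof
  fix u show "((f \<odot> g) \<odot> h) u = (f \<odot> g \<odot> h) u"
    by (induction u arbitrary: f g h)
       (simp_all add: D_shuf tw_shuf shuf_linear plus_fun_apply)
qed

end

section \<open>Linear independence and dimension\<close>

text \<open>
  The dimension only depends on the sizes of finite independent subsets, and in this form the bounds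
  are transported along injective linear maps without choosing bases.
\<close>

definition has_indep :: "('a \<Rightarrow> 'k::field) set \<Rightarrow> nat \<Rightarrow> bool" where
  "has_indep U n \<longleftrightarrow> (\<exists>S\<subseteq>U. finite S \<and> tens.independent S \<and> card S = n)"

lemma has_indep_mono: "has_indep U n \<Longrightarrow> U \<subseteq> W \<Longrightarrow> has_indep W n"
  unfolding has_indep_def by blast

lemma has_indep_family:
  fixes v :: "'i \<Rightarrow> 'a \<Rightarrow> 'k::field"
  assumes fin: "finite I" and sub: "v ` I \<subseteq> U"
    and ind: "\<And>l i. (\<Sum>i\<in>I. tscale (l i) (v i)) = 0 \<Longrightarrow> i \<in> I \<Longrightarrow> l i = 0"
  shows "has_indep U (card I)"
proof -
  have inj: "inj_on v I"
  proof (rule inj_onI, rule ccontr)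
    fix i j assume ij: "i \<in> I" "j \<in> I" "v i = v j" "i \<noteq> j"
    define l where "l = (\<lambda>k. if k = i then 1 else if k = j then -1 else (0::'k))"
    have "(\<Sum>k\<in>I. tscale (l k) (v k)) = (\<Sum>k\<in>{i, j}. tscale (l k) (v k))"
      by (rule sum.mono_neutral_right) (use ij fin in \<open>auto simp: l_def\<close>)
    also have "\<dots> = 0"
      using ij by (simp add: l_def pointwise tscale_apply)
    finally have "l i = 0" using ind ij by blast
    then show False by (simp add: l_def)
  qed
  have "tens.independent (v ` I)"
  proof (rule tens.independent_if_scalars_zero)
    show "finite (v ` I)" using fin by simp
    fix l x assume s: "(\<Sum>x\<in>v ` I. tscale (l x) x) = 0" and x: "x \<in> v ` I"
    have "(\<Sum>i\<in>I. tscale (l (v i)) (v i)) = 0"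
      using s by (simp add: sum.reindex[OF inj])
    from ind[OF this] x show "l x = 0" by blast
  qed
  with inj fin sub show ?thesis
    unfolding has_indep_def by (metis card_image finite_imageI)
qed

lemma has_indep_scalars:
  assumes "finite S" "tens.independent S" "(\<Sum>s\<in>S. tscale (l s) s) = 0" "s \<in> S"
  shows "l s = 0"
  using tens.independentD[OF assms(2,1) order_refl assms(3,4)] .

definition lin :: "(('a \<Rightarrow> 'k::field) \<Rightarrow> 'b \<Rightarrow> 'k) \<Rightarrow> bool" where
  "lin L \<longleftrightarrow> (\<forall>f g. L (f + g) = L f + L g) \<and> (\<forall>a f. L (tscale a f) = tscale a (L f))"

lemma lin_add: "lin L \<Longrightarrow> L (f + g) = L f + L g"
  and lin_scale: "lin L \<Longrightarrow> L (tscale a f) = tscale a (L f)"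
  by (simp_all add: lin_def)

lemma lin_zero: "lin L \<Longrightarrow> L 0 = 0"
  using lin_scale[of L 0 0] by simp

lemma lin_sum: "lin L \<Longrightarrow> L (\<Sum>i\<in>I. f i) = (\<Sum>i\<in>I. L (f i))"
proof (induction I rule: infinite_finite_induct)
  case (insert i I)
  then show ?case by (simp only: sum.insert[OF insert(1,2)] lin_add)
qed (simp_all add: lin_zero)

lemma lin_sum_scale: "lin L \<Longrightarrow> L (\<Sum>i\<in>I. tscale (l i) (f i)) = (\<Sum>i\<in>I. tscale (l i) (L (f i)))"
  by (simp add: lin_sum lin_scale)

lemma lin_zero_on_span:
  assumes "lin L" "\<And>s. s \<in> S \<Longrightarrow> L s = 0" "f \<in> tens.span S"
  shows "L f = 0"
  using assms(3)
  by (induction rule: tens.span_induct_alt)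
     (simp_all add: lin_zero lin_add lin_scale assms(1,2))

lemma lin_comp: "lin L \<Longrightarrow> lin L' \<Longrightarrow> lin (\<lambda>f. L (L' f))"
  by (simp add: lin_def)

lemma lin_D: "lin (D i)"
  by (simp add: lin_def)

text \<open>
  The dimension as counted in \<open>nichols_dim\<close>, for an arbitrary set of functions.
\<close>

definition sdim :: "('a \<Rightarrow> 'k::field) set \<Rightarrow> enat" where
  "sdim U = (if \<exists>B. finite B \<and> tens.span B = U then enat (tens.dim U) else \<infinity>)"

lemma has_indep_le_sdim:
  assumes "has_indep U n"
  shows "enat n \<le> sdim U"
proof (cases "\<exists>B. finite B \<and> tens.span B = U")
  case True
  then obtain B where B: "finite B" "tens.span B = U" by blast
  obtain B' where B': "B' \<subseteq> U" "tens.independent B'" "U \<subseteq> tens.span B'" "card B' = tens.dim U"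
    using tens.basis_exists by blast
  from assms obtain S where S: "S \<subseteq> U" "tens.independent S" "card S = n"
    unfolding has_indep_def by blast
  have "finite B'"
    using tens.independent_span_bound[OF B(1) B'(2)] B'(1) B(2) by blast
  then have "n \<le> card B'"
    using tens.independent_span_bound[of B' S] S B'(3) by blast
  with True B'(4) show ?thesis by (simp add: sdim_def)
qed (simp only: sdim_def, simp)

lemma sdim_le:
  assumes U: "tens.subspace U" and le: "\<And>m. has_indep U m \<Longrightarrow> m \<le> K"
  shows "sdim U \<le> enat K"
proof -
  obtain B where B: "B \<subseteq> U" "tens.independent B" "U \<subseteq> tens.span B" "card B = tens.dim U"
    using tens.basis_exists by blast
  have fin: "finite B"
  proof (rule ccontr)
    assume "infinite B"
    then obtain C where C: "C \<subseteq> B" "finite C" "card C = Suc K"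
      using infinite_arbitrarily_large by blast
    moreover have "tens.independent C"
      using tens.independent_mono[OF B(2) C(1)] .
    ultimately have "has_indep U (Suc K)"
      unfolding has_indep_def using B(1) by (intro exI[of _ C]) auto
    from le[OF this] show False by simp
  qed
  have "card B \<le> K"
    using fin B(1,2) by (intro le) (auto simp: has_indep_def)
  moreover have "tens.span B = U"
    using B U by (metis order_antisym tens.span_minimal)
  with fin have "\<exists>B. finite B \<and> tens.span B = U" by blast
  ultimately show ?thesis using B(4) by (simp add: sdim_def)
qed

lemma enat_prod: "(\<Prod>i\<in>I. enat (m i)) = enat (\<Prod>i\<in>I. m i)"
  by (induction I rule: infinite_finite_induct) (simp_all add: one_enat_def)

text \<open>
  If \<open>d = k\<close> is finite, truncating all factors at \<open>k + 1\<close> shows that each factor is at most \<open>k\<close>; in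
  particular no factor is infinite and the truncation changes nothing.
\<close>

lemma enat_prod_le:
  fixes f :: "'i \<Rightarrow> enat"
  assumes fin: "finite I" and ge1: "\<And>i. i \<in> I \<Longrightarrow> 1 \<le> f i"
    and le: "\<And>m. (\<And>i. i \<in> I \<Longrightarrow> enat (m i) \<le> f i) \<Longrightarrow> enat (\<Prod>i\<in>I. m i) \<le> d"
  shows "(\<Prod>i\<in>I. f i) \<le> d"
proof (cases d)
  case (enat k)
  define m where "m i = (case f i of enat N \<Rightarrow> min N (Suc k) | \<infinity> \<Rightarrow> Suc k)" for i
  have "enat (m i) \<le> f i" for i by (auto simp: m_def split: enat.splits)
  then have k: "(\<Prod>i\<in>I. m i) \<le> k" using le[of m] enat by simp
  have m1: "m i \<ge> 1" if "i \<in> I" for i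
    using ge1[OF that] by (auto simp: m_def one_enat_def split: enat.splits)
  have "f i = enat (m i)" if i: "i \<in> I" for i
  proof -
    have "(\<Prod>i\<in>I. m i) > 0" using m1 fin by (intro prod_pos) force
    then have "m i \<le> (\<Prod>i\<in>I. m i)" using fin i by (intro dvd_imp_le dvd_prodI)
    then have "m i \<le> k" using k by simp
    then show ?thesis by (auto simp: m_def split: enat.splits)
  qed
  then have "(\<Prod>i\<in>I. f i) = enat (\<Prod>i\<in>I. m i)" by (simp flip: enat_prod)
  with k enat show ?thesis by simp
qed simp

section \<open>Quantum integers and orders of roots of unity\<close>

definition qnum :: "'k::field \<Rightarrow> nat \<Rightarrow> 'k" where
  "qnum t n = (\<Sum>i<n. t ^ i)"

lemma qnum_0 [simp]: "qnum t 0 = 0"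
  by (simp add: qnum_def)

lemma qnum_Suc: "qnum t (Suc n) = qnum t n + t ^ n"
  by (simp add: qnum_def)

lemma qnum_Suc': "qnum t (Suc n) = 1 + t * qnum t n"
proof (induction n)
  case (Suc n)
  have "qnum t (Suc (Suc n)) = (1 + t * qnum t n) + t * t ^ n"
    by (simp only: qnum_Suc[of _ "Suc n"] Suc power_Suc)
  also have "\<dots> = 1 + t * qnum t (Suc n)"
    by (simp only: qnum_Suc[of _ n]) (simp add: algebra_simps)
  finally show ?case .
qed (simp add: qnum_def)

lemma qnum_geometric: "(t - 1) * qnum t n = t ^ n - 1"
  by (induction n) (simp_all add: qnum_Suc algebra_simps)

lemma qnum_1: "qnum (1::'k::field) n = of_nat n"
  by (simp add: qnum_def)

lemma qnum_eq_0_iff: "t \<noteq> 1 \<Longrightarrow> qnum t n = 0 \<longleftrightarrow> t ^ n = (1::'k::field)"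
  using qnum_geometric[of t n] by auto

text \<open>
  For \<open>t = 1\<close> the quantum integers are the integers, which do not vanish in characteristic \<open>0\<close>.  This
  is why the order of \<open>1\<close> has to be infinite.
\<close>

lemma qnum_nonzero_below_root_order:
  fixes t :: "'k::field_char_0"
  assumes "enat m \<le> root_order t" "0 < e" "e < m"
  shows "qnum t e \<noteq> 0"
proof (cases "t = 1")
  case True
  then show ?thesis using assms by (simp add: qnum_1)
next
  case False
  have "t ^ e \<noteq> 1"
  proof
    assume *: "t ^ e = 1"
    then have "(LEAST n. n > 0 \<and> t ^ n = 1) \<le> e"
      using assms by (intro Least_le) auto
    moreover have "root_order t = enat (LEAST n. n > 0 \<and> t ^ n = 1)"
      using * False assms(2) by (auto simp: root_order_def)
    ultimately show False using assms by simp
  qed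
  with False show ?thesis by (simp add: qnum_eq_0_iff)
qed

lemma root_order_finiteD:
  assumes "root_order t = enat N"
  shows "N > 0" "t ^ N = 1" "t \<noteq> 1" "qnum t N = 0"
proof -
  have *: "t \<noteq> 1" "\<exists>n>0. t ^ n = 1" and N: "N = (LEAST n. n > 0 \<and> t ^ n = 1)"
    using assms by (auto simp: root_order_def split: if_splits)
  from LeastI_ex[OF *(2), folded N] show "N > 0" "t ^ N = 1" "t \<noteq> 1" "qnum t N = 0"
    using * by (auto simp: qnum_eq_0_iff)
qed

lemma root_order_ge_1: "1 \<le> root_order t"
proof (cases "root_order t")
  case (enat N)
  then show ?thesis using root_order_finiteD(1)[OF enat] by (simp add: one_enat_def)
qed simp

lemma root_order_eq_2: "root_order (t::'k::field_char_0) = 2 \<longleftrightarrow> t = -1"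
proof
  assume "root_order t = 2"
  then have "t\<^sup>2 = 1" "t \<noteq> 1"
    using root_order_finiteD[of t 2] by (simp_all add: numeral_eq_enat)
  then show "t = -1" by (simp add: power2_eq_1_iff)
next
  assume t: "t = -1"
  have "(LEAST n. n > 0 \<and> t ^ n = 1) = 2"
  proof (rule Least_equality)
    show "0 < (2::nat) \<and> t ^ 2 = 1" by (simp add: t)
    fix n :: nat assume n: "0 < n \<and> t ^ n = 1"
    then have "n \<noteq> 1" by (auto simp: t)
    with n show "2 \<le> n" by simp
  qed
  moreover have "\<exists>n>0. t ^ n = 1" using t by (intro exI[of _ 2]) simp
  moreover have "t \<noteq> 1" using t by simp
  ultimately show "root_order t = 2" by (simp add: root_order_def numeral_eq_enat)
qed

lemma root_order_eq_3: "root_order (t::'k::field_char_0) = 3 \<longleftrightarrow> 1 + t + t\<^sup>2 = 0"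
proof
  assume "root_order t = 3"
  then have "t ^ 3 = 1" "t \<noteq> 1"
    using root_order_finiteD[of t 3] by (simp_all add: numeral_eq_enat)
  then have "(t - 1) * (1 + t + t\<^sup>2) = 0" by algebra
  with \<open>t \<noteq> 1\<close> show "1 + t + t\<^sup>2 = 0" by simp
next
  assume t: "1 + t + t\<^sup>2 = 0"
  have t3: "t ^ 3 = 1" using t by algebra
  have t1: "t \<noteq> 1" using t by auto
  have "(LEAST n. n > 0 \<and> t ^ n = 1) = 3"
  proof (rule Least_equality)
    show "0 < (3::nat) \<and> t ^ 3 = 1" by (simp add: t3)
    fix n :: nat assume n: "0 < n \<and> t ^ n = 1"
    have "n \<noteq> 1" using n t1 by auto
    moreover have "n \<noteq> 2"
    proof
      assume "n = 2"
      with n have "t\<^sup>2 = 1" by simp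
      with t t3 have "t = 1" by algebra
      with t1 show False by simp
    qed
    ultimately show "3 \<le> n" using n by arith
  qed
  moreover have "\<exists>n>0. t ^ n = 1" using t3 by (intro exI[of _ 3]) simp
  ultimately show "root_order t = 3" using t1 by (simp add: root_order_def numeral_eq_enat)
qed

lemma finite_root_order:
  assumes "\<exists>k>0. a ^ k = (1::'k::field)" "a \<noteq> 1"
  obtains N where "root_order a = enat N"
  using assms by (auto simp: root_order_def)

lemma root_of_unity_mult:
  "\<exists>k>0. a ^ k = (1::'k::field) \<Longrightarrow> \<exists>k>0. b ^ k = 1 \<Longrightarrow> \<exists>k>0. (a * b) ^ k = 1"
proof -
  assume "\<exists>k>0. a ^ k = 1" "\<exists>k>0. b ^ k = 1"
  then obtain k l where k: "k > 0" "a ^ k = 1" "l > 0" "b ^ l = 1" by blast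
  have "(a * b) ^ (k * l) = (a ^ k) ^ l * (b ^ l) ^ k"
    by (simp only: power_mult_distrib power_mult[symmetric] mult.commute)
  with k show ?thesis by (intro exI[of _ "k * l"]) simp
qed

lemma root_of_unity_power: "\<exists>k>0. a ^ k = (1::'k::field) \<Longrightarrow> \<exists>k>0. (a ^ n) ^ k = 1"
  by (metis power_commutes power_mult power_one mult.commute)

section \<open>The subalgebra generated by letters\<close>

context quantum_shuffle
begin

fun mon :: "'a list \<Rightarrow> 'a list \<Rightarrow> 'k" where
  "mon [] = word []"
| "mon (i # w) = X i \<odot> mon w"

text \<open>
  The Nichols algebra in coordinates, see \<open>coord_nichols\<close>.
\<close>

definition nich :: "'a set \<Rightarrow> ('a list \<Rightarrow> 'k) set" where
  "nich A = tens.span (mon ` lists A)"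

lemma mon_append: "mon (v @ w) = mon v \<odot> mon w"
  by (induction v) (simp_all add: shuf_assoc)

lemma mon_in_nich: "w \<in> lists A \<Longrightarrow> mon w \<in> nich A"
  unfolding nich_def by (rule tens.span_base) auto

lemma one_in_nich: "word [] \<in> nich A"
  using mon_in_nich[of "[]" A] by simp

lemma X_in_nich: "i \<in> A \<Longrightarrow> X i \<in> nich A"
  using mon_in_nich[of "[i]" A] by simp

lemma nich_shuf_mon: "g \<in> nich A \<Longrightarrow> w \<in> lists A \<Longrightarrow> mon w \<odot> g \<in> nich A"
  unfolding nich_def
proof (induction rule: tens.span_induct_alt)
  case (step c x y)
  then obtain v where v: "v \<in> lists A" "x = mon v" by blast
  have "mon w \<odot> x \<in> tens.span (mon ` lists A)"
    using v step unfolding v(2) mon_append[symmetric]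
    by (intro tens.span_base imageI) auto
  with step show ?case
    by (auto simp: shuf_linear intro!: tens.span_add tens.span_scale)
qed (simp add: tens.span_zero)

lemma nich_shuf: "f \<in> nich A \<Longrightarrow> g \<in> nich A \<Longrightarrow> f \<odot> g \<in> nich A"
  unfolding nich_def
proof (induction rule: tens.span_induct_alt)
  case (step c x y)
  then show ?case
    using nich_shuf_mon[unfolded nich_def]
    by (auto simp: shuf_linear intro!: tens.span_add tens.span_scale)
qed (simp add: tens.span_zero)

lemma nich_diff: "f \<in> nich A \<Longrightarrow> g \<in> nich A \<Longrightarrow> f - g \<in> nich A"
  and nich_scale: "f \<in> nich A \<Longrightarrow> tscale c f \<in> nich A"
  by (simp_all add: nich_def tens.span_diff tens.span_scale)

lemma lin_shuf: "lin ((\<odot>) f)"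
  by (simp add: lin_def shuf_linear)

lemma lin_shuf_pow: "lin ((\<odot>) f ^^ e)"
  by (induction e) (simp_all add: lin_def shuf_linear)

lemma shuf_pow_assoc: "((\<odot>) f ^^ e) g \<odot> h = ((\<odot>) f ^^ e) (g \<odot> h)"
  by (induction e) (simp_all add: shuf_assoc)

lemma shuf_pow_in:
  assumes "f \<in> U" "s \<in> U" "\<And>g h. g \<in> U \<Longrightarrow> h \<in> U \<Longrightarrow> g \<odot> h \<in> U"
  shows "((\<odot>) f ^^ e) s \<in> U"
  by (induction e) (simp_all add: assms)

lemma shuf_at_Nil_pow: "f [] = 0 \<Longrightarrow> e > 0 \<Longrightarrow> ((\<odot>) f ^^ e) g [] = 0"
  by (cases e) auto

lemma shuf_pow_eq_0:
  assumes "((\<odot>) f ^^ m) (word []) = 0" "m \<le> e"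
  shows "((\<odot>) f ^^ e) g = 0"
proof -
  have "((\<odot>) f ^^ m) h = 0" for h
    using assms(1) shuf_pow_assoc[of m f "word []" h] by simp
  moreover from assms(2) obtain d where "e = m + d" using le_Suc_ex by blast
  ultimately show ?thesis by (simp add: funpow_add)
qed

text \<open>
  Powers are iterated left multiplications.  Every factor \<open>y\<close> that \<open>L\<close> passes contributes \<open>\<rho>\<close>, so the
  sum over the factors that are hit is the quantum integer of \<open>e\<close>.
\<close>

lemma twisted_derivation_pow:
  assumes lin: "lin L"
    and der: "\<And>f. f \<in> U \<Longrightarrow> L (y \<odot> f) = tscale c f + tscale \<rho> (y \<odot> L f)"
    and closed: "\<And>f. f \<in> U \<Longrightarrow> y \<odot> f \<in> U"
    and s: "s \<in> U" "L s = 0"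
  shows "L (((\<odot>) y ^^ e) s) = tscale (c * qnum \<rho> e) (((\<odot>) y ^^ (e - 1)) s)"
proof -
  have U: "((\<odot>) y ^^ e) s \<in> U" for e
    by (induction e) (simp_all add: s closed)
  show ?thesis
  proof (induction e)
    case (Suc e)
    have "L (((\<odot>) y ^^ Suc e) s) = tscale c (((\<odot>) y ^^ e) s)
            + tscale (\<rho> * c * qnum \<rho> e) (y \<odot> ((\<odot>) y ^^ (e - 1)) s)"
      by (simp add: der[OF U] Suc shuf_linear mult_ac)
    also have "\<dots> = tscale (c * qnum \<rho> (Suc e)) (((\<odot>) y ^^ e) s)"
    proof (cases e)
      case 0
      then show ?thesis by (simp add: qnum_Suc)
    next
      case (Suc d)
      then show ?thesis 
        by (simp add: qnum_Suc' pointwise tscale_apply algebra_simps)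
    qed
    finally show ?case by simp
  qed (simp add: s)
qed

text \<open>
  A linear relation between the \<open>y ^ e * s\<close> can be differentiated: \<open>L\<close> removes the terms with
  \<open>e = 0\<close> and shifts the others by one, with nonzero factors.  By induction on the range of exponents
  the coefficients with \<open>e > 0\<close> vanish, and what is left is a relation in \<open>W\<close>.
\<close>

lemma has_indep_pow:
  assumes lin: "lin L"
    and der: "\<And>f. f \<in> U \<Longrightarrow> L (y \<odot> f) = tscale c f + tscale \<rho> (y \<odot> L f)"
    and closed: "\<And>f. f \<in> U \<Longrightarrow> y \<odot> f \<in> U"
    and W: "\<And>s. s \<in> W \<Longrightarrow> s \<in> U \<and> L s = 0"
    and c: "c \<noteq> 0" and m: "\<And>e. 0 < e \<Longrightarrow> e < m \<Longrightarrow> qnum \<rho> e \<noteq> 0"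
    and ind: "has_indep W n"
  shows "has_indep {((\<odot>) y ^^ e) s | e s. s \<in> W} (m * n)"
proof -
  from ind obtain S where S: "S \<subseteq> W" "finite S" "tens.independent S" "card S = n"
    unfolding has_indep_def by blast
  have L: "L (((\<odot>) y ^^ e) s) = tscale (c * qnum \<rho> e) (((\<odot>) y ^^ (e - 1)) s)" if "s \<in> S" for s e
    using twisted_derivation_pow[of L U y c \<rho> s e] assms S that by blast
  have *: "l (e, s) = 0"
    if "(\<Sum>(e, s)\<in>{..<m'} \<times> S. tscale (l (e, s)) (((\<odot>) y ^^ e) s)) = 0" "e < m'" "s \<in> S" "m' \<le> m"
    for m' l e s
    using that
  proof (induction m' arbitrary: l e s)
    case (Suc m')
    have eq: "(\<Sum>s\<in>S. tscale (l (0, s)) s)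
       + (\<Sum>(e, s)\<in>{..<m'} \<times> S. tscale (l (Suc e, s)) (((\<odot>) y ^^ Suc e) s)) = 0"
      using Suc.prems(1)
      by (simp flip: sum.cartesian_product add: sum.lessThan_Suc_shift del: sum.lessThan_Suc)
    have "L (\<Sum>s\<in>S. tscale (l (0, s)) s) = 0"
      using S W by (subst lin_sum_scale[OF lin]) (auto intro!: sum.neutral)
    then have "L (\<Sum>(e, s)\<in>{..<m'} \<times> S. tscale (l (Suc e, s)) (((\<odot>) y ^^ Suc e) s)) = 0"
      using arg_cong[OF eq, of L] by (simp add: lin_add[OF lin] lin_zero[OF lin])
    also have "L (\<Sum>(e, s)\<in>{..<m'} \<times> S. tscale (l (Suc e, s)) (((\<odot>) y ^^ Suc e) s))
       = (\<Sum>(e, s)\<in>{..<m'} \<times> S. tscale (l (Suc e, s) * (c * qnum \<rho> (Suc e))) (((\<odot>) y ^^ e) s))"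
      by (subst lin_sum[OF lin], rule sum.cong)
         (auto simp: lin_scale[OF lin] L simp del: funpow.simps)
    finally have l: "l (Suc e, s) * (c * qnum \<rho> (Suc e)) = 0" if "e < m'" "s \<in> S" for e s
      using Suc.IH[of "\<lambda>(e, s). l (Suc e, s) * (c * qnum \<rho> (Suc e))" e s] that Suc.prems
      by simp
    have l1: "l (Suc e, s) = 0" if "e < m'" "s \<in> S" for e s
      using l[OF that] c m[of "Suc e"] that Suc.prems by auto
    have "(\<Sum>(e, s)\<in>{..<m'} \<times> S. tscale (l (Suc e, s)) (((\<odot>) y ^^ Suc e) s)) = 0"
      by (rule sum.neutral) (auto simp: l1)
    with eq have "(\<Sum>s\<in>S. tscale (l (0, s)) s) = 0" by simp
    from has_indep_scalars[OF S(2,3) this] have "l (0, s) = 0" if "s \<in> S" for s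
      using that by blast
    with l1 Suc.prems show ?case by (cases e) auto
  qed simp
  have "has_indep {((\<odot>) y ^^ e) s | e s. s \<in> W} (card ({..<m} \<times> S))"
  proof (rule has_indep_family[where v = "\<lambda>(e, s). ((\<odot>) y ^^ e) s"])
    fix l i assume "(\<Sum>i\<in>{..<m} \<times> S. tscale (l i) (case i of (e, s) \<Rightarrow> ((\<odot>) y ^^ e) s)) = 0"
      and "i \<in> {..<m} \<times> S"
    then show "l i = 0"
      using *[of l m "fst i" "snd i"] by (auto simp: case_prod_unfold)
  qed (use S in auto)
  then show ?thesis using S by (simp add: card_cartesian_product)
qed

lemma D_X_pow:
  "D i (((\<odot>) (X b) ^^ e) (word []))
    = (if i = b then tscale (qnum (q b b) e) (((\<odot>) (X b) ^^ (e - 1)) (word [])) else 0)"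
proof (cases "i = b")
  case True
  have "D b (((\<odot>) (X b) ^^ e) (word []))
    = tscale (1 * qnum (q b b) e) (((\<odot>) (X b) ^^ (e - 1)) (word []))"
    by (rule twisted_derivation_pow[OF lin_D, where U = UNIV])
       (auto simp: D_shuf D_word_Cons tw_word shuf_linear)
  with True show ?thesis by simp
next
  case False
  then have "D i (((\<odot>) (X b) ^^ e) (word [])) = 0"
    by (induction e) (simp_all add: D_shuf D_word_Cons)
  with False show ?thesis by simp
qed

lemma X_pow_eq_0:
  assumes "qnum (q b b) n = 0" "n > 0"
  shows "((\<odot>) (X b) ^^ n) (word []) = 0"
  by (rule eq_zero_if_D_zero)
     (use assms in \<open>auto simp: D_X_pow shuf_at_Nil_pow\<close>)

end

section \<open>Iterated braided commutators\<close>

context quantum_shuffle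
begin

text \<open>
  The iterated braided commutators of the letter \<open>b\<close> with the letter \<open>a\<close>, see
  \<open>coord_nichols_Ad_pow\<close>.  The scalar is that of braiding \<open>b\<close> past the degree of \<open>a\<close> and \<open>n\<close>
  letters \<open>b\<close>.
\<close>

fun ad :: "'a \<Rightarrow> 'a \<Rightarrow> nat \<Rightarrow> 'a list \<Rightarrow> 'k" where
  "ad a b 0 = X a"
| "ad a b (Suc n) = X b \<odot> ad a b n - tscale (q b a * q b b ^ n) (ad a b n \<odot> X b)"

declare ad.simps(2) [simp del]

text \<open>
  The factor that \<open>D b\<close> splits off from \<open>ad a b (Suc n)\<close>; its first zero determines the nilpotency
  order.
\<close>

definition ad_coeff :: "'a \<Rightarrow> 'a \<Rightarrow> nat \<Rightarrow> 'k" where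
  "ad_coeff a b n = qnum (q b b) (Suc n) * (1 - q a b * q b a * q b b ^ n)"

text \<open>
  The scalar of braiding the degree of \<open>ad a b n\<close> with itself.
\<close>

definition ad_diag :: "'a \<Rightarrow> 'a \<Rightarrow> nat \<Rightarrow> 'k" where
  "ad_diag a b n = q a a * (q a b * q b a) ^ n * q b b ^ n\<^sup>2"

lemma ad_in_nich: "ad a b n \<in> nich {a, b}"
  by (induction n) (auto simp: ad.simps(2) intro!: X_in_nich nich_diff nich_scale nich_shuf)

lemma tw_ad: "tw g (ad a b n) = tscale (g a * g b ^ n) (ad a b n)"
proof (induction n)
  case 0
  then show ?case by (simp add: tw_word)
next
  case (Suc n)
  then show ?case
    by (simp add: ad.simps(2) tw_word tw_shuf shuf_linear)
       (simp add: pointwise tscale_apply algebra_simps)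
qed

lemma ad_coeff_Suc:
  "ad_coeff a b (Suc n) = 1 - q a b * q b a * q b b ^ (Suc n + Suc n) + q b b * ad_coeff a b n"
  unfolding ad_coeff_def power_add
proof -
  define s where "s = qnum (q b b) (Suc n)"
  define t where "t = q b b ^ n"
  have 1: "qnum (q b b) (Suc (Suc n)) = 1 + q b b * s" "1 + q b b * s = s + q b b * t"
    using qnum_Suc[of "q b b" "Suc n"] qnum_Suc'[of "q b b" "Suc n"] by (simp_all add: s_def t_def)
  have 2: "q b b * s = s + q b b * t - 1" using 1(2) by (simp add: algebra_simps)
  show "qnum (q b b) (Suc (Suc n)) * (1 - q a b * q b a * q b b ^ Suc n) =
    1 - q a b * q b a * (q b b ^ Suc n * q b b ^ Suc n) +
    q b b * (qnum (q b b) (Suc n) * (1 - q a b * q b a * q b b ^ n))"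
    unfolding 1(1) s_def[symmetric] power_Suc t_def[symmetric]
    using 2 by algebra
qed

text \<open>
  It follows that \<open>ad a b n\<close> is a multiple of the single word \<open>b \<dots> b a\<close>.
\<close>

lemma D_ad_Suc:
  assumes "a \<noteq> b"
  shows "D i (ad a b (Suc n)) = (if i = b then tscale (ad_coeff a b n) (ad a b n) else 0)"
proof (induction n arbitrary: i)
  case 0
  show ?case
    using assms
    by (simp add: ad.simps(2) D_word_Cons D_shuf tw_word shuf_linear)
       (auto simp: pointwise tscale_apply ad_coeff_def qnum_Suc algebra_simps)
next
  case (Suc n)
  show ?case
  proof (cases "i = b")
    case True
    have "D b (ad a b (Suc (Suc n))) =
        tscale (1 - q a b * q b a * q b b ^ (Suc n + Suc n)) (ad a b (Suc n)) +
        tscale (q b b * ad_coeff a b n) (ad a b (Suc n))"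
      by (simp add: ad.simps(2)[of a b "Suc n"] D_shuf Suc tw_ad D_word_Cons tw_word shuf_linear)
         (simp add: ad.simps(2)[of a b n] shuf_linear, simp add: pointwise tscale_apply algebra_simps power_add)
    with True show ?thesis
      by (simp add: ad_coeff_Suc tens.scale_left_distrib flip: power_add)
  next
    case False
    then show ?thesis
      by (simp add: ad.simps(2)[of a b "Suc n"] D_shuf Suc D_word_Cons)
  qed
qed

lemma ad_at_Nil: "ad a b n [] = 0"
  by (cases n) (simp_all add: ad.simps(2) minus_apply tscale_apply)

lemma ad_Suc_eq_0_iff:
  assumes "a \<noteq> b"
  shows "ad a b (Suc j) = 0 \<longleftrightarrow> ad_coeff a b j = 0 \<or> ad a b j = 0"
proof -
  have "ad a b (Suc j) = 0 \<longleftrightarrow> (\<forall>i. D i (ad a b (Suc j)) = 0)"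
    using eq_zero_if_D_zero[of "ad a b (Suc j)"] ad_at_Nil[of a b "Suc j"] by auto
  also have "\<dots> \<longleftrightarrow> ad_coeff a b j = 0 \<or> ad a b j = 0"
    by (auto simp: D_ad_Suc[OF assms] tens.scale_eq_0_iff)
  finally show ?thesis .
qed

lemma ad_coeff_nonzero_if_ad_nonzero:
  assumes "a \<noteq> b"
  shows "ad a b r \<noteq> 0 \<Longrightarrow> i < r \<Longrightarrow> ad_coeff a b i \<noteq> 0"
  by (induction r) (auto simp: ad_Suc_eq_0_iff[OF assms] less_Suc_eq)

end

section \<open>Linear independence of the PBW monomials\<close>

context quantum_shuffle
begin

primrec E :: "'a \<Rightarrow> 'a \<Rightarrow> nat \<Rightarrow> ('a list \<Rightarrow> 'k) \<Rightarrow> 'a list \<Rightarrow> 'k" where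
  "E a b 0 f = D a f"
| "E a b (Suc j) f = E a b j (D b f)"

lemma lin_E: "lin (E a b j)"
  by (induction j) (simp_all add: lin_def)

lemma E_tw: "E a b j (tw h f) = tscale (h a * h b ^ j) (tw h (E a b j f))"
proof (induction j arbitrary: f)
  case (Suc j)
  then show ?case
    by (simp add: D_tw lin_scale[OF lin_E] mult_ac)
qed (simp add: D_tw)

text \<open>
  The subalgebra on which \<open>E a b j\<close> is a twisted derivation.
\<close>

definition killed :: "'a \<Rightarrow> 'a \<Rightarrow> nat \<Rightarrow> ('a list \<Rightarrow> 'k) set" where
  "killed a b j = {f. \<forall>i<j. E a b i f = 0}"

lemma killed_0 [simp]: "killed a b 0 = UNIV"
  by (simp add: killed_def)

lemma killed_D: "f \<in> killed a b (Suc j) \<Longrightarrow> D b f \<in> killed a b j"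
  by (force simp: killed_def simp flip: E.simps(2))

lemma killed_tw: "f \<in> killed a b j \<Longrightarrow> tw h f \<in> killed a b j"
  by (simp add: killed_def E_tw)

lemma killed_Suc: "f \<in> killed a b (Suc j) \<longleftrightarrow> f \<in> killed a b j \<and> E a b j f = 0"
  by (auto simp: killed_def less_Suc_eq)

text \<open>
  Expand \<open>D b\<close> applied \<open>j\<close> times to \<open>f \<odot> g\<close> by the Leibniz rule.  In a mixed term both factors carry
  fewer than \<open>j\<close> derivations, so \<open>D a\<close> applied to either of them gives zero by hypothesis.  The
  induction peels off one \<open>D b\<close> at a time.
\<close>

lemma E_shuf:
  assumes "f \<in> killed a b j" "g \<in> killed a b j"
  shows "E a b j (f \<odot> g) = E a b j f \<odot> g + tw (\<lambda>k. q k a * q k b ^ j) f \<odot> E a b j g"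
  using assms
proof (induction j arbitrary: f g)
  case (Suc j)
  note fg = Suc.prems[THEN killed_D] Suc.prems[unfolded killed_Suc]
  have "E a b (Suc j) (f \<odot> g) = E a b j (D b f \<odot> g) + E a b j (\<sigma> b f \<odot> D b g)"
    by (simp add: D_shuf lin_add[OF lin_E])
  also have "E a b j (D b f \<odot> g) = E a b (Suc j) f \<odot> g"
    using Suc.IH[of "D b f" g] fg by simp
  also have "E a b j (\<sigma> b f \<odot> D b g) = tw (\<lambda>k. q k a * q k b ^ Suc j) f \<odot> E a b (Suc j) g"
    using Suc.IH[of "\<sigma> b f" "D b g"] fg by (simp add: killed_tw E_tw tw_tw mult_ac)
  finally show ?case .
qed (simp add: D_shuf)

lemma killed_shuf: "f \<in> killed a b j \<Longrightarrow> g \<in> killed a b j \<Longrightarrow> f \<odot> g \<in> killed a b j"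
  by (induction j) (simp_all add: killed_Suc E_shuf)

lemma E_ad:
  assumes "a \<noteq> b" "j \<le> n"
  shows "E a b j (ad a b n) = (if j = n then tscale (\<Prod>i<n. ad_coeff a b i) (word []) else 0)"
  using assms(2)
proof (induction n arbitrary: j)
  case 0
  then show ?case by (simp add: D_word_Cons)
next
  case (Suc n)
  show ?case
  proof (cases j)
    case 0
    then show ?thesis using assms(1) by (simp add: D_ad_Suc)
  next
    case (Suc i)
    then show ?thesis
      using assms(1) Suc.IH[of i] Suc.prems
      by (simp add: D_ad_Suc lin_scale[OF lin_E] mult_ac)
  qed
qed

lemma ad_killed: "a \<noteq> b \<Longrightarrow> ad a b n \<in> killed a b n"
  by (simp add: killed_def E_ad)

lemma E_X: "a \<noteq> b \<Longrightarrow> E a b j (X b) = 0"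
proof (cases j)
  case (Suc i)
  have "E a b i (word []) = 0" for i
    by (induction i) (simp_all add: lin_zero[OF lin_E])
  with Suc show ?thesis by (simp add: D_word_Cons)
qed (simp add: D_word_Cons)

lemma E_one: "E a b j (word []) = 0"
  by (induction j) (simp_all add: lin_zero[OF lin_E])

lemma nich_killed_shuf:
  "f \<in> nich A \<inter> killed a b j \<Longrightarrow> g \<in> nich A \<inter> killed a b j \<Longrightarrow> f \<odot> g \<in> nich A \<inter> killed a b j"
  by (simp add: nich_shuf killed_shuf)

lemma tw_ad_self:
  "tw (\<lambda>k. q k a * q k b ^ j) (ad a b j) = tscale (ad_diag a b j) (ad a b j)"
  by (simp add: tw_ad ad_diag_def power_mult_distrib power2_eq_square power_mult mult_ac)

lemma E_ad_shuf:
  assumes "a \<noteq> b" "f \<in> killed a b j"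
  shows "E a b j (ad a b j \<odot> f)
    = tscale (\<Prod>i<j. ad_coeff a b i) f + tscale (ad_diag a b j) (ad a b j \<odot> E a b j f)"
  using assms
  by (simp add: E_shuf ad_killed E_ad tw_ad_self shuf_linear)

lemma E_ad_pow:
  assumes "a \<noteq> b" "s \<in> killed a b (Suc j)"
  shows "E a b j (((\<odot>) (ad a b j) ^^ e) s)
    = tscale ((\<Prod>i<j. ad_coeff a b i) * qnum (ad_diag a b j) e) (((\<odot>) (ad a b j) ^^ (e - 1)) s)"
  by (rule twisted_derivation_pow[OF lin_E, where U = "killed a b j"])
     (use assms in \<open>auto simp: E_ad_shuf killed_shuf ad_killed killed_Suc\<close>)

lemma has_indep_ad_pow:
  assumes ab: "a \<noteq> b" and c: "\<And>i. i < j \<Longrightarrow> ad_coeff a b i \<noteq> 0"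
    and m: "\<And>e. 0 < e \<Longrightarrow> e < m \<Longrightarrow> qnum (ad_diag a b j) e \<noteq> 0"
    and ind: "has_indep (nich {a, b} \<inter> killed a b (Suc j)) n"
  shows "has_indep {((\<odot>) (ad a b j) ^^ e) s | e s. s \<in> nich {a, b} \<inter> killed a b (Suc j)} (m * n)"
  by (rule has_indep_pow[OF lin_E[of a b j], where U = "killed a b j"
        and c = "\<Prod>i<j. ad_coeff a b i" and \<rho> = "ad_diag a b j"])
     (use assms in \<open>auto simp: E_ad_shuf killed_shuf ad_killed killed_Suc\<close>)

lemma ad_pow_in:
  assumes "a \<noteq> b" "s \<in> nich {a, b} \<inter> killed a b j"
  shows "((\<odot>) (ad a b j) ^^ e) s \<in> nich {a, b} \<inter> killed a b j"
  by (rule shuf_pow_in[OF _ assms(2) nich_killed_shuf]) (auto simp: ad_in_nich ad_killed assms)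

text \<open>
  The powers of \<open>ad a b (k - 1), \<dots>, ad a b 0\<close> are multiplied on from the left, each time with the
  twisted derivation that sees the new factor and kills everything to its right.
\<close>

lemma has_indep_extend:
  assumes ab: "a \<noteq> b"
    and ind: "has_indep (nich {a, b} \<inter> killed a b k) n"
    and c: "\<And>i. Suc i < k \<Longrightarrow> ad_coeff a b i \<noteq> 0"
    and m: "\<And>j e. j < k \<Longrightarrow> 0 < e \<Longrightarrow> e < m j \<Longrightarrow> qnum (ad_diag a b j) e \<noteq> 0"
  shows "has_indep (nich {a, b}) (n * (\<Prod>j<k. m j))"
  using ind c m
proof (induction k arbitrary: n)
  case (Suc k)
  have "has_indep {((\<odot>) (ad a b k) ^^ e) s | e s. s \<in> nich {a, b} \<inter> killed a b (Suc k)} (m k * n)"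
    using Suc.prems by (intro has_indep_ad_pow ab) auto
  then have "has_indep (nich {a, b} \<inter> killed a b k) (m k * n)"
    by (rule has_indep_mono) (use ad_pow_in[OF ab] in \<open>auto simp: killed_Suc\<close>)
  then have "has_indep (nich {a, b}) (m k * n * (\<Prod>j<k. m j))"
    by (rule Suc.IH) (use Suc.prems in auto)
  then show ?case by (simp add: mult_ac)
qed simp

lemma has_indep_X_pow:
  assumes ab: "a \<noteq> b" and n: "\<And>e. 0 < e \<Longrightarrow> e < n \<Longrightarrow> qnum (q b b) e \<noteq> 0"
  shows "has_indep (nich {a, b} \<inter> killed a b k) n"
proof -
  have one: "has_indep {word [] :: 'a list \<Rightarrow> 'k} 1"
  proof -
    have "word [] \<noteq> (0 :: 'a list \<Rightarrow> 'k)"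
      by (auto simp: word_def fun_eq_iff zero_fun_apply)
    then have "tens.independent {word [] :: 'a list \<Rightarrow> 'k}"
      by (simp add: tens.dependent_single)
    then show ?thesis unfolding has_indep_def by (intro exI[of _ "{word []}"]) auto
  qed
  have "has_indep {((\<odot>) (X b) ^^ e) s | e s. s \<in> {word []}} (n * 1)"
    by (rule has_indep_pow[OF lin_D[of b], where U = UNIV and c = 1 and \<rho> = "q b b"])
       (use n one in \<open>auto simp: D_shuf D_word_Cons tw_word shuf_linear\<close>)
  moreover have "((\<odot>) (X b) ^^ e) (word []) \<in> nich {a, b} \<inter> killed a b k" for e
    by (rule shuf_pow_in[OF _ _ nich_killed_shuf])
       (auto simp: X_in_nich one_in_nich killed_def E_X[OF ab] E_one)
  ultimately show ?thesis
    by (auto elim!: has_indep_mono)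
qed

text \<open>
  The lower bound for the dimension.  It counts the monomials with exponents \<open>ej < m j\<close> of
  \<open>ad a b j\<close>, in increasing order of \<open>j\<close>, followed by a power of \<open>b\<close> with exponent less than \<open>n\<close>.
\<close>

theorem pbw_independent:
  assumes ab: "a \<noteq> b" and c: "\<And>i. i < r \<Longrightarrow> ad_coeff a b i \<noteq> 0"
    and m: "\<And>j e. j \<le> r \<Longrightarrow> 0 < e \<Longrightarrow> e < m j \<Longrightarrow> qnum (ad_diag a b j) e \<noteq> 0"
    and n: "\<And>e. 0 < e \<Longrightarrow> e < n \<Longrightarrow> qnum (q b b) e \<noteq> 0"
  shows "has_indep (nich {a, b}) (n * (\<Prod>j\<le>r. m j))"
  using has_indep_extend[OF ab has_indep_X_pow[OF ab n], of n "Suc r" m] c m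
  by (simp add: lessThan_Suc_atMost)

end

section \<open>Commutators of consecutive root vectors\<close>

text \<open>
  The obstruction to \<open>ad a b 2\<close> and \<open>ad a b 1\<close> commuting up to a scalar, in terms of
  \<open>s = q a a\<close>, \<open>p = q a b * q b a\<close> and \<open>t = q b b\<close>; it appears in \<open>D_ad_comm2\<close>.
\<close>

definition kappa :: "'k::field \<Rightarrow> 'k \<Rightarrow> 'k \<Rightarrow> 'k" where
  "kappa s p t = 1 + s * p * t * (1 + t) - s * p * t * p * t * (1 + t) - p * t\<^sup>2 * (s * p * t)\<^sup>2"

context quantum_shuffle
begin

text \<open>
  The scalar of braiding the degree of \<open>ad a b (Suc j)\<close> past that of \<open>ad a b j\<close>.
\<close>

definition ad_exch :: "'a \<Rightarrow> 'a \<Rightarrow> nat \<Rightarrow> 'k" where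
  "ad_exch a b j = (q a a * q b a ^ Suc j) * (q a b * q b b ^ Suc j) ^ j"

definition ad_comm :: "'a \<Rightarrow> 'a \<Rightarrow> nat \<Rightarrow> 'a list \<Rightarrow> 'k" where
  "ad_comm a b j = ad a b (Suc j) \<odot> ad a b j - tscale (ad_exch a b j) (ad a b j \<odot> ad a b (Suc j))"

lemma ad_comm_in_nich: "ad_comm a b j \<in> nich {a, b}"
  unfolding ad_comm_def by (intro nich_diff nich_scale nich_shuf ad_in_nich)

lemma ad_comm_at_Nil: "ad_comm a b 0 [] = 0" "ad_comm a b (Suc j) [] = 0"
  by (simp_all add: ad_comm_def minus_apply tscale_apply ad.simps(2))

lemma D_ad_comm_0:
  assumes "a \<noteq> b"
  shows "D i (ad_comm a b 0) = (if i = b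
    then tscale (ad_coeff a b 0 * (1 - q a a * (q a b * q b a))) (X a \<odot> X a) else 0)"
  using assms unfolding ad_comm_def
  by (simp add: D_shuf D_ad_Suc D_word_Cons tw_ad tw_word shuf_linear)
     (auto simp: pointwise tscale_apply ad_exch_def algebra_simps)

text \<open>
  The first and, below, the second derivative of \<open>ad_comm a b 1\<close> in the direction \<open>b\<close>.
\<close>

definition ad_comm1 :: "'a \<Rightarrow> 'a \<Rightarrow> 'a list \<Rightarrow> 'k" where
  "ad_comm1 a b = tscale (ad_coeff a b 1 * (1 - ad_exch a b 1 * (q a b * q b b))) (ad a b 1 \<odot> ad a b 1)
     + tscale (ad_coeff a b 0 * (q a b * q b b ^ 2)) (ad a b 2 \<odot> X a)
     - tscale (ad_exch a b 1 * ad_coeff a b 0) (X a \<odot> ad a b 2)"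

definition ad_comm2 :: "'a \<Rightarrow> 'a \<Rightarrow> 'a list \<Rightarrow> 'k" where
  "ad_comm2 a b = tscale (ad_coeff a b 0 * ad_coeff a b 1 * (1 - ad_exch a b 1 * (q a b * (1 + q b b)))) (X a \<odot> ad a b 1)
     + tscale (ad_coeff a b 0 * ad_coeff a b 1 * (q a b * q b b * (1 + q b b) - ad_exch a b 1 * (q a b * q b b) ^ 2))
         (ad a b 1 \<odot> X a)"

lemma D_ad_comm_1:
  assumes "a \<noteq> b"
  shows "D i (ad_comm a b 1) = (if i = b then ad_comm1 a b else 0)"
  using assms unfolding ad_comm_def ad_comm1_def One_nat_def numeral_2_eq_2
  by (simp add: D_shuf D_ad_Suc D_word_Cons tw_ad tw_word shuf_linear)
     (auto simp: pointwise tscale_apply algebra_simps)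

lemma D_ad_comm1:
  assumes "a \<noteq> b"
  shows "D i (ad_comm1 a b) = (if i = b then ad_comm2 a b else 0)"
  using assms unfolding ad_comm2_def ad_comm1_def One_nat_def numeral_2_eq_2
  by (simp add: D_shuf D_ad_Suc D_word_Cons tw_ad tw_word shuf_linear)
     (auto simp: pointwise tscale_apply ad_exch_def algebra_simps)

text \<open>
  After two derivations in the direction \<open>b\<close>, exactly two obstructions to the vanishing of
  \<open>ad_comm a b 1\<close> are left: \<open>kappa\<close> in the direction \<open>a\<close>, and a multiple of the square of \<open>a\<close> in the
  direction \<open>b\<close>.
\<close>

lemma D_ad_comm2:
  assumes "a \<noteq> b"
  shows "D i (ad_comm2 a b) = (if i = a then tscale (ad_coeff a b 0 * ad_coeff a b 1 * kappa (q a a) (q a b * q b a) (q b b)) (ad a b 1)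
    else if i = b then tscale ((ad_coeff a b 0)\<^sup>2 * ad_coeff a b 1 * q a b * (1 + q b b + q b b ^ 2)
      * (1 - q a a * (q a b * q b a)\<^sup>2 * q b b ^ 2)) (X a \<odot> X a) else 0)"
  using assms unfolding ad_comm2_def One_nat_def
  by (simp add: D_shuf D_ad_Suc D_word_Cons tw_ad tw_word shuf_linear)
     (auto simp: pointwise tscale_apply ad_exch_def kappa_def algebra_simps power2_eq_square)

text \<open>
  If \<open>kappa\<close> does not vanish, \<open>ad_comm a b 1\<close> behaves like a further generator.  It lies in the same
  subalgebra \<open>killed a b 2\<close> as the products of powers of \<open>ad a b 2\<close> and \<open>b\<close>, but \<open>E a b 1\<close> after
  \<open>E a b 2\<close> kills these products and not the commutator.  So it enlarges the family by one element
  before the powers of \<open>ad a b 1\<close> and \<open>ad a b 0\<close> are multiplied on.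
\<close>

theorem pbw_independent_strict:
  assumes ab: "a \<noteq> b" and c: "ad_coeff a b 0 \<noteq> 0" "ad_coeff a b 1 \<noteq> 0" and kap: "kappa (q a a) (q a b * q b a) (q b b) \<noteq> 0"
    and m: "\<And>j e. j \<le> 2 \<Longrightarrow> 0 < e \<Longrightarrow> e < m j \<Longrightarrow> qnum (ad_diag a b j) e \<noteq> 0"
    and n: "\<And>e. 0 < e \<Longrightarrow> e < n \<Longrightarrow> qnum (q b b) e \<noteq> 0"
  shows "has_indep (nich {a, b}) ((m 2 * n + 1) * (m 0 * m 1))"
proof -
  define Y where "Y = {((\<odot>) (ad a b 2) ^^ e) s | e s. s \<in> nich {a, b} \<inter> killed a b (Suc 2)}"
  have "has_indep Y (m 2 * n)"
    unfolding Y_def using c m n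
    by (intro has_indep_ad_pow has_indep_X_pow ab) (auto simp: less_2_cases_iff)
  then obtain S where S: "S \<subseteq> Y" "finite S" "tens.independent S" "card S = m 2 * n"
    unfolding has_indep_def by blast
  have Y: "s \<in> nich {a, b} \<inter> killed a b 2" "E a b 1 (E a b 2 s) = 0" if "s \<in> Y" for s
  proof -
    from that obtain e t where t: "t \<in> nich {a, b} \<inter> killed a b (Suc 2)"
      and s: "s = ((\<odot>) (ad a b 2) ^^ e) t"
      unfolding Y_def by blast
    have *: "((\<odot>) (ad a b 2) ^^ e) t \<in> nich {a, b} \<inter> killed a b 2" for e
      using t by (intro ad_pow_in[OF ab]) (auto simp: killed_def)
    then show "s \<in> nich {a, b} \<inter> killed a b 2" unfolding s .
    have "E a b 2 s = tscale ((\<Prod>i<2. ad_coeff a b i) * qnum (ad_diag a b 2) e)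
        (((\<odot>) (ad a b 2) ^^ (e - 1)) t)"
      unfolding s by (rule E_ad_pow[OF ab]) (use t in auto)
    then show "E a b 1 (E a b 2 s) = 0"
      using *[of "e - 1", THEN IntD2, unfolded killed_def, simplified, rule_format, of 1]
      by (simp add: lin_scale[OF lin_E])
  qed
  have ad_comm: "ad_comm a b 1 \<in> killed a b 2"
    using ab D_ad_comm_1[OF ab, of a] D_ad_comm_1[OF ab, of b] D_ad_comm1[OF ab, of a]
    by (auto simp: killed_def less_2_cases_iff)
  have "E a b 2 (ad_comm a b 1) = tscale (ad_coeff a b 0 * ad_coeff a b 1 * kappa (q a a) (q a b * q b a) (q b b)) (ad a b 1)"
    using ab by (simp add: numeral_2_eq_2 D_ad_comm_1[unfolded One_nat_def] D_ad_comm1 D_ad_comm2)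
  then have "E a b 1 (E a b 2 (ad_comm a b 1))
      = tscale (ad_coeff a b 0 * ad_coeff a b 1 * kappa (q a a) (q a b * q b a) (q b b) * ad_coeff a b 0) (word [])"
    using ab by (simp only: lin_scale[OF lin_E] E_ad[OF ab order_refl]) simp
  moreover have "tscale x (word []) = (0 :: 'a list \<Rightarrow> 'k) \<Longrightarrow> x = 0" for x
    by (drule fun_cong[of _ _ "[]"]) (simp add: word_def tscale_apply zero_fun_apply)
  ultimately have "E a b 1 (E a b 2 (ad_comm a b 1)) \<noteq> 0"
    using c kap by auto
  then have notin: "ad_comm a b 1 \<notin> tens.span S"
    using lin_zero_on_span[OF lin_comp[OF lin_E[of a b 1] lin_E[of a b 2]], of S] Y(2) S(1)
    by blast
  then have "ad_comm a b 1 \<notin> S" using tens.span_base by blast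
  have "has_indep (nich {a, b} \<inter> killed a b 2) (m 2 * n + 1)"
    unfolding has_indep_def
    by (rule exI[of _ "insert (ad_comm a b 1) S"])
       (use S Y(1) ad_comm notin \<open>ad_comm a b 1 \<notin> S\<close> ad_comm_in_nich in \<open>auto simp: tens.independent_insert\<close>)
  from has_indep_extend[OF ab this, of m] c m
  show ?thesis by (simp add: numeral_2_eq_2)
qed

text \<open>
  The second hypothesis says \<open>q a a * (q a b * q b a) = 1\<close> or \<open>q a a = -1\<close>.  The only derivative of the
  commutator is a multiple of the square of \<open>a\<close>; in the first case the factor is zero, in the second
  case the square is.
\<close>

lemma ad_comm_0_eq_0:
  assumes "a \<noteq> b" "ad_coeff b a 1 = 0"
  shows "ad_comm a b 0 = 0"
proof -
  have "(1 + q a a) * (1 - q b a * q a b * q a a) = 0"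
    using assms(2) by (simp add: ad_coeff_def qnum_Suc)
  then have *: "1 - q a a * (q a b * q b a) = 0 \<or> 1 + q a a = 0"
    by (metis mult.assoc mult.commute mult_eq_0_iff)
  have "X a \<odot> X a = 0" if "1 + q a a = 0"
    using X_pow_eq_0[of a 2] that by (simp add: qnum_Suc numeral_2_eq_2)
  with * have *: "tscale (ad_coeff a b 0 * (1 - q a a * (q a b * q b a))) (X a \<odot> X a) = 0"
    by (elim disjE) (simp_all only: mult_zero_right tens.scale_zero_left tens.scale_zero_right)
  have "D i (ad_comm a b 0) = 0" for i
    unfolding D_ad_comm_0[OF assms(1)] * by simp
  then show ?thesis
    by (rule eq_zero_if_D_zero[rotated]) (simp add: ad_comm_at_Nil)
qed

text \<open>
  The three alternatives are those in which the obstruction in the direction \<open>b\<close> from \<open>D_ad_comm2\<close>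
  disappears; in the last one because the square of \<open>a\<close> is zero.
\<close>

lemma ad_comm_1_eq_0:
  assumes "a \<noteq> b" "kappa (q a a) (q a b * q b a) (q b b) = 0"
    and "1 + q b b + q b b ^ 2 = 0 \<or> 1 - q a a * (q a b * q b a)\<^sup>2 * q b b ^ 2 = 0
      \<or> 1 + q a a = 0"
  shows "ad_comm a b 1 = 0"
proof -
  have "X a \<odot> X a = 0" if "1 + q a a = 0"
    using X_pow_eq_0[of a 2] that by (simp add: qnum_Suc numeral_2_eq_2)
  then have *: "tscale ((ad_coeff a b 0)\<^sup>2 * ad_coeff a b 1 * q a b * (1 + q b b + q b b ^ 2)
      * (1 - q a a * (q a b * q b a)\<^sup>2 * q b b ^ 2)) (X a \<odot> X a) = 0"
    using assms(3)
    by (elim disjE)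
       (simp_all only: mult_zero_right mult_zero_left tens.scale_zero_left tens.scale_zero_right)
  have "D i (ad_comm2 a b) = 0" for i
    unfolding D_ad_comm2[OF assms(1)] * assms(2) by simp
  then have "ad_comm2 a b = 0"
    by (rule eq_zero_if_D_zero[rotated]) (simp add: ad_comm2_def plus_fun_apply tscale_apply ad_at_Nil)
  then have "D i (ad_comm1 a b) = 0" for i
    by (simp add: D_ad_comm1[OF assms(1)])
  then have "ad_comm1 a b = 0"
    by (rule eq_zero_if_D_zero[rotated])
       (simp add: ad_comm1_def plus_fun_apply minus_apply tscale_apply ad_at_Nil)
  then have "D i (ad_comm a b 1) = 0" for i
    by (simp only: D_ad_comm_1[OF assms(1)] if_cancel)
  then show ?thesis
    by (rule eq_zero_if_D_zero[rotated]) (simp add: ad_comm_at_Nil)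
qed

text \<open>
  The factor \<open>ad a b j\<close> produced by \<open>D b\<close> is moved to the front by the commutation relation, and the
  scalars collected on the way add up to a quantum integer at \<open>ad_diag a b (Suc j)\<close>.
\<close>

lemma D_ad_pow:
  assumes ab: "a \<noteq> b" and ad_comm: "ad_comm a b j = 0"
  shows "D i (((\<odot>) (ad a b (Suc j)) ^^ e) (word [])) = (if i = b then
    tscale (ad_coeff a b j * qnum (ad_diag a b (Suc j)) e)
      (ad a b j \<odot> ((\<odot>) (ad a b (Suc j)) ^^ (e - 1)) (word [])) else 0)"
proof (induction e)
  case (Suc e)
  have rel: "ad a b (Suc j) \<odot> ad a b j = tscale (ad_exch a b j) (ad a b j \<odot> ad a b (Suc j))"
    using ad_comm by (simp add: ad_comm_def)
  have ad_diag: "q a b * q b b ^ Suc j * ad_exch a b j = ad_diag a b (Suc j)"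
  proof -
    define s where "s = q b b ^ Suc j"
    have "q b b ^ (Suc j)\<^sup>2 = s ^ Suc j"
      by (simp only: s_def power2_eq_square power_mult)
    then show ?thesis
      unfolding ad_exch_def ad_diag_def s_def[symmetric] by (simp add: power_mult_distrib mult_ac)
  qed
  show ?case
  proof (cases "i = b \<and> e > 0")
    case True
    then obtain d where d: "e = Suc d" using gr0_implies_Suc by blast
    have "D b (((\<odot>) (ad a b (Suc j)) ^^ Suc e) (word [])) =
      tscale (ad_coeff a b j) (ad a b j \<odot> ((\<odot>) (ad a b (Suc j)) ^^ e) (word [])) +
      tscale (q a b * q b b ^ Suc j * (ad_coeff a b j * qnum (ad_diag a b (Suc j)) e))
        ((ad a b (Suc j) \<odot> ad a b j) \<odot> ((\<odot>) (ad a b (Suc j)) ^^ d) (word []))"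
      using True Suc ab by (simp add: D_shuf D_ad_Suc tw_ad shuf_linear d shuf_assoc mult_ac)
    also have "\<dots> = tscale (ad_coeff a b j * (1 + q a b * q b b ^ Suc j * ad_exch a b j * qnum (ad_diag a b (Suc j)) e))
        (ad a b j \<odot> ((\<odot>) (ad a b (Suc j)) ^^ e) (word []))"
      unfolding rel by (simp add: shuf_linear shuf_assoc d)
        (simp add: fun_eq_iff plus_fun_apply tscale_apply algebra_simps)
    finally show ?thesis
      using True unfolding ad_diag by (simp add: qnum_Suc')
  next
    case False
    then show ?thesis
      using Suc ab by (auto simp: D_shuf D_ad_Suc qnum_Suc)
  qed
qed simp

lemma ad_pow_eq_0:
  assumes "a \<noteq> b" "ad_comm a b j = 0" "qnum (ad_diag a b (Suc j)) m = 0" "m > 0"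
  shows "((\<odot>) (ad a b (Suc j)) ^^ m) (word []) = 0"
  by (rule eq_zero_if_D_zero)
     (use assms in \<open>auto simp: D_ad_pow shuf_at_Nil_pow ad_at_Nil\<close>)

end

section \<open>Spanning by PBW monomials\<close>

context quantum_shuffle
begin

text \<open>
  The exponent \<open>e - 1\<close> is truncated at \<open>e = 0\<close>, where no term with \<open>w\<close> occurs; the first conjunct
  carries this through the induction.
\<close>

lemma commute_past_pow:
  assumes yf: "y \<odot> f = w + tscale t (f \<odot> y)" and wf: "w \<odot> f = tscale \<rho> (f \<odot> w)"
  shows "\<exists>s s'. (e = 0 \<longrightarrow> s = 0 \<and> s' = 1) \<and> (\<forall>h. y \<odot> ((\<odot>) f ^^ e) h
    = tscale s (((\<odot>) f ^^ (e - 1)) (w \<odot> h)) + tscale s' (((\<odot>) f ^^ e) (y \<odot> h)))"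
proof (induction e)
  case 0
  show ?case by simp
next
  case (Suc e)
  then obtain s s' where e: "e = 0 \<longrightarrow> s = 0 \<and> s' = 1" and IH: "\<And>h. y \<odot> ((\<odot>) f ^^ e) h
    = tscale s (((\<odot>) f ^^ (e - 1)) (w \<odot> h)) + tscale s' (((\<odot>) f ^^ e) (y \<odot> h))" by blast
  have w: "w \<odot> ((\<odot>) f ^^ e) h = tscale (\<rho> ^ e) (((\<odot>) f ^^ e) (w \<odot> h))" for e h
  proof (induction e)
    case (Suc e)
    have "w \<odot> ((\<odot>) f ^^ Suc e) h = (w \<odot> f) \<odot> ((\<odot>) f ^^ e) h" by (simp add: shuf_assoc)
    also have "\<dots> = tscale \<rho> (f \<odot> w \<odot> ((\<odot>) f ^^ e) h)"
      unfolding wf by (simp add: shuf_linear shuf_assoc)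
    finally show ?case unfolding Suc by (simp add: shuf_linear)
  qed simp
  have "y \<odot> ((\<odot>) f ^^ Suc e) h
    = tscale (\<rho> ^ e + (if e = 0 then 0 else t * s)) (((\<odot>) f ^^ e) (w \<odot> h))
      + tscale (t * s') (((\<odot>) f ^^ Suc e) (y \<odot> h))" (is "?l = ?r") for h
  proof -
    have "?l = (y \<odot> f) \<odot> ((\<odot>) f ^^ e) h" by (simp add: shuf_assoc)
    also have "\<dots> = w \<odot> ((\<odot>) f ^^ e) h + tscale t (f \<odot> y \<odot> ((\<odot>) f ^^ e) h)"
      unfolding yf by (simp add: shuf_linear shuf_assoc)
    also have "\<dots> = ?r"
    proof (cases e)
      case 0
      then show ?thesis using e by simp
    next
      case (Suc d)
      have "w \<odot> ((\<odot>) f ^^ e) h + tscale t (f \<odot> y \<odot> ((\<odot>) f ^^ e) h)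
        = tscale (\<rho> ^ e) (((\<odot>) f ^^ e) (w \<odot> h)) + (tscale (t * s) (((\<odot>) f ^^ Suc (e - 1)) (w \<odot> h))
          + tscale (t * s') (((\<odot>) f ^^ Suc e) (y \<odot> h)))"
        unfolding w IH by (simp add: shuf_linear tens.scale_right_distrib)
      then show ?thesis using Suc by (simp add: tens.scale_left_distrib add_ac)
    qed
    finally show ?thesis .
  qed
  then show ?case by (intro exI[of _ "\<rho> ^ e + (if e = 0 then 0 else t * s)"] exI[of _ "t * s'"]) simp
qed

text \<open>
  The span of the monomials contains the unit, and left multiplication by \<open>a = ad a b 0\<close> only raises
  the first exponent.  Moving \<open>b\<close> to the right past a power of \<open>ad a b j\<close> produces one factor
  \<open>ad a b (Suc j)\<close>, which commutes past the remaining factors and joins the next power.  Monomials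
  whose exponents leave the box are zero.
\<close>

theorem pbw_spanning:
  assumes ad_comm: "ad_comm a b 0 = 0" "ad_comm a b 1 = 0" and z3: "ad a b 3 = 0"
    and nil: "\<And>j. j \<le> 2 \<Longrightarrow> ((\<odot>) (ad a b j) ^^ m j) (word []) = 0"
      "((\<odot>) (X b) ^^ n) (word []) = 0"
  shows "\<exists>S. finite S \<and> nich {a, b} \<subseteq> tens.span S \<and> card S \<le> n * (m 0 * m 1 * m 2)"
proof -
  define P where "P = (\<lambda>e0 e1 e2 d. ((\<odot>) (X a) ^^ e0) (((\<odot>) (ad a b 1) ^^ e1)
    (((\<odot>) (ad a b 2) ^^ e2) (((\<odot>) (X b) ^^ d) (word [])))))"
  define I where "I = {..<m 0} \<times> {..<m 1} \<times> {..<m 2} \<times> {..<n}"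
  define S where "S = (\<lambda>(e0, e1, e2, d). P e0 e1 e2 d) ` I"
  have fin: "finite S" and card: "card S \<le> n * (m 0 * m 1 * m 2)"
  proof -
    have I: "finite I" "card I = n * (m 0 * m 1 * m 2)"
      by (simp_all add: I_def card_cartesian_product)
    then show "finite S" "card S \<le> n * (m 0 * m 1 * m 2)"
      using card_image_le[OF I(1)] by (auto simp: S_def simp flip: I(2))
  qed
  have P: "P e0 e1 e2 d \<in> tens.span S" for e0 e1 e2 d
  proof (cases "(e0, e1, e2, d) \<in> I")
    case True
    then have "P e0 e1 e2 d \<in> S" unfolding S_def by force
    then show ?thesis by (rule tens.span_base)
  next
    case False
    then consider "m 0 \<le> e0" | "m 1 \<le> e1" | "m 2 \<le> e2" | "n \<le> d"
      unfolding I_def by force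
    then have "P e0 e1 e2 d = 0"
    proof cases
      case 1
      then show ?thesis unfolding P_def using shuf_pow_eq_0[OF nil(1)[of 0]] by simp
    next
      case 2
      then show ?thesis
        unfolding P_def using shuf_pow_eq_0[OF nil(1)[of 1]] by (simp add: lin_zero[OF lin_shuf_pow])
    next
      case 3
      then show ?thesis
        unfolding P_def using shuf_pow_eq_0[OF nil(1)[of 2]] by (simp add: lin_zero[OF lin_shuf_pow])
    next
      case 4
      then show ?thesis
        unfolding P_def using shuf_pow_eq_0[OF nil(2)] by (simp add: lin_zero[OF lin_shuf_pow])
    qed
    then show ?thesis by (simp add: tens.span_zero)
  qed
  have ad: "X b \<odot> ad a b j = ad a b (Suc j) + tscale (q b a * q b b ^ j) (ad a b j \<odot> X b)" for j
    by (simp add: ad.simps(2))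
  have rel: "ad a b (Suc j) \<odot> ad a b j = tscale (ad_exch a b j) (ad a b j \<odot> ad a b (Suc j))" if "j < 2" for j
    using that ad_comm by (auto simp: ad_comm_def less_2_cases_iff)
  have "X a \<odot> P e0 e1 e2 d \<in> tens.span S" for e0 e1 e2 d
    using P[of "Suc e0" e1 e2 d] by (simp add: P_def)
  moreover have "X b \<odot> P e0 e1 e2 d \<in> tens.span S" for e0 e1 e2 d
  proof -
    have z0: "X b \<odot> X a = ad a b 1 + tscale (q b a) (X a \<odot> X b)"
        "ad a b 1 \<odot> X a = tscale (ad_exch a b 0) (X a \<odot> ad a b 1)"
      using ad[of 0] rel[of 0] by simp_all
    obtain s0 t0 where 0: "\<And>h. X b \<odot> ((\<odot>) (X a) ^^ e0) h
      = tscale s0 (((\<odot>) (X a) ^^ (e0 - 1)) (ad a b 1 \<odot> h)) + tscale t0 (((\<odot>) (X a) ^^ e0) (X b \<odot> h))"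
      using commute_past_pow[OF z0, of e0] by (elim exE conjE) (rule that, erule spec)
    have z1: "X b \<odot> ad a b 1 = ad a b 2 + tscale (q b a * q b b) (ad a b 1 \<odot> X b)"
        "ad a b 2 \<odot> ad a b 1 = tscale (ad_exch a b 1) (ad a b 1 \<odot> ad a b 2)"
      using ad[of 1] rel[of 1] by (simp_all add: numeral_2_eq_2)
    obtain s1 t1 where 1: "\<And>h. X b \<odot> ((\<odot>) (ad a b 1) ^^ e1) h
      = tscale s1 (((\<odot>) (ad a b 1) ^^ (e1 - 1)) (ad a b 2 \<odot> h)) + tscale t1 (((\<odot>) (ad a b 1) ^^ e1) (X b \<odot> h))"
      using commute_past_pow[OF z1, of e1] by (elim exE conjE) (rule that, erule spec)
    have z2: "X b \<odot> ad a b 2 = ad a b 3 + tscale (q b a * q b b ^ 2) (ad a b 2 \<odot> X b)"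
        "ad a b 3 \<odot> ad a b 2 = tscale 0 (ad a b 2 \<odot> ad a b 3)"
      using ad[of 2] by (simp_all add: numeral_3_eq_3[symmetric]) (simp_all add: z3)
    obtain s2 t2 where 2: "\<And>h. X b \<odot> ((\<odot>) (ad a b 2) ^^ e2) h
      = tscale s2 (((\<odot>) (ad a b 2) ^^ (e2 - 1)) (ad a b 3 \<odot> h)) + tscale t2 (((\<odot>) (ad a b 2) ^^ e2) (X b \<odot> h))"
      using commute_past_pow[OF z2, of e2] by (elim exE conjE) (rule that, erule spec)
    have "X b \<odot> P e0 e1 e2 d = tscale s0 (P (e0 - 1) (Suc e1) e2 d)
      + tscale (t0 * s1) (P e0 (e1 - 1) (Suc e2) d) + tscale (t0 * t1 * t2) (P e0 e1 e2 (Suc d))"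
      unfolding P_def 0 1 2
      by (simp only: z3 shuf_zero_left lin_zero[OF lin_shuf_pow] lin_add[OF lin_shuf_pow]
          lin_scale[OF lin_shuf_pow] tens.scale_right_distrib tens.scale_zero_right
          tens.scale_scale funpow.simps o_apply add_0_left add_0_right add.assoc mult.assoc)
    then show ?thesis using P by (simp add: tens.span_add tens.span_scale)
  qed
  ultimately have gen: "X i \<odot> s \<in> tens.span S" if "i \<in> {a, b}" "s \<in> S" for i s
    using that by (auto simp: S_def)
  have closed: "X i \<odot> f \<in> tens.span S" if "f \<in> tens.span S" "i \<in> {a, b}" for i f
    using that
    by (induction rule: tens.span_induct_alt)
       (auto simp: shuf_linear gen tens.span_zero intro!: tens.span_add tens.span_scale)
  have "mon w \<in> tens.span S" if "w \<in> lists {a, b}" for w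
    using that
  proof (induction w)
    case Nil
    then show ?case using P[of 0 0 0 0] by (simp add: P_def)
  qed (use closed in auto)
  then have "nich {a, b} \<subseteq> tens.span S"
    unfolding nich_def by (intro tens.span_minimal tens.subspace_span) auto
  with fin card show ?thesis by blast
qed

text \<open>
  The upper bound for the dimension.  The alternative \<open>ad a b 2 = 0\<close> with \<open>m 2 = 1\<close> is the case in
  which only \<open>ad a b 0\<close> and \<open>ad a b 1\<close> occur.
\<close>

lemma has_indep_le_pbw:
  fixes m :: "nat \<Rightarrow> nat"
  assumes ab: "a \<noteq> b"
    and ad_comm: "ad_comm a b 0 = 0" "ad_comm a b 1 = 0" and z3: "ad a b 3 = 0"
    and n: "root_order (q b b) = enat n"
    and m: "root_order (ad_diag a b 0) = enat (m 0)" "root_order (ad_diag a b 1) = enat (m 1)"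
      "root_order (ad_diag a b 2) = enat (m 2) \<or> ad a b 2 = 0 \<and> m 2 = 1"
    and ind: "has_indep (nich {a, b}) M"
  shows "M \<le> n * (m 0 * m 1 * m 2)"
proof -
  have nil: "((\<odot>) (ad a b j) ^^ m j) (word []) = 0" if "j \<le> 2" for j
  proof -
    have "ad_diag a b 0 = q a a" by (simp add: ad_diag_def)
    then have "((\<odot>) (ad a b 0) ^^ m 0) (word []) = 0"
      using X_pow_eq_0[of a "m 0"] root_order_finiteD[OF m(1)] by simp
    moreover have "((\<odot>) (ad a b (Suc 0)) ^^ m 1) (word []) = 0"
      using ad_pow_eq_0[OF ab ad_comm(1), of "m 1"] root_order_finiteD[OF m(2)] by simp
    moreover have "((\<odot>) (ad a b (Suc 1)) ^^ m 2) (word []) = 0"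
      using m(3)
    proof
      assume "root_order (ad_diag a b 2) = enat (m 2)"
      from root_order_finiteD[OF this] show ?thesis
        using ad_pow_eq_0[OF ab ad_comm(2), of "m 2"] by (simp add: numeral_2_eq_2)
    qed (simp add: numeral_2_eq_2)
    ultimately show ?thesis
      using that by (auto simp: le_Suc_eq numeral_2_eq_2)
  qed
  have nilX: "((\<odot>) (X b) ^^ n) (word []) = 0"
    using X_pow_eq_0[of b n] root_order_finiteD[OF n] by simp
  obtain S where S: "finite S" "nich {a, b} \<subseteq> tens.span S" "card S \<le> n * (m 0 * m 1 * m 2)"
    using pbw_spanning[OF ad_comm z3 nil nilX] by blast
  from ind obtain T where T: "T \<subseteq> nich {a, b}" "tens.independent T" "card T = M"
    unfolding has_indep_def by blast
  have "card T \<le> card S"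
    using tens.independent_span_bound[OF S(1) T(2)] T(1) S(2) by blast
  with T(3) S(3) show ?thesis by simp
qed

end

section \<open>Reduced expressions and the sum over permutations\<close>

abbreviation pinv :: "(nat \<Rightarrow> nat) \<Rightarrow> nat \<Rightarrow> nat" where
  "pinv p \<equiv> inv_into UNIV p"

definition Inv :: "nat \<Rightarrow> (nat \<Rightarrow> nat) \<Rightarrow> (nat \<times> nat) set" where
  "Inv n p = {(i, j). i < j \<and> j < n \<and> p j < p i}"

lemma Inv_id: "Inv n id = {}"
  by (auto simp: Inv_def)

lemma finite_Inv [simp]: "finite (Inv n p)"
  by (rule finite_subset[of _ "{..<n} \<times> {..<n}"]) (auto simp: Inv_def)

lemma transpose_Suc_less_iff:
  "transpose i (Suc i) k < transpose i (Suc i) l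
    \<longleftrightarrow> (k = Suc i \<and> l = i) \<or> (k < l \<and> \<not> (k = i \<and> l = Suc i))"
  by (auto simp: transpose_def)

lemma transpose_Suc_permutes: "Suc i < n \<Longrightarrow> transpose i (Suc i) permutes {..<n}"
  by (intro permutes_swap_id) auto

text \<open>
  Composing with a simple transposition creates exactly one inversion, or, read backwards, removes
  one.
\<close>

lemma Inv_transpose:
  assumes p: "p permutes {..<n}" and i: "Suc i < n" and less: "pinv p i < pinv p (Suc i)"
  shows "Inv n (transpose i (Suc i) \<circ> p) = insert (pinv p i, pinv p (Suc i)) (Inv n p)"
    and "(pinv p i, pinv p (Suc i)) \<notin> Inv n p"
proof -
  have eq: "p k = l \<longleftrightarrow> k = pinv p l" for k l
    using permutes_inverses[OF p] by metis
  have "pinv p (Suc i) < n"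
    using permutes_in_image[OF permutes_inv[OF p], of "Suc i"] i by simp
  then show "Inv n (transpose i (Suc i) \<circ> p) = insert (pinv p i, pinv p (Suc i)) (Inv n p)"
    using less by (auto simp: Inv_def transpose_Suc_less_iff eq)
  show "(pinv p i, pinv p (Suc i)) \<notin> Inv n p"
    by (simp add: Inv_def permutes_inverses[OF p])
qed

lemma card_Inv_transpose:
  assumes p: "p permutes {..<n}" and i: "Suc i < n"
  shows "card (Inv n (transpose i (Suc i) \<circ> p)) =
    (if pinv p i < pinv p (Suc i) then Suc (card (Inv n p)) else card (Inv n p) - 1)"
    and "\<not> pinv p i < pinv p (Suc i) \<Longrightarrow> card (Inv n p) > 0"
proof -
  let ?s = "transpose i (Suc i)"
  have sp: "?s \<circ> p permutes {..<n}"
    by (rule permutes_compose[OF p transpose_Suc_permutes[OF i]])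
  have *: "card (Inv n p) = Suc (card (Inv n (?s \<circ> p)))" if "\<not> pinv p i < pinv p (Suc i)"
  proof -
    have inv: "pinv (?s \<circ> p) k = pinv p (?s k)" for k
      by (simp add: o_inv_distrib[OF permutes_bij[OF transpose_Suc_permutes[OF i]] permutes_bij[OF p]])
    have "pinv p i \<noteq> pinv p (Suc i)"
      using permutes_inverses(1)[OF p] by (metis n_not_Suc_n)
    with that have "pinv (?s \<circ> p) i < pinv (?s \<circ> p) (Suc i)" by (simp add: inv)
    from Inv_transpose[OF sp i this] show ?thesis
      by (simp add: comp_assoc[symmetric])
  qed
  show "card (Inv n (?s \<circ> p)) =
    (if pinv p i < pinv p (Suc i) then Suc (card (Inv n p)) else card (Inv n p) - 1)"
    using * Inv_transpose[OF p i] by simp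
  show "\<not> pinv p i < pinv p (Suc i) \<Longrightarrow> card (Inv n p) > 0"
    using * by simp
qed

lemma word_perm_simps [simp]:
  "word_perm [] = id" "word_perm (i # is) = transpose i (Suc i) \<circ> word_perm is"
  by (simp_all add: word_perm_def)

lemma word_perm_permutes: "\<forall>i\<in>set is. Suc i < n \<Longrightarrow> word_perm is permutes {..<n}"
proof (induction "is")
  case (Cons i "is")
  then show ?case
    using permutes_compose[OF _ transpose_Suc_permutes[of i n], of "word_perm is"] by (simp del: o_apply)
qed (simp add: permutes_id)

lemma card_Inv_word_perm: "\<forall>i\<in>set is. Suc i < n \<Longrightarrow> card (Inv n (word_perm is)) \<le> length is"
proof (induction "is")
  case (Cons i "is")
  then show ?case
    using card_Inv_transpose(1)[OF word_perm_permutes, of "is" n i] by (auto simp del: o_apply)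
qed (simp add: Inv_id)

lemma permutes_increasing_eq_id:
  assumes f: "f permutes {..<n}" and inc: "\<And>i. Suc i < n \<Longrightarrow> f i < f (Suc i)"
  shows "f = id"
proof (rule permutes_natset_ge[OF f])
  have "k < n \<Longrightarrow> k \<le> f k" for k
  proof (induction k)
    case (Suc k)
    then show ?case using inc[of k] by simp
  qed simp
  then show "\<forall>i\<in>{..<n}. i \<le> f i" by simp
qed

text \<open>
  Bubble sort: as long as the inverse of \<open>p\<close> has a descent, a simple transposition removes an
  inversion, and the only permutation without descents is the identity.
\<close>

lemma word_of_length_card_Inv:
  assumes "p permutes {..<n}"
  shows "\<exists>is. (\<forall>i\<in>set is. Suc i < n) \<and> word_perm is = p \<and> length is = card (Inv n p)"
  using assms
proof (induction "card (Inv n p)" arbitrary: p rule: less_induct)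
  case less
  show ?case
  proof (cases "\<exists>i. Suc i < n \<and> \<not> pinv p i < pinv p (Suc i)")
    case True
    then obtain i where i: "Suc i < n" "\<not> pinv p i < pinv p (Suc i)" by blast
    let ?s = "transpose i (Suc i)"
    note c = card_Inv_transpose[OF less.prems i(1)]
    have "?s \<circ> p permutes {..<n}"
      by (rule permutes_compose[OF less.prems transpose_Suc_permutes[OF i(1)]])
    moreover have "card (Inv n (?s \<circ> p)) < card (Inv n p)"
      using c i(2) by simp
    ultimately obtain js where js: "\<forall>i\<in>set js. Suc i < n" "word_perm js = ?s \<circ> p"
      "length js = card (Inv n (?s \<circ> p))"
      using less.hyps by blast
    have "word_perm (i # js) = p"
      by (simp add: js(2) comp_assoc[symmetric])
    moreover have "length (i # js) = card (Inv n p)"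
      using js(3) c i(2) by simp
    ultimately show ?thesis using js(1) i(1) by (intro exI[of _ "i # js"]) auto
  next
    case False
    then have "pinv p = id"
      by (intro permutes_increasing_eq_id[OF permutes_inv[OF less.prems]]) auto
    then have "p = id"
      using permutes_inv_inv[OF less.prems] by (metis inv_id)
    then show ?thesis by (intro exI[of _ "[]"]) (simp add: Inv_id)
  qed
qed

lemma length_reduced_expression:
  assumes "p permutes {..<n}" "reduced_expression n p is"
  shows "length is = card (Inv n p)"
proof (rule le_antisym)
  show "length is \<le> card (Inv n p)"
    using word_of_length_card_Inv[OF assms(1)] assms(2)
    unfolding reduced_expression_def by auto
  show "card (Inv n p) \<le> length is"
    using card_Inv_word_perm[of "is" n] assms(2) unfolding reduced_expression_def by auto
qed

lemma reduced_expression_exists: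
  assumes "p permutes {..<n}"
  shows "\<exists>is. reduced_expression n p is"
proof -
  obtain "is" where *: "\<forall>i\<in>set is. Suc i < n" "word_perm is = p" "length is = card (Inv n p)"
    using word_of_length_card_Inv[OF assms] by blast
  have "length is \<le> length js" if "\<forall>j\<in>set js. Suc j < n" "word_perm js = p" for js
    using card_Inv_word_perm[OF that(1)] that(2) *(3) by simp
  with * show ?thesis unfolding reduced_expression_def by blast
qed

definition perm_word :: "(nat \<Rightarrow> nat) \<Rightarrow> 'a list \<Rightarrow> 'a list" where
  "perm_word p w = map (\<lambda>k. w ! pinv p k) [0..<length w]"

lemma length_perm_word [simp]: "length (perm_word p w) = length w"
  by (simp add: perm_word_def)

lemma nth_perm_word: "k < length w \<Longrightarrow> perm_word p w ! k = w ! pinv p k"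
  by (simp add: perm_word_def)

lemma perm_word_id [simp]: "perm_word id w = w"
  by (simp add: perm_word_def map_nth)

lemma set_perm_word:
  assumes "p permutes {..<length w}"
  shows "set (perm_word p w) \<subseteq> set w"
proof
  fix a assume "a \<in> set (perm_word p w)"
  then obtain k where k: "k < length w" "a = w ! pinv p k"
    by (auto simp: perm_word_def)
  have "pinv p k < length w"
    using permutes_in_image[OF permutes_inv[OF assms], of k] k(1) by simp
  with k(2) show "a \<in> set w" by simp
qed

text \<open>
  The increasing enumeration of the natural numbers other than \<open>m\<close>.
\<close>

definition skip :: "nat \<Rightarrow> nat \<Rightarrow> nat" where
  "skip m k = (if k < m then k else Suc k)"

text \<open>
  The permutation that moves position \<open>0\<close> to \<open>m\<close> and distributes the others over the remaining places
  as \<open>p\<close> does.  Every permutation of \<open>{..<Suc n}\<close> arises once in this way, and its inversions are those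
  of \<open>p\<close> and those of position \<open>0\<close>.  This turns the sum over permutations into iterated
  multiplication by letters.
\<close>

definition perm_cons :: "nat \<Rightarrow> (nat \<Rightarrow> nat) \<Rightarrow> nat \<Rightarrow> nat" where
  "perm_cons m p k = (case k of 0 \<Rightarrow> m | Suc k \<Rightarrow> skip m (p k))"

lemma perm_cons_simps [simp]:
  "perm_cons m p 0 = m" "perm_cons m p (Suc k) = skip m (p k)"
  by (simp_all add: perm_cons_def)

lemma skip_less_iff [simp]: "skip m k < skip m l \<longleftrightarrow> k < l"
  by (auto simp: skip_def)

lemma skip_inj [simp]: "skip m k = skip m l \<longleftrightarrow> k = l"
  by (auto simp: skip_def)

lemma skip_neq [simp]: "skip m k \<noteq> m" "m \<noteq> skip m k"
  by (auto simp: skip_def)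

lemma skip_less_self [simp]: "skip m k < m \<longleftrightarrow> k < m"
  by (auto simp: skip_def)

lemma perm_cons_permutes:
  assumes p: "p permutes {..<n}" and m: "m \<le> n"
  shows "perm_cons m p permutes {..<Suc n}"
proof -
  have inj: "inj (perm_cons m p)"
  proof (rule injI)
    fix k l assume "perm_cons m p k = perm_cons m p l"
    then show "k = l"
      by (cases k; cases l) (simp_all add: inj_eq[OF permutes_inj[OF p]])
  qed
  note inj_on = inj_on_subset[OF inj subset_UNIV]
  have out: "perm_cons m p k = k" if k: "k \<notin> {..<Suc n}" for k
  proof -
    obtain l where l: "k = Suc l" using k by (cases k) auto
    with k have "p l = l" using permutes_not_in[OF p, of l] by simp
    with l k m show ?thesis by (simp add: skip_def)
  qed
  have "perm_cons m p ` {..<Suc n} \<subseteq> {..<Suc n}"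
  proof
    fix y assume "y \<in> perm_cons m p ` {..<Suc n}"
    then obtain k where "k < Suc n" "y = perm_cons m p k" by auto
    then show "y \<in> {..<Suc n}"
      using m permutes_in_image[OF p] by (cases k) (auto simp: skip_def)
  qed
  then have "perm_cons m p ` {..<Suc n} = {..<Suc n}"
    by (intro endo_inj_surj inj_on) simp_all
  then have "bij_betw (perm_cons m p) {..<Suc n} {..<Suc n}"
    using inj_on by (simp add: bij_betw_def)
  then show ?thesis
    using out by (intro bij_imp_permutes) auto
qed

lemma permutes_Suc_eq_perm_cons:
  "{p. p permutes {..<Suc n}} = (\<lambda>(m, p). perm_cons m p) ` ({..n} \<times> {p. p permutes {..<n}})"
  and inj_on_perm_cons: "inj_on (\<lambda>(m, p). perm_cons m p) ({..n} \<times> {p. p permutes {..<n}})"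
proof -
  show inj: "inj_on (\<lambda>(m, p). perm_cons m p) ({..n} \<times> {p. p permutes {..<n}})"
  proof (rule inj_onI, clarify)
    fix m p m' p' assume eq: "perm_cons m p = perm_cons m' p'"
    have m: "m = m'" using fun_cong[OF eq, of 0] by simp
    moreover have "p k = p' k" for k using fun_cong[OF eq, of "Suc k"] m by simp
    ultimately show "m = m' \<and> p = p'" by auto
  qed
  let ?A = "(\<lambda>(m, p). perm_cons m p) ` ({..n} \<times> {p. p permutes {..<n}})"
  have "?A = {p. p permutes {..<Suc n}}"
  proof (rule card_subset_eq)
    show "finite {p. p permutes {..<Suc n}}" by (simp add: finite_permutations)
    show "?A \<subseteq> {p. p permutes {..<Suc n}}" using perm_cons_permutes by auto
    show "card ?A = card {p. p permutes {..<Suc n}}"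
      by (simp add: card_image[OF inj] card_cartesian_product card_permutations[of "{..<n}" n]
          card_permutations[of "{..<Suc n}" "Suc n"] del: fact_Suc) (simp add: algebra_simps)
  qed
  then show "{p. p permutes {..<Suc n}} = ?A" by simp
qed

lemma Inv_perm_cons:
  "Inv (Suc n) (perm_cons m p)
    = (\<lambda>k. (0, Suc k)) ` {k. k < n \<and> p k < m} \<union> map_prod Suc Suc ` Inv n p"
proof (rule Set.set_eqI)
  fix x :: "nat \<times> nat"
  obtain i j where x: "x = (i, j)" by (cases x)
  show "x \<in> Inv (Suc n) (perm_cons m p) \<longleftrightarrow>
    x \<in> (\<lambda>k. (0, Suc k)) ` {k. k < n \<and> p k < m} \<union> map_prod Suc Suc ` Inv n p"
    unfolding x by (cases i; cases j) (auto simp: Inv_def image_iff)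
qed

lemma perm_word_perm_cons:
  assumes p: "p permutes {..<length w}" and m: "m \<le> length w"
  shows "perm_word (perm_cons m p) (a # w)
    = take m (perm_word p w) @ a # drop m (perm_word p w)"
proof (rule nth_equalityI)
  fix k assume k: "k < length (perm_word (perm_cons m p) (a # w))"
  have inj: "inj (perm_cons m p)"
    by (rule permutes_inj[OF perm_cons_permutes[OF p m]])
  consider "k < m" | "k = m" | l where "k = Suc l" "m \<le> l" 
    by (cases k) (force simp: not_less_eq)+
  then show "perm_word (perm_cons m p) (a # w) ! k
    = (take m (perm_word p w) @ a # drop m (perm_word p w)) ! k"
  proof cases
    case 1
    then have "perm_cons m p (Suc (pinv p k)) = k"
      using permutes_inverses[OF p] by (simp add: skip_def)
    then have "pinv (perm_cons m p) k = Suc (pinv p k)" using inj by (metis inv_f_f)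
    with 1 k m show ?thesis by (simp add: nth_perm_word nth_append)
  next
    case 2
    then have "pinv (perm_cons m p) k = 0" using inj by (metis inv_f_f perm_cons_simps(1))
    with 2 k m show ?thesis by (simp add: nth_perm_word nth_append)
  next
    case 3
    then have "perm_cons m p (Suc (pinv p l)) = k"
      using permutes_inverses[OF p] by (simp add: skip_def)
    then have "pinv (perm_cons m p) k = Suc (pinv p l)" using inj by (metis inv_f_f)
    with 3 k m show ?thesis by (simp add: nth_perm_word nth_append Suc_diff_le)
  qed
qed (use m in simp)

context quantum_shuffle
begin

text \<open>
  The scalar picked up by \<open>w\<close> under a reduced expression of \<open>p\<close>, see \<open>braid_word_shortest\<close>.
\<close>

definition inv_coeff :: "(nat \<Rightarrow> nat) \<Rightarrow> 'a list \<Rightarrow> 'k" where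
  "inv_coeff p w = (\<Prod>(i, j)\<in>Inv (length w) p. q (w ! i) (w ! j))"

lemma inv_coeff_perm_cons:
  assumes p: "p permutes {..<length w}" and m: "m \<le> length w"
  shows "inv_coeff (perm_cons m p) (a # w)
    = (\<Prod>k<m. q a (perm_word p w ! k)) * inv_coeff p w"
proof -
  have inj: "inj_on (\<lambda>k. (0::nat, Suc k)) K" "inj_on (map_prod Suc Suc) L" for K L
    by (auto simp: inj_on_def)
  have "inv_coeff (perm_cons m p) (a # w)
    = (\<Prod>k | k < length w \<and> p k < m. q a (w ! k)) * inv_coeff p w"
    unfolding inv_coeff_def length_Cons Inv_perm_cons
    by (subst prod.union_disjoint)
       (auto simp: prod.reindex[OF inj(1)] prod.reindex[OF inj(2)] case_prod_unfold
         intro!: prod.cong)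
  also have "(\<Prod>k | k < length w \<and> p k < m. q a (w ! k)) = (\<Prod>k<m. q a (perm_word p w ! k))"
  proof (rule prod.reindex_bij_witness[where i = "pinv p" and j = p])
    fix k assume "k \<in> {..<m}"
    then show "pinv p k \<in> {k. k < length w \<and> p k < m}"
      using m permutes_inverses[OF p] permutes_in_image[OF permutes_inv[OF p], of k] by simp
  qed (use m in \<open>auto simp: permutes_inverses[OF p] nth_perm_word\<close>)
  finally show ?thesis .
qed

lemma X_shuf_word:
  "X a \<odot> word v = (\<Sum>m\<le>length v. tscale (\<Prod>k<m. q a (v ! k)) (word (take m v @ a # drop m v)))"
proof (induction v)
  case (Cons b v)
  let ?r = "\<Sum>m\<le>length (b # v). tscale (\<Prod>k<m. q a ((b # v) ! k))
    (word (take m (b # v) @ a # drop m (b # v)))"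
  have r: "?r = word (a # b # v) + (\<Sum>m\<le>length v. tscale (q a b * (\<Prod>k<m. q a (v ! k)))
    (word (b # take m v @ a # drop m v)))"
    by (simp add: sum.atMost_Suc_shift prod.lessThan_Suc_shift del: sum.atMost_Suc prod.lessThan_Suc)
  have "D i (X a \<odot> word (b # v)) = D i ?r" for i
  proof -
    have "D i (X a \<odot> word (b # v))
        = (if i = a then word (b # v) else 0) + (if i = b then tscale (q a b) (X a \<odot> word v) else 0)"
      by (auto simp: D_shuf D_word_Cons tw_word shuf_linear)
    also have "\<dots> = D i ?r"
      unfolding r Cons
      by (auto simp: D_word_Cons lin_sum[OF lin_D] tens.scale_sum_right)
    finally show ?thesis .
  qed
  moreover have "?r [] = 0" unfolding r
    by (simp add: plus_fun_apply sum_fun_apply tscale_apply)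
  then have "(X a \<odot> word (b # v)) [] = ?r []"
    by (simp only: shuf.simps(1) word_at_Nil mult_zero_left)
  ultimately show ?case
    by (rule eq_if_D_eq[rotated])
qed simp

text \<open>
  The right-hand side is the quantum symmetrizer applied to the basis vector \<open>w\<close>, see \<open>coord_S_P\<close>.
\<close>

theorem mon_eq_sum_permutations:
  "mon w = (\<Sum>p | p permutes {..<length w}. tscale (inv_coeff p w) (word (perm_word p w)))"
proof (induction w)
  case Nil
  then show ?case by (simp add: inv_coeff_def Inv_def perm_word_def)
next
  case (Cons a w)
  have "mon (a # w) = (\<Sum>p | p permutes {..<length w}. \<Sum>m\<le>length w.
      tscale (inv_coeff (perm_cons m p) (a # w)) (word (perm_word (perm_cons m p) (a # w))))"
    by (auto simp: Cons shuf_sum_right shuf_linear X_shuf_word tens.scale_sum_right mult.commute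
        inv_coeff_perm_cons perm_word_perm_cons intro!: sum.cong)
  also have "\<dots> = (\<Sum>(m, p)\<in>{..length w} \<times> {p. p permutes {..<length w}}.
      tscale (inv_coeff (perm_cons m p) (a # w)) (word (perm_word (perm_cons m p) (a # w))))"
    by (subst sum.swap) (simp add: sum.cartesian_product)
  also have "\<dots> = (\<Sum>p | p permutes {..<length (a # w)}.
      tscale (inv_coeff p (a # w)) (word (perm_word p (a # w))))"
    unfolding length_Cons permutes_Suc_eq_perm_cons
    by (subst sum.reindex[OF inj_on_perm_cons]) (simp add: case_prod_unfold)
  finally show ?case .
qed

end

section \<open>Tensors in coordinates\<close>

lemma pure_tensor_Nil: "pure_tensor scale [] \<phi>s = (if \<phi>s = [] then 1 else 0)"
  by (simp add: pure_tensor_def)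

lemma pure_tensor_Cons:
  "pure_tensor scale (v # vs) \<phi>s = (case \<phi>s of [] \<Rightarrow> 0 | \<phi> # \<psi>s \<Rightarrow>
     if Vector_Spaces.linear scale (*) \<phi> then \<phi> v * pure_tensor scale vs \<psi>s else 0)"
  by (auto simp: pure_tensor_def prod.lessThan_Suc_shift simp del: prod.lessThan_Suc split: list.splits)

lemma pure_tensor_wrong_length: "length \<phi>s \<noteq> length vs \<Longrightarrow> pure_tensor scale vs \<phi>s = 0"
  by (simp add: pure_tensor_def)

lemma pure_tensor_append:
  "pure_tensor scale (vs @ us) \<phi>s
    = pure_tensor scale vs (take (length vs) \<phi>s) * pure_tensor scale us (drop (length vs) \<phi>s)"
  by (induction vs arbitrary: \<phi>s)
     (auto simp: pure_tensor_Nil pure_tensor_Cons split: list.splits)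

lemma pure_tensor_linear_slot:
  assumes "vector_space scale"
  shows "pure_tensor scale (vs @ (scale a v + v') # us)
    = tscale a (pure_tensor scale (vs @ v # us)) + pure_tensor scale (vs @ v' # us)"
proof
  fix \<phi>s
  have *: "Vector_Spaces.linear scale (*) \<phi> \<Longrightarrow> \<phi> (scale a v + v') = a * \<phi> v + \<phi> v'" for \<phi>
    by (simp add: Vector_Spaces.linear_def module_hom_iff)
  show "pure_tensor scale (vs @ (scale a v + v') # us) \<phi>s
    = (tscale a (pure_tensor scale (vs @ v # us)) + pure_tensor scale (vs @ v' # us)) \<phi>s"
    by (auto simp: pure_tensor_append pure_tensor_Cons plus_fun_apply tscale_apply *
        distrib_left distrib_right mult_ac split: list.splits)
qed

lemma tensor_mult_pure_tensor:
  "tensor_mult (pure_tensor scale vs) (pure_tensor scale us) = pure_tensor scale (vs @ us)"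
proof
  fix \<phi>s
  have "tensor_mult (pure_tensor scale vs) (pure_tensor scale us) \<phi>s = (\<Sum>m\<le>length \<phi>s.
      if m = length vs then pure_tensor scale (vs @ us) \<phi>s else 0)"
    unfolding tensor_mult_def
    by (rule sum.cong) (auto simp: pure_tensor_append pure_tensor_wrong_length)
  also have "\<dots> = pure_tensor scale (vs @ us) \<phi>s"
    by (simp add: pure_tensor_wrong_length)
  finally show "tensor_mult (pure_tensor scale vs) (pure_tensor scale us) \<phi>s
    = pure_tensor scale (vs @ us) \<phi>s" .
qed

lemma tensor_mult_linear:
  "lin (tensor_mult s)" "lin (\<lambda>s. tensor_mult s t)"
  by (auto simp: lin_def tensor_mult_def pointwise tscale_apply algebra_simps sum.distrib
      sum_distrib_left)

lemma lin_degree_part: "lin (degree_part n)"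
  by (auto simp: lin_def degree_part_def pointwise tscale_apply)

lemma degree_part_pure_tensor:
  "degree_part n (pure_tensor scale vs) = (if length vs = n then pure_tensor scale vs else 0)"
  by (auto simp: degree_part_def pointwise pure_tensor_wrong_length)

locale diagonal_braiding = quantum_shuffle q for q :: "nat \<Rightarrow> nat \<Rightarrow> 'k::field" +
  fixes scale :: "'k \<Rightarrow> 'v::ab_group_add \<Rightarrow> 'v"
    and c :: "('v, 'k) tensor \<Rightarrow> ('v, 'k) tensor"
    and n :: nat and x :: "nat \<Rightarrow> 'v"
  assumes braided: "braided_pair scale c"
    and diagonal: "diagonal_type_data scale c n x q"
begin

abbreviation letters :: "nat set" where
  "letters \<equiv> {1..n}"

abbreviation TA :: "('v, 'k) tensor set" where
  "TA \<equiv> tensor_algebra scale"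

definition P :: "nat list \<Rightarrow> ('v, 'k) tensor" where
  "P w = pure_tensor scale (map x w)"

lemma vector_space_scale: "vector_space scale"
  using braided by (simp add: braided_pair_def)

sublocale V: vector_space scale
  by (rule vector_space_scale)

lemma basis: "inj_on x letters" "V.independent (x ` letters)" "V.span (x ` letters) = UNIV"
  using diagonal by (auto simp: diagonal_type_data_def is_basis_def)

lemma c_letters:
  "i \<in> letters \<Longrightarrow> j \<in> letters \<Longrightarrow> c (P [i, j]) = tscale (q i j) (P [j, i])"
  using diagonal by (simp add: diagonal_type_data_def P_def)

lemma c_add: "s \<in> tensor_power scale 2 \<Longrightarrow> t \<in> tensor_power scale 2 \<Longrightarrow> c (s + t) = c s + c t"
  and c_scale: "t \<in> tensor_power scale 2 \<Longrightarrow> c (tscale a t) = tscale a (c t)"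
  using braided by (simp_all add: braided_pair_def)

lemma c_zero: "c 0 = 0"
  using c_scale[of 0 0] by (simp add: tensor_power_def tens.span_zero)

lemma subspace_TA: "tens.subspace TA"
  by (simp add: tensor_algebra_def tens.subspace_span)

lemma TA_add: "s \<in> TA \<Longrightarrow> t \<in> TA \<Longrightarrow> s + t \<in> TA"
  and TA_scale: "t \<in> TA \<Longrightarrow> tscale a t \<in> TA"
  and TA_zero: "0 \<in> TA"
  using subspace_TA by (auto simp: tens.subspace_def)

lemma P_in_TA: "P w \<in> TA"
  by (auto simp: P_def tensor_algebra_def intro: tens.span_base)

lemma P_append: "P (v @ w) \<phi>s = P v (take (length v) \<phi>s) * P w (drop (length v) \<phi>s)"
  by (simp add: P_def pure_tensor_append)

lemma P_wrong_length: "length \<phi>s \<noteq> length w \<Longrightarrow> P w \<phi>s = 0"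
  by (simp add: P_def pure_tensor_wrong_length)

lemma pure_tensor_in_span_P:
  "w \<in> lists letters \<Longrightarrow> pure_tensor scale (map x w @ vs) \<in> tens.span (P ` lists letters)"
proof (induction vs arbitrary: w)
  case Nil
  then show ?case by (auto simp: P_def[symmetric] intro: tens.span_base)
next
  case (Cons v vs)
  have "v \<in> V.span (x ` letters)" using basis by simp
  then show ?case
  proof (induction rule: V.span_induct_alt)
    case base
    have "pure_tensor scale (map x w @ 0 # vs) = 0"
      using pure_tensor_linear_slot[OF vector_space_scale, of "map x w" "1" 0 0 vs] by simp
    then show ?case by (simp add: tens.span_zero)
  next
    case (step a y v')
    then obtain i where i: "i \<in> letters" "y = x i" by auto
    have "pure_tensor scale (map x w @ y # vs) \<in> tens.span (P ` lists letters)"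
      using Cons.IH[of "w @ [i]"] Cons.prems i by simp
    then show ?case
      using step(2)
      by (simp add: pure_tensor_linear_slot[OF vector_space_scale] tens.span_add tens.span_scale)
  qed
qed

lemma TA_eq_span_P: "TA = tens.span (P ` lists letters)"
proof
  show "TA \<subseteq> tens.span (P ` lists letters)"
    unfolding tensor_algebra_def
    using pure_tensor_in_span_P[of "[]"]
    by (intro tens.span_minimal tens.subspace_span) auto
  show "tens.span (P ` lists letters) \<subseteq> TA"
    using P_in_TA subspace_TA by (intro tens.span_minimal) auto
qed

text \<open>
  Braid generators and everything built from them are linear on the tensor algebra only, since \<open>c\<close> is
  constrained on \<open>V \<otimes> V\<close> alone.
\<close>

definition ta_lin :: "(('v, 'k) tensor \<Rightarrow> 'b \<Rightarrow> 'k) \<Rightarrow> bool" where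
  "ta_lin L \<longleftrightarrow> (\<forall>s\<in>TA. \<forall>t\<in>TA. L (s + t) = L s + L t) \<and> (\<forall>a. \<forall>t\<in>TA. L (tscale a t) = tscale a (L t))"

lemma lin_imp_ta_lin: "lin L \<Longrightarrow> ta_lin L"
  by (simp add: lin_def ta_lin_def)

lemma ta_lin_add: "ta_lin L \<Longrightarrow> s \<in> TA \<Longrightarrow> t \<in> TA \<Longrightarrow> L (s + t) = L s + L t"
  and ta_lin_scale: "ta_lin L \<Longrightarrow> t \<in> TA \<Longrightarrow> L (tscale a t) = tscale a (L t)"
  by (simp_all add: ta_lin_def)

lemma ta_lin_zero: "ta_lin L \<Longrightarrow> L 0 = 0"
  using ta_lin_scale[of L 0 0] TA_zero by simp

lemma ta_lin_comp:
  "ta_lin L \<Longrightarrow> (\<And>t. t \<in> TA \<Longrightarrow> L t \<in> TA) \<Longrightarrow> ta_lin L' \<Longrightarrow> ta_lin (\<lambda>t. L' (L t))"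
  by (simp add: ta_lin_def)

lemma ta_lin_comp_lin: "ta_lin L \<Longrightarrow> lin L' \<Longrightarrow> ta_lin (\<lambda>t. L' (L t))"
  by (simp add: ta_lin_def lin_def)

lemma TA_induct [consumes 1, case_names zero step]:
  assumes "t \<in> TA" "Q 0"
    and "\<And>a w t. w \<in> lists letters \<Longrightarrow> t \<in> TA \<Longrightarrow> Q t \<Longrightarrow> Q (tscale a (P w) + t)"
  shows "Q t"
proof -
  have "t \<in> TA \<and> Q t"
    using assms(1) unfolding TA_eq_span_P
  proof (induction rule: tens.span_induct_alt)
    case base
    show ?case using assms(2) by (simp add: tens.span_zero)
  next
    case (step a y t)
    then obtain w where w: "w \<in> lists letters" "y = P w" by blast
    with step assms(3)[of w t a] show ?case
      unfolding TA_eq_span_P by (auto intro: tens.span_add tens.span_scale tens.span_base)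
  qed
  then show ?thesis by simp
qed

lemma ta_lin_eqI:
  assumes "ta_lin L" "ta_lin L'" "\<And>w. w \<in> lists letters \<Longrightarrow> L (P w) = L' (P w)" "t \<in> TA"
  shows "L t = L' t"
  using assms(4)
  by (induction rule: TA_induct)
     (simp_all add: assms(1-3) ta_lin_zero ta_lin_add ta_lin_scale TA_scale P_in_TA)

lemma ta_lin_in:
  assumes "ta_lin L" "tens.subspace U" "\<And>w. w \<in> lists letters \<Longrightarrow> L (P w) \<in> U" "t \<in> TA"
  shows "L t \<in> U"
  using assms(4)
  by (induction rule: TA_induct)
     (simp_all add: assms ta_lin_zero ta_lin_add ta_lin_scale TA_scale P_in_TA
       tens.subspace_0 tens.subspace_add tens.subspace_scale)

lemma ta_lin_TA:
  "ta_lin L \<Longrightarrow> (\<And>w. w \<in> lists letters \<Longrightarrow> L (P w) \<in> TA) \<Longrightarrow> t \<in> TA \<Longrightarrow> L t \<in> TA"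
  by (rule ta_lin_in[OF _ subspace_TA])

definition dual :: "nat \<Rightarrow> 'v \<Rightarrow> 'k" where
  "dual i v = V.representation (x ` letters) v (x i)"

lemma linear_dual: "Vector_Spaces.linear scale (*) (dual i)"
  unfolding dual_def using basis by (intro V.linear_representation)

lemma dual_x: "i \<in> letters \<Longrightarrow> j \<in> letters \<Longrightarrow> dual i (x j) = (if i = j then 1 else 0)"
  using basis by (auto simp: dual_def V.representation_basis dest: inj_onD)

text \<open>
  The coordinates of a tensor in the basis \<open>P w\<close>, read off at the words in the dual basis.
\<close>

definition coord :: "('v, 'k) tensor \<Rightarrow> nat list \<Rightarrow> 'k" where
  "coord t w = (if w \<in> lists letters then t (map dual w) else 0)"

lemma lin_coord: "lin coord"
  by (simp add: lin_def coord_def pointwise tscale_apply)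

lemma coord_P: assumes "w \<in> lists letters" shows "coord (P w) = word w"
proof
  fix u
  have *: "u \<in> lists letters \<Longrightarrow> P w (map dual u) = (if u = w then 1 else 0)"
    using assms
  proof (induction w arbitrary: u)
    case Nil
    then show ?case by (auto simp: P_def pure_tensor_Nil)
  next
    case (Cons i w)
    then show ?case
      by (cases u) (auto simp: P_def pure_tensor_Cons linear_dual dual_x simp del: atLeastAtMost_iff)
  qed
  show "coord (P w) u = word w u"
  proof (cases "u \<in> lists letters")
    case True
    then show ?thesis by (simp only: coord_def word_def if_True *)
  next
    case False
    then have "u \<noteq> w" using assms by blast
    with False show ?thesis by (simp only: coord_def word_def if_False)
  qed
qed

lemma TA_expansion:
  assumes "t \<in> TA"
  shows "t \<phi>s = (\<Sum>w | set w \<subseteq> letters \<and> length w = length \<phi>s. coord t w * P w \<phi>s)"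
  using assms
proof (induction rule: TA_induct)
  case zero
  show ?case by (simp add: coord_def zero_fun_apply)
next
  case (step a v t)
  have fin: "finite {w. set w \<subseteq> letters \<and> length w = length \<phi>s}"
    by (rule finite_lists_length_eq) simp
  have v: "set v \<subseteq> letters" using step(1) by auto
  have "(\<Sum>w | set w \<subseteq> letters \<and> length w = length \<phi>s. coord (P v) w * P w \<phi>s) =
    (\<Sum>w | set w \<subseteq> letters \<and> length w = length \<phi>s. if w = v then P v \<phi>s else 0)"
    unfolding coord_P[OF step(1)] by (rule sum.cong) (auto simp: word_def)
  also have "\<dots> = P v \<phi>s"
    using v fin by (simp add: P_wrong_length)
  finally have "(\<Sum>w | set w \<subseteq> letters \<and> length w = length \<phi>s. coord (P v) w * P w \<phi>s) = P v \<phi>s" .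
  moreover have "coord (tscale a (P v) + t) w = a * coord (P v) w + coord t w" for w
    by (simp only: lin_add[OF lin_coord] lin_scale[OF lin_coord] plus_fun_apply tscale_apply)
  moreover have "(tscale a (P v) + t) \<phi>s = a * P v \<phi>s + t \<phi>s"
    by (simp only: plus_fun_apply tscale_apply)
  ultimately show ?case
    by (simp only: step(3) distrib_right sum.distrib mult.assoc flip: sum_distrib_left)
qed

lemma coord_inj: "t \<in> TA \<Longrightarrow> coord t = 0 \<Longrightarrow> t = 0"
  by (rule ext, subst TA_expansion) (simp_all add: zero_fun_apply)

text \<open>
  The argument of \<open>c\<close> in the definition of \<open>braid_gen\<close>.
\<close>

abbreviation contraction :: "nat \<Rightarrow> ('v \<Rightarrow> 'k) list \<Rightarrow> ('v, 'k) tensor \<Rightarrow> ('v, 'k) tensor" where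
  "contraction i \<phi>s t \<equiv>
     (\<lambda>\<psi>s. if length \<psi>s = 2 then t (take i \<phi>s @ \<psi>s @ drop (i + 2) \<phi>s) else 0)"

lemma lin_contraction: "lin (contraction i \<phi>s)"
  by (auto simp: lin_def pointwise tscale_apply)

lemma contraction_P:
  assumes "i + 2 \<le> length \<phi>s" "i = length v"
  shows "contraction i \<phi>s (P (v @ a # b # w))
    = tscale (P v (take i \<phi>s) * P w (drop (i + 2) \<phi>s)) (P [a, b])"
proof
  fix \<psi>s :: "('v \<Rightarrow> 'k) list"
  have "P (v @ [a, b] @ w) (take i \<phi>s @ \<psi>s @ drop (i + 2) \<phi>s)
      = P v (take i \<phi>s) * (P [a, b] \<psi>s * P w (drop (i + 2) \<phi>s))" if "length \<psi>s = 2"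
    using assms that unfolding P_append[of v] P_append[of "[a, b]"] by simp
  then show "contraction i \<phi>s (P (v @ a # b # w)) \<psi>s
      = tscale (P v (take i \<phi>s) * P w (drop (i + 2) \<phi>s)) (P [a, b]) \<psi>s"
    by (auto simp: tscale_apply P_wrong_length)
qed

lemma contraction_P_short:
  "i + 2 \<le> length \<phi>s \<Longrightarrow> length w \<noteq> length \<phi>s \<Longrightarrow> contraction i \<phi>s (P w) = 0"
  by (auto simp: pointwise P_wrong_length)

lemma split_at_two:
  assumes "i + 2 \<le> length w"
  shows "w = take i w @ w ! i # w ! Suc i # drop (i + 2) w"
  using assms id_take_nth_drop[of i w] Cons_nth_drop_Suc[of "Suc i" w] by simp

lemma contraction_in_tensor_power:
  assumes "i + 2 \<le> length \<phi>s" "t \<in> TA"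
  shows "contraction i \<phi>s t \<in> tensor_power scale 2"
proof (rule ta_lin_in[OF lin_imp_ta_lin[OF lin_contraction] _ _ assms(2)])
  show "tens.subspace (tensor_power scale 2)"
    by (simp add: tensor_power_def tens.subspace_span)
  fix w
  show "contraction i \<phi>s (P w) \<in> tensor_power scale 2"
  proof (cases "length w = length \<phi>s")
    case True
    then have w: "w = take i w @ w ! i # w ! Suc i # drop (i + 2) w"
      using assms(1) by (intro split_at_two) simp
    have "P [w ! i, w ! Suc i] \<in> tensor_power scale 2"
      by (auto simp: P_def tensor_power_def intro!: tens.span_base exI[of _ "[x (w ! i), x (w ! Suc i)]"])
    then show ?thesis
      using True assms(1)
      by (subst w, subst contraction_P) (auto simp: tensor_power_def tens.span_scale)
  next
    case False
    then show ?thesis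
      using contraction_P_short[OF assms(1)] by (simp add: tensor_power_def tens.span_zero)
  qed
qed

lemma ta_lin_braid_gen: "ta_lin (braid_gen c i)"
  unfolding ta_lin_def
proof (intro conjI ballI allI ext)
  fix s t \<phi>s a assume t: "t \<in> TA"
  note in2 = contraction_in_tensor_power[of i \<phi>s]
  { assume s: "s \<in> TA"
    show "braid_gen c i (s + t) \<phi>s = (braid_gen c i s + braid_gen c i t) \<phi>s"
    proof (cases "i + 2 \<le> length \<phi>s")
      case True
      have "c (contraction i \<phi>s (s + t)) = c (contraction i \<phi>s s) + c (contraction i \<phi>s t)"
        unfolding lin_add[OF lin_contraction] using True s t by (intro c_add in2)
      with True show ?thesis by (simp only: braid_gen_def plus_fun_apply if_True)
    qed (simp add: braid_gen_def plus_fun_apply) }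
  show "braid_gen c i (tscale a t) \<phi>s = tscale a (braid_gen c i t) \<phi>s"
  proof (cases "i + 2 \<le> length \<phi>s")
    case True
    have "c (contraction i \<phi>s (tscale a t)) = tscale a (c (contraction i \<phi>s t))"
      unfolding lin_scale[OF lin_contraction] using True t by (intro c_scale in2)
    with True show ?thesis by (simp only: braid_gen_def tscale_apply if_True)
  qed (simp add: braid_gen_def tscale_apply)
qed

lemma braid_gen_P:
  assumes "a \<in> letters" "b \<in> letters"
  shows "braid_gen c (length v) (P (v @ a # b # w)) = tscale (q a b) (P (v @ b # a # w))"
proof
  fix \<phi>s
  let ?i = "length v"
  show "braid_gen c ?i (P (v @ a # b # w)) \<phi>s = tscale (q a b) (P (v @ b # a # w)) \<phi>s"
  proof (cases "?i + 2 \<le> length \<phi>s")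
    case True
    have ab: "P [a, b] \<in> tensor_power scale 2"
      by (auto simp: P_def tensor_power_def intro!: tens.span_base exI[of _ "[x a, x b]"])
    have drop: "take (length [b, a]) (drop ?i \<phi>s) = [\<phi>s ! ?i, \<phi>s ! (?i + 1)]"
        "drop (length [b, a]) (drop ?i \<phi>s) = drop (?i + 2) \<phi>s"
      using True by (simp_all add: take_Suc_conv_app_nth)
    have "P (v @ [b, a] @ w) \<phi>s = P v (take ?i \<phi>s) *
        (P [b, a] [\<phi>s ! ?i, \<phi>s ! (?i + 1)] * P w (drop (?i + 2) \<phi>s))"
      unfolding P_append[of v] P_append[of "[b, a]"] drop ..
    then show ?thesis
      using True unfolding braid_gen_def contraction_P[OF True refl] c_scale[OF ab] c_letters[OF assms]
      by (simp add: tscale_apply mult_ac)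
  next
    case False
    then show ?thesis
      by (simp add: braid_gen_def tscale_apply P_wrong_length)
  qed
qed

lemma braid_gen_P_short:
  assumes "length w < i + 2"
  shows "braid_gen c i (P w) = P w"
proof
  fix \<phi>s
  show "braid_gen c i (P w) \<phi>s = P w \<phi>s"
  proof (cases "i + 2 \<le> length \<phi>s")
    case True
    then show ?thesis
      unfolding braid_gen_def using contraction_P_short[OF True, of w] assms
      by (simp add: c_zero zero_fun_apply P_wrong_length)
  qed (simp add: braid_gen_def)
qed

lemma braid_gen_in_TA: "t \<in> TA \<Longrightarrow> braid_gen c i t \<in> TA"
proof (rule ta_lin_TA[OF ta_lin_braid_gen])
  fix w assume w: "w \<in> lists letters"
  show "braid_gen c i (P w) \<in> TA"
  proof (cases "i + 2 \<le> length w")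
    case True
    then have "set [w ! i, w ! Suc i] \<subseteq> letters" using w by (force simp: in_lists_conv_set)
    moreover have "i = length (take i w)" using True by simp
    ultimately have "braid_gen c i (P (take i w @ w ! i # w ! Suc i # drop (i + 2) w)) \<in> TA"
      using braid_gen_P[of "w ! i" "w ! Suc i" "take i w" "drop (i + 2) w"]
      by (simp add: TA_scale P_in_TA del: atLeastAtMost_iff)
    then show ?thesis using split_at_two[OF True] by simp
  next
    case False
    then show ?thesis by (simp add: braid_gen_P_short P_in_TA)
  qed
qed

lemma braid_word_simps [simp]:
  "braid_word c [] t = t" "braid_word c (i # is) t = braid_gen c i (braid_word c is t)"
  "braid_word c (is @ js) t = braid_word c is (braid_word c js t)"
  by (simp_all add: braid_word_def)

lemma braid_word_in_TA: "t \<in> TA \<Longrightarrow> braid_word c is t \<in> TA"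
  by (induction "is") (simp_all add: braid_gen_in_TA)

lemma ta_lin_braid_word: "ta_lin (braid_word c is)"
proof (induction "is")
  case Nil
  show ?case by (simp add: ta_lin_def)
next
  case (Cons i "is")
  have "ta_lin (\<lambda>t. braid_gen c i (braid_word c is t))"
    by (rule ta_lin_comp[OF Cons braid_word_in_TA ta_lin_braid_gen])
  then show ?case by (simp add: ta_lin_def)
qed

end

section \<open>The Nichols algebra inside the shuffle algebra\<close>

context diagonal_braiding
begin

lemma lists_perm_word:
  "p permutes {..<length w} \<Longrightarrow> w \<in> lists letters \<Longrightarrow> perm_word p w \<in> lists letters"
  using set_perm_word[of p w] by (auto simp: in_lists_conv_set)

lemma inv_coeff_id: "inv_coeff id w = 1"
  by (simp add: inv_coeff_def Inv_id)

lemma braid_gen_perm_word: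
  assumes p: "p permutes {..<length w}" and i: "Suc i < length w" and w: "w \<in> lists letters"
  shows "braid_gen c i (P (perm_word p w))
    = tscale (q (w ! pinv p i) (w ! pinv p (Suc i))) (P (perm_word (transpose i (Suc i) \<circ> p) w))"
proof -
  let ?u = "perm_word p w"
  let ?s = "transpose i (Suc i)"
  have u: "?u = take i ?u @ ?u ! i # ?u ! Suc i # drop (i + 2) ?u"
    using i by (intro split_at_two) simp
  have inv: "pinv (?s \<circ> p) k = pinv p (?s k)" for k
    by (simp add: o_inv_distrib[OF permutes_bij[OF transpose_Suc_permutes[OF i]] permutes_bij[OF p]])
  have swapped: "take i ?u @ ?u ! Suc i # ?u ! i # drop (i + 2) ?u = perm_word (?s \<circ> p) w"
  proof (rule nth_equalityI)
    fix k assume "k < length (take i ?u @ ?u ! Suc i # ?u ! i # drop (i + 2) ?u)"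
    then have k: "k < length w" using i by simp
    have "(take i ?u @ ?u ! Suc i # ?u ! i # drop (i + 2) ?u) ! k = ?u ! (?s k)"
      using i k by (auto simp: nth_append nth_Cons transpose_def split: nat.splits
          intro!: arg_cong[of _ _ "nth ?u"])
    also have "?s k < length w" using i k by (auto simp: transpose_def)
    then have "?u ! (?s k) = perm_word (?s \<circ> p) w ! k"
      using k by (simp only: nth_perm_word inv)
    finally show "(take i ?u @ ?u ! Suc i # ?u ! i # drop (i + 2) ?u) ! k = perm_word (?s \<circ> p) w ! k" .
  qed (use i in simp)
  have "set ?u \<subseteq> letters" using lists_perm_word[OF p w] by auto
  then have l: "?u ! i \<in> letters" "?u ! Suc i \<in> letters"
    using i by (auto simp del: atLeastAtMost_iff intro!: subsetD[of "set ?u" letters])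
  have "braid_gen c i (P ?u) = braid_gen c (length (take i ?u))
      (P (take i ?u @ ?u ! i # ?u ! Suc i # drop (i + 2) ?u))"
    using u i by simp
  also have "\<dots> = tscale (q (?u ! i) (?u ! Suc i)) (P (perm_word (?s \<circ> p) w))"
    unfolding braid_gen_P[OF l] swapped ..
  finally show ?thesis using i by (simp add: nth_perm_word)
qed

lemma inv_coeff_transpose:
  assumes "p permutes {..<length w}" "Suc i < length w" "pinv p i < pinv p (Suc i)"
  shows "inv_coeff (transpose i (Suc i) \<circ> p) w
    = q (w ! pinv p i) (w ! pinv p (Suc i)) * inv_coeff p w"
  unfolding inv_coeff_def Inv_transpose(1)[OF assms]
  using Inv_transpose(2)[OF assms] by simp

text \<open>
  Along a word of minimal length every generator creates a new inversion \<open>(k, l)\<close> and contributes the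
  scalar \<open>q (w ! k) (w ! l)\<close>.  The result only depends on the permutation, so any choice of a reduced
  expression gives the same operator.
\<close>

lemma braid_word_shortest:
  assumes "\<forall>i\<in>set is. Suc i < length w" "length is = card (Inv (length w) (word_perm is))"
    and w: "w \<in> lists letters"
  shows "braid_word c is (P w) = tscale (inv_coeff (word_perm is) w) (P (perm_word (word_perm is) w))"
  using assms(1,2)
proof (induction "is")
  case Nil
  show ?case
    by (simp only: braid_word_simps word_perm_simps inv_coeff_id perm_word_id tens.scale_one)
next
  case (Cons i "is")
  let ?p = "word_perm is"
  have p: "?p permutes {..<length w}" and i: "Suc i < length w"
    using Cons.prems by (auto intro: word_perm_permutes)
  have le: "card (Inv (length w) ?p) \<le> length is"
    using Cons.prems by (intro card_Inv_word_perm) auto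
  have len: "Suc (length is) = card (Inv (length w) (transpose i (Suc i) \<circ> ?p))"
    using Cons.prems(2) by (simp del: o_apply)
  have less: "pinv ?p i < pinv ?p (Suc i)"
    using card_Inv_transpose(1)[OF p i] le len by (cases "pinv ?p i < pinv ?p (Suc i)") auto
  have "length is = card (Inv (length w) ?p)"
    using card_Inv_transpose(1)[OF p i] len less by simp
  then have IH: "braid_word c is (P w) = tscale (inv_coeff ?p w) (P (perm_word ?p w))"
    using Cons by simp
  have "braid_word c (i # is) (P w) = tscale (inv_coeff ?p w) (braid_gen c i (P (perm_word ?p w)))"
    by (simp add: IH ta_lin_scale[OF ta_lin_braid_gen P_in_TA])
  also have "\<dots> = tscale (inv_coeff (word_perm (i # is)) w) (P (perm_word (word_perm (i # is)) w))"
    unfolding braid_gen_perm_word[OF p i w] word_perm_simps inv_coeff_transpose[OF p i less]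
    by (simp add: mult_ac)
  finally show ?case .
qed

lemma matsumoto_section_P:
  assumes p: "p permutes {..<length w}" and w: "w \<in> lists letters"
  shows "matsumoto_section c (length w) p (P w) = tscale (inv_coeff p w) (P (perm_word p w))"
proof -
  define "is" where "is = (SOME is. reduced_expression (length w) p is)"
  have red: "reduced_expression (length w) p is"
    unfolding is_def using reduced_expression_exists[OF p] by (rule someI_ex)
  then have "word_perm is = p" "\<forall>i\<in>set is. Suc i < length w"
    by (simp_all add: reduced_expression_def)
  with braid_word_shortest[OF this(2) _ w] length_reduced_expression[OF p red] show ?thesis
    by (simp add: matsumoto_section_def is_def)
qed

lemma ta_lin_sum: "(\<And>i. i \<in> I \<Longrightarrow> ta_lin (L i)) \<Longrightarrow> ta_lin (\<lambda>t. \<Sum>i\<in>I. L i t)"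
  by (simp add: ta_lin_def sum.distrib tens.scale_sum_right)

lemma ta_lin_quantum_symmetrizer: "ta_lin (quantum_symmetrizer c m)"
  unfolding quantum_symmetrizer_def[abs_def] matsumoto_section_def
  by (intro ta_lin_sum ta_lin_braid_word)

lemma quantum_symmetrizer_P:
  assumes "w \<in> lists letters"
  shows "quantum_symmetrizer c (length w) (P w)
    = (\<Sum>p | p permutes {..<length w}. tscale (inv_coeff p w) (P (perm_word p w)))"
  unfolding quantum_symmetrizer_def using assms by (intro sum.cong) (auto simp: matsumoto_section_P)

lemma degree_part_P: "degree_part m (P w) = (if length w = m then P w else 0)"
  unfolding P_def by (simp add: degree_part_pure_tensor)

lemma degree_part_in_TA: "t \<in> TA \<Longrightarrow> degree_part m t \<in> TA"
  by (rule ta_lin_TA[OF lin_imp_ta_lin[OF lin_degree_part]])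
     (simp add: degree_part_P P_in_TA TA_zero)

lemma ta_lin_pointwise:
  assumes "\<And>\<phi>s. ta_lin (L \<phi>s)"
  shows "ta_lin (\<lambda>t \<phi>s. L \<phi>s t \<phi>s)"
  using assms by (simp add: ta_lin_def fun_eq_iff plus_fun_apply tscale_apply)

abbreviation S :: "('v, 'k) tensor \<Rightarrow> ('v, 'k) tensor" where
  "S \<equiv> graded_symmetrizer c"

lemma ta_lin_S: "ta_lin S"
  unfolding graded_symmetrizer_def[abs_def]
  by (intro ta_lin_pointwise[where L = "\<lambda>\<phi>s t. quantum_symmetrizer c (length \<phi>s) (degree_part (length \<phi>s) t)"]
      ta_lin_comp[OF lin_imp_ta_lin[OF lin_degree_part] degree_part_in_TA ta_lin_quantum_symmetrizer])

lemma S_P: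
  assumes "w \<in> lists letters"
  shows "S (P w) = (\<Sum>p | p permutes {..<length w}. tscale (inv_coeff p w) (P (perm_word p w)))"
    (is "_ = ?r")
proof
  fix \<phi>s
  show "S (P w) \<phi>s = ?r \<phi>s"
  proof (cases "length \<phi>s = length w")
    case True
    then show ?thesis
      using quantum_symmetrizer_P[OF assms] by (simp add: graded_symmetrizer_def degree_part_P)
  next
    case False
    then have "S (P w) \<phi>s = 0"
      by (simp add: graded_symmetrizer_def degree_part_P ta_lin_zero[OF ta_lin_quantum_symmetrizer]
          zero_fun_apply)
    with False show ?thesis
      by (simp add: sum_fun_apply tscale_apply P_wrong_length)
  qed
qed

lemma S_in_TA: "t \<in> TA \<Longrightarrow> S t \<in> TA"
  by (rule ta_lin_TA[OF ta_lin_S])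
     (auto simp: S_P P_in_TA intro!: tens.subspace_sum[OF subspace_TA] TA_scale)

theorem coord_S_P: "w \<in> lists letters \<Longrightarrow> coord (S (P w)) = mon w"
  unfolding S_P lin_sum[OF lin_coord] lin_scale[OF lin_coord] mon_eq_sum_permutations
  by (intro sum.cong refl) (simp only: coord_P lists_perm_word mem_Collect_eq)

lemma ta_lin_coord_S: "ta_lin (\<lambda>t. coord (S t))"
  by (rule ta_lin_comp_lin[OF ta_lin_S lin_coord])

lemma tensor_mult_P: "tensor_mult (P v) (P w) = P (v @ w)"
  by (simp add: P_def tensor_mult_pure_tensor)

lemma tensor_mult_in_TA:
  assumes "s \<in> TA" "t \<in> TA"
  shows "tensor_mult s t \<in> TA"
proof (rule ta_lin_TA[OF lin_imp_ta_lin[OF tensor_mult_linear(1)] _ assms(2)])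
  fix w
  show "tensor_mult s (P w) \<in> TA"
    by (rule ta_lin_TA[OF lin_imp_ta_lin[OF tensor_mult_linear(2)] _ assms(1)])
       (simp add: tensor_mult_P P_in_TA)
qed

text \<open>
  The graded symmetrizer is an algebra map from the tensor algebra to the shuffle algebra.
\<close>

lemma coord_S_tensor_mult:
  assumes "s \<in> TA" "t \<in> TA"
  shows "coord (S (tensor_mult s t)) = coord (S s) \<odot> coord (S t)"
proof -
  have 1: "coord (S (tensor_mult s (P w))) = coord (S s) \<odot> mon w" if w: "w \<in> lists letters" for w
  proof (rule ta_lin_eqI[OF _ _ _ assms(1)])
    show "ta_lin (\<lambda>s. coord (S (tensor_mult s (P w))))"
      by (rule ta_lin_comp[OF lin_imp_ta_lin[OF tensor_mult_linear(2)] _ ta_lin_coord_S])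
         (rule tensor_mult_in_TA[OF _ P_in_TA])
    show "ta_lin (\<lambda>s. coord (S s) \<odot> mon w)"
      by (rule ta_lin_comp_lin[OF ta_lin_coord_S]) (simp add: lin_def shuf_linear)
    show "coord (S (tensor_mult (P v) (P w))) = coord (S (P v)) \<odot> mon w" if "v \<in> lists letters" for v
      using that w append_in_lists_conv[of v w letters]
      by (simp only: tensor_mult_P coord_S_P mon_append simp_thms)
  qed
  show ?thesis
  proof (rule ta_lin_eqI[OF _ _ _ assms(2)])
    show "ta_lin (\<lambda>t. coord (S (tensor_mult s t)))"
      by (rule ta_lin_comp[OF lin_imp_ta_lin[OF tensor_mult_linear(1)] _ ta_lin_coord_S])
         (rule tensor_mult_in_TA[OF assms(1)])
    show "ta_lin (\<lambda>t. coord (S s) \<odot> coord (S t))"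
      by (rule ta_lin_comp_lin[OF ta_lin_coord_S lin_shuf])
  qed (simp add: 1 coord_S_P)
qed

text \<open>
  The scalar of braiding the word \<open>v\<close> past the word \<open>w\<close>.
\<close>

definition bichar :: "nat list \<Rightarrow> nat list \<Rightarrow> 'k" where
  "bichar v w = prod_list (map (\<lambda>i. prod_list (map (q i) w)) v)"

lemma bichar_simps [simp]:
  "bichar [] w = 1" "bichar (i # v) w = prod_list (map (q i) w) * bichar v w"
  by (simp_all add: bichar_def)

lemma bichar_append_left: "bichar (us @ v) w = bichar us w * bichar v w"
  by (simp add: bichar_def)

lemma braid_letter_past_word:
  assumes "a \<in> letters" "v \<in> lists letters" "length us = k"
  shows "braid_word c (rev [k..<k + length v]) (P (us @ a # v @ w))
    = tscale (prod_list (map (q a) v)) (P (us @ v @ a # w))"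
  using assms(2,3)
proof (induction v arbitrary: us k rule: list.induct)
  case (Cons b v)
  have b: "b \<in> letters" "v \<in> lists letters"
    using Cons.prems(1) unfolding Cons_in_lists_iff by blast+
  have r: "rev [k..<k + length (b # v)] = rev [Suc k..<Suc k + length v] @ [k]"
    using upt_conv_Cons[of k "k + length (b # v)"] by (simp del: upt_Suc)
  have "braid_gen c k (P (us @ a # (b # v) @ w)) = tscale (q a b) (P ((us @ [b]) @ a # v @ w))"
    using braid_gen_P[OF assms(1) b(1), of us "v @ w"] Cons.prems by simp
  then show ?case
    unfolding r using Cons.IH[OF b(2), of "us @ [b]" "Suc k"] Cons.prems
    by (simp add: ta_lin_scale[OF ta_lin_braid_word P_in_TA])
qed simp

lemma block_braid_P_aux:
  assumes "v \<in> lists letters" "us \<in> lists letters"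
  shows "block_braid c (length us) (length v) (P (us @ v @ w)) = tscale (bichar us v) (P (v @ us @ w))"
  using assms(2)
proof (induction us arbitrary: w rule: rev_induct)
  case Nil
  then show ?case by (simp add: block_braid_def)
next
  case (snoc a us)
  then have a: "a \<in> letters" "us \<in> lists letters" by auto
  have "block_braid c (length (us @ [a])) (length v) (P ((us @ [a]) @ v @ w))
    = block_braid c (length us) (length v) (tscale (prod_list (map (q a) v)) (P (us @ v @ a # w)))"
    using braid_letter_past_word[OF a(1) assms(1) refl, of us w] by (simp add: block_braid_def)
  also have "\<dots> = tscale (bichar (us @ [a]) v) (P (v @ (us @ [a]) @ w))"
    unfolding block_braid_def ta_lin_scale[OF ta_lin_braid_word P_in_TA]
    using snoc.IH[OF a(2), of "a # w"]
    by (simp add: block_braid_def bichar_append_left mult_ac)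
  finally show ?case .
qed

lemma block_braid_P:
  "v \<in> lists letters \<Longrightarrow> us \<in> lists letters \<Longrightarrow>
    block_braid c (length us) (length v) (P (us @ v)) = tscale (bichar us v) (P (v @ us))"
  using block_braid_P_aux[of v us "[]"] by simp

lemma ta_lin_block_braid: "ta_lin (block_braid c k m)"
  unfolding block_braid_def[abs_def] by (rule ta_lin_braid_word)

lemma tensor_mult_braid_P:
  assumes v: "v \<in> lists letters" and w: "w \<in> lists letters"
  shows "tensor_mult_braid c (P v) (P w) = tscale (bichar v w) (P (w @ v))"
proof
  fix \<phi>s
  have "tensor_mult_braid c (P v) (P w) \<phi>s = (\<Sum>m\<le>length \<phi>s.
      if m = length v then tscale (bichar v w) (P (w @ v)) \<phi>s else 0)"
    unfolding tensor_mult_braid_def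
  proof (rule sum.cong)
    fix m assume "m \<in> {..length \<phi>s}"
    show "block_braid c m (length \<phi>s - m)
        (tensor_mult (degree_part m (P v)) (degree_part (length \<phi>s - m) (P w))) \<phi>s
      = (if m = length v then tscale (bichar v w) (P (w @ v)) \<phi>s else 0)"
    proof (cases "m = length v \<and> length \<phi>s - m = length w")
      case True
      then have "length \<phi>s - m = length w" "m = length v" by auto
      then show ?thesis by (simp only: degree_part_P tensor_mult_P block_braid_P[OF w v] simp_thms if_True)
    next
      case False
      then have "length v \<noteq> m \<or> length w \<noteq> length \<phi>s - m" by auto
      moreover have "P (w @ v) \<phi>s = 0" if "m = length v"
        using False that \<open>m \<in> {..length \<phi>s}\<close> by (intro P_wrong_length) auto
      ultimately show ?thesis
        by (auto simp: degree_part_P lin_zero[OF tensor_mult_linear(1)]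
          lin_zero[OF tensor_mult_linear(2)] ta_lin_zero[OF ta_lin_block_braid] zero_fun_apply
          tscale_apply)
    qed
  qed simp
  also have "\<dots> = tscale (bichar v w) (P (w @ v)) \<phi>s"
    by (simp add: P_wrong_length tscale_apply)
  finally show "tensor_mult_braid c (P v) (P w) \<phi>s = tscale (bichar v w) (P (w @ v)) \<phi>s" .
qed

lemma ta_lin_pointwise_sum:
  assumes "\<And>\<phi>s i. ta_lin (L \<phi>s i)"
  shows "ta_lin (\<lambda>t \<phi>s. \<Sum>i\<in>I \<phi>s. L \<phi>s i t \<phi>s)"
proof -
  have "ta_lin (\<lambda>t \<phi>s. (\<Sum>i\<in>I \<phi>s. L \<phi>s i t) \<phi>s)"
    by (rule ta_lin_pointwise[where L = "\<lambda>\<phi>s t. \<Sum>i\<in>I \<phi>s. L \<phi>s i t"]) (rule ta_lin_sum[OF assms])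
  then show ?thesis by (simp only: sum_fun_apply)
qed

lemma ta_lin_tensor_mult_braid:
  "s \<in> TA \<Longrightarrow> ta_lin (tensor_mult_braid c s)"
  "t \<in> TA \<Longrightarrow> ta_lin (\<lambda>s. tensor_mult_braid c s t)"
proof -
  assume "s \<in> TA"
  then have "ta_lin (\<lambda>t. block_braid c m k (tensor_mult (degree_part m s) (degree_part k t)))" for m k
    by (intro ta_lin_comp[OF _ _ ta_lin_block_braid] tensor_mult_in_TA degree_part_in_TA
        ta_lin_comp_lin[OF _ tensor_mult_linear(1)] lin_imp_ta_lin[OF lin_degree_part])
  then show "ta_lin (tensor_mult_braid c s)"
    unfolding tensor_mult_braid_def[abs_def] by (rule ta_lin_pointwise_sum)
next
  assume "t \<in> TA"
  then have "ta_lin (\<lambda>s. block_braid c m k (tensor_mult (degree_part m s) (degree_part k t)))" for m k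
    by (intro ta_lin_comp[OF _ _ ta_lin_block_braid] tensor_mult_in_TA degree_part_in_TA
        ta_lin_comp_lin[OF _ tensor_mult_linear(2)] lin_imp_ta_lin[OF lin_degree_part])
  then show "ta_lin (\<lambda>s. tensor_mult_braid c s t)"
    unfolding tensor_mult_braid_def[abs_def] by (rule ta_lin_pointwise_sum)
qed

lemma tensor_mult_braid_in_TA:
  assumes "s \<in> TA" "t \<in> TA"
  shows "tensor_mult_braid c s t \<in> TA"
proof (rule ta_lin_TA[OF ta_lin_tensor_mult_braid(1)[OF assms(1)] _ assms(2)])
  fix w assume w: "w \<in> lists letters"
  show "tensor_mult_braid c s (P w) \<in> TA"
    by (rule ta_lin_TA[OF ta_lin_tensor_mult_braid(2)[OF P_in_TA] _ assms(1)])
       (simp add: tensor_mult_braid_P[OF _ w] TA_scale P_in_TA)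
qed

lemma tw_mon: "tw g (mon w) = tscale (prod_list (map g w)) (mon w)"
  by (induction w) (simp_all add: tw_word tw_shuf shuf_linear mult_ac)

text \<open>
  For words, the scalar \<open>bichar v w\<close> can be absorbed into an automorphism \<open>tw\<close> applied to the
  symmetrization of \<open>v\<close>, because that is a combination of permutations of \<open>v\<close>.  The resulting
  formula extends linearly to all \<open>s\<close> and depends on \<open>s\<close> only through its symmetrization.
\<close>

lemma coord_S_tensor_mult_braid:
  assumes s: "s \<in> TA" and t: "t \<in> TA" and sb: "coord (S s) = X b"
  shows "coord (S (tensor_mult_braid c s t)) = tw (q b) (coord (S t)) \<odot> X b"
proof -
  have 1: "coord (S (tensor_mult_braid c s (P w)))
      = mon w \<odot> tw (\<lambda>i. prod_list (map (q i) w)) (coord (S s))" if w: "w \<in> lists letters" for w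
  proof (rule ta_lin_eqI[OF _ _ _ s])
    show "ta_lin (\<lambda>s. coord (S (tensor_mult_braid c s (P w))))"
      by (rule ta_lin_comp[OF ta_lin_tensor_mult_braid(2)[OF P_in_TA] _ ta_lin_coord_S])
         (rule tensor_mult_braid_in_TA[OF _ P_in_TA])
    show "ta_lin (\<lambda>s. mon w \<odot> tw (\<lambda>i. prod_list (map (q i) w)) (coord (S s)))"
      by (rule ta_lin_comp_lin[OF ta_lin_coord_S]) (simp add: lin_def shuf_linear)
    fix v assume v: "v \<in> lists letters"
    have "w @ v \<in> lists letters" using v w by simp
    then show "coord (S (tensor_mult_braid c (P v) (P w)))
      = mon w \<odot> tw (\<lambda>i. prod_list (map (q i) w)) (coord (S (P v)))"
      by (simp only: tensor_mult_braid_P[OF v w] ta_lin_scale[OF ta_lin_S P_in_TA]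
          lin_scale[OF lin_coord] coord_S_P v mon_append tw_mon shuf_scale_right bichar_def)
  qed
  show ?thesis
  proof (rule ta_lin_eqI[OF _ _ _ t])
    show "ta_lin (\<lambda>t. coord (S (tensor_mult_braid c s t)))"
      by (rule ta_lin_comp[OF ta_lin_tensor_mult_braid(1)[OF s] _ ta_lin_coord_S])
         (rule tensor_mult_braid_in_TA[OF s])
    show "ta_lin (\<lambda>t. tw (q b) (coord (S t)) \<odot> X b)"
      by (rule ta_lin_comp_lin[OF ta_lin_coord_S]) (simp add: lin_def shuf_linear)
  qed (simp add: 1 coord_S_P sb tw_word tw_mon shuf_linear)
qed

abbreviation B :: "('v, 'k) tensor set" where
  "B \<equiv> nichols scale c"

lemma nichols_subset_TA: "B \<subseteq> TA"
  by (auto simp: nichols_def S_in_TA)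

lemma subspace_nichols: "tens.subspace B"
  unfolding tens.subspace_def nichols_def
proof (intro conjI ballI allI)
  show "0 \<in> S ` TA" using ta_lin_zero[OF ta_lin_S] TA_zero by (metis imageI)
next
  fix s t assume "s \<in> S ` TA" "t \<in> S ` TA"
  then show "s + t \<in> S ` TA" by (auto simp: TA_add simp flip: ta_lin_add[OF ta_lin_S])
next
  fix a t assume "t \<in> S ` TA"
  then show "tscale a t \<in> S ` TA" by (auto simp: TA_scale simp flip: ta_lin_scale[OF ta_lin_S])
qed

lemma coord_nichols: "coord ` B = nich letters"
proof
  show "coord ` B \<subseteq> nich letters"
  proof clarify
    fix t assume "t \<in> B"
    then obtain s where s: "s \<in> TA" "t = S s" by (auto simp: nichols_def)
    show "coord t \<in> nich letters"
      unfolding s(2)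
    proof (rule ta_lin_in[OF ta_lin_coord_S _ _ s(1)])
      show "tens.subspace (nich letters)" unfolding nich_def by (rule tens.subspace_span)
      show "coord (S (P w)) \<in> nich letters" if "w \<in> lists letters" for w
        unfolding coord_S_P[OF that] by (rule mon_in_nich[OF that])
    qed
  qed
  have "tens.subspace (coord ` B)"
  proof -
    have "f + g \<in> coord ` B" if "f \<in> coord ` B" "g \<in> coord ` B" for f g
      using that tens.subspace_add[OF subspace_nichols]
      by (auto simp flip: lin_add[OF lin_coord])
    moreover have "tscale a f \<in> coord ` B" if "f \<in> coord ` B" for a f
      using that tens.subspace_scale[OF subspace_nichols]
      by (auto simp flip: lin_scale[OF lin_coord])
    moreover have "0 \<in> coord ` B"
      using tens.subspace_0[OF subspace_nichols] lin_zero[OF lin_coord] by (metis imageI)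
    ultimately show ?thesis unfolding tens.subspace_def by blast
  qed
  moreover have "mon ` lists letters \<subseteq> coord ` B"
  proof (rule image_subsetI)
    fix w assume "w \<in> lists letters"
    then have "mon w = coord (S (P w))" by (simp only: coord_S_P)
    then show "mon w \<in> coord ` B"
      unfolding nichols_def using P_in_TA by blast
  qed
  ultimately show "nich letters \<subseteq> coord ` B"
    unfolding nich_def by (rule tens.span_minimal[rotated])
qed

lemma coord_eq_0_iff: "t \<in> B \<Longrightarrow> coord t = 0 \<longleftrightarrow> t = 0"
  using coord_inj nichols_subset_TA lin_zero[OF lin_coord] by blast

lemma nichols_preimage:
  assumes "t \<in> B"
  shows "inv_into TA S t \<in> TA" "S (inv_into TA S t) = t"
  using assms unfolding nichols_def by (simp_all add: inv_into_into f_inv_into_f)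

text \<open>
  The preimages chosen in the definition of the two products do not matter: by
  \<open>coord_S_tensor_mult\<close> and \<open>coord_S_tensor_mult_braid\<close> the result only depends on their
  symmetrizations.
\<close>

lemma coord_nichols_Ad:
  assumes "s \<in> B" "t \<in> B" "coord s = X b"
  shows "nichols_Ad scale c s t \<in> B"
    and "coord (nichols_Ad scale c s t) = X b \<odot> coord t - tw (q b) (coord t) \<odot> X b"
proof -
  note pre = nichols_preimage[OF assms(1)] nichols_preimage[OF assms(2)]
  have "nichols_mult scale c s t \<in> B" "nichols_mult_braid scale c s t \<in> B"
    using pre by (auto simp: nichols_mult_def nichols_mult_braid_def nichols_def
        tensor_mult_in_TA tensor_mult_braid_in_TA)
  then show "nichols_Ad scale c s t \<in> B"
    unfolding nichols_Ad_def by (rule tens.subspace_diff[OF subspace_nichols])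
  have "coord (nichols_mult scale c s t) = X b \<odot> coord t"
    unfolding nichols_mult_def using pre assms(3) by (simp add: coord_S_tensor_mult)
  moreover have "coord (nichols_mult_braid scale c s t) = tw (q b) (coord t) \<odot> X b"
    unfolding nichols_mult_braid_def using pre assms(3) by (simp add: coord_S_tensor_mult_braid)
  moreover have "coord (f - g) = coord f - coord g" for f g
    using lin_add[OF lin_coord, of "f - g" g] by (simp add: algebra_simps)
  ultimately show "coord (nichols_Ad scale c s t) = X b \<odot> coord t - tw (q b) (coord t) \<odot> X b"
    by (simp add: nichols_Ad_def)
qed

lemma nichols_of_vector_in:
  assumes "a \<in> letters"
  shows "nichols_of_vector scale c (x a) \<in> B" "coord (nichols_of_vector scale c (x a)) = X a"
proof -
  have eq: "nichols_of_vector scale c (x a) = S (P [a])"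
    by (simp add: nichols_of_vector_def P_def)
  show "nichols_of_vector scale c (x a) \<in> B"
    unfolding eq nichols_def using P_in_TA by blast
  have "[a] \<in> lists letters" using assms by (intro lists.intros)
  then show "coord (nichols_of_vector scale c (x a)) = X a"
    unfolding eq using coord_S_P[of "[a]"] by simp
qed

lemma coord_nichols_Ad_pow:
  assumes ab: "a \<in> letters" "b \<in> letters"
  defines "T \<equiv> nichols_Ad scale c (nichols_of_vector scale c (x b))"
  shows "(T ^^ k) (nichols_of_vector scale c (x a)) \<in> B
    \<and> coord ((T ^^ k) (nichols_of_vector scale c (x a))) = ad a b k"
proof (induction k)
  case 0
  then show ?case using nichols_of_vector_in[OF ab(1)] by simp
next
  case (Suc k)
  let ?t = "(T ^^ k) (nichols_of_vector scale c (x a))"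
  have t: "?t \<in> B" "coord ?t = ad a b k" using Suc by auto
  have "T ?t \<in> B" "coord (T ?t) = X b \<odot> coord ?t - tw (q b) (coord ?t) \<odot> X b"
    using coord_nichols_Ad[OF nichols_of_vector_in(1)[OF ab(2)] t(1) nichols_of_vector_in(2)[OF ab(2)]]
    by (simp_all only: T_def)
  then show ?case
    by (simp only: t(2) tw_ad ad.simps(2) shuf_scale_left funpow.simps o_apply simp_thms)
qed

lemma nilpotency_order_iff_ad:
  assumes "a \<in> letters" "b \<in> letters"
  shows "nilpotency_order (nichols_Ad scale c (nichols_of_vector scale c (x b)))
      (nichols_of_vector scale c (x a)) (r + 1) \<longleftrightarrow> ad a b r \<noteq> 0 \<and> ad a b (Suc r) = 0"
proof -
  let ?T = "nichols_Ad scale c (nichols_of_vector scale c (x b))"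
  let ?y = "nichols_of_vector scale c (x a)"
  have *: "(?T ^^ k) ?y = 0 \<longleftrightarrow> ad a b k = 0" for k
    using coord_nichols_Ad_pow[OF assms, of k] coord_eq_0_iff by metis
  have "ad a b 0 \<noteq> 0"
    by (auto simp: word_def fun_eq_iff zero_fun_apply)
  then have "?y \<noteq> 0" using *[of 0] by simp
  then show ?thesis
    unfolding nilpotency_order_def using *[of r] *[of "Suc r"] by auto
qed

lemma has_indep_nichols: "has_indep B m \<longleftrightarrow> has_indep (nich letters) m"
proof
  assume "has_indep B m"
  then obtain U where U: "U \<subseteq> B" "finite U" "tens.independent U" "card U = m"
    unfolding has_indep_def by blast
  have "has_indep (nich letters) (card U)"
  proof (rule has_indep_family[where v = coord])
    show "coord ` U \<subseteq> nich letters" using U(1) coord_nichols by blast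
    fix l t assume s: "(\<Sum>t\<in>U. tscale (l t) (coord t)) = 0" and t: "t \<in> U"
    have "(\<Sum>t\<in>U. tscale (l t) t) \<in> B"
      using U(1) by (intro tens.subspace_sum[OF subspace_nichols] tens.subspace_scale[OF subspace_nichols]) auto
    moreover have "coord (\<Sum>t\<in>U. tscale (l t) t) = 0"
      using s by (simp add: lin_sum[OF lin_coord] lin_scale[OF lin_coord])
    ultimately have "(\<Sum>t\<in>U. tscale (l t) t) = 0" by (simp add: coord_eq_0_iff)
    then show "l t = 0" by (rule has_indep_scalars[OF U(2,3) _ t])
  qed (rule U(2))
  with U(4) show "has_indep (nich letters) m" by simp
next
  assume "has_indep (nich letters) m"
  then obtain U where U: "U \<subseteq> nich letters" "finite U" "tens.independent U" "card U = m"
    unfolding has_indep_def by blast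
  define pre where "pre = inv_into B coord"
  have pre: "pre f \<in> B" "coord (pre f) = f" if "f \<in> U" for f
    using that U(1) unfolding coord_nichols[symmetric] pre_def
    by (auto simp: subset_iff inv_into_into f_inv_into_f)
  have "has_indep B (card U)"
  proof (rule has_indep_family[where v = pre])
    show "pre ` U \<subseteq> B" using pre by blast
    fix l f assume s: "(\<Sum>f\<in>U. tscale (l f) (pre f)) = 0" and f: "f \<in> U"
    have "(\<Sum>f\<in>U. tscale (l f) f) = coord (\<Sum>f\<in>U. tscale (l f) (pre f))"
      by (simp add: lin_sum[OF lin_coord] lin_scale[OF lin_coord] pre)
    also have "\<dots> = 0" unfolding s by (rule lin_zero[OF lin_coord])
    finally show "l f = 0" by (rule has_indep_scalars[OF U(2,3) _ f])
  qed (rule U(2))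
  with U(4) show "has_indep B m" by simp
qed

lemma nichols_dim_eq_sdim: "nichols_dim scale c = sdim B"
  by (simp add: nichols_dim_def sdim_def)

end

section \<open>Braidings of finite group type\<close>

context diagonal_braiding
begin

lemma pure_tensor_2_in: "pure_tensor scale [v, w] \<in> tensor_power scale 2"
  by (auto simp: tensor_power_def intro!: tens.span_base exI[of _ "[v, w]"])

text \<open>
  Contract the last factor of \<open>c (x i \<otimes> x j)\<close> with the form \<open>\<psi> k\<close> dual to \<open>y k\<close>.  Computed in the
  basis \<open>y\<close> this gives \<open>\<psi> k (x i)\<close> times \<open>g k (x j)\<close>, computed in the basis \<open>x\<close> it gives
  \<open>\<psi> k (x i)\<close> times \<open>q i j\<close> times \<open>x j\<close>.  Some \<open>\<psi> k (x i)\<close> is nonzero.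
\<close>

lemma braiding_eigenvalue:
  assumes gt: "group_type_data scale c m y g" and i: "i \<in> letters" and j: "j \<in> letters"
  shows "\<exists>k\<in>{1..m}. g k (x j) = scale (q i j) (x j)"
proof -
  have y: "inj_on y {1..m}" "V.independent (y ` {1..m})" "V.span (y ` {1..m}) = UNIV"
    and g: "\<And>k. k \<in> {1..m} \<Longrightarrow> Vector_Spaces.linear scale scale (g k)"
    and cy: "\<And>k l. k \<in> {1..m} \<Longrightarrow> l \<in> {1..m} \<Longrightarrow>
        c (pure_tensor scale [y k, y l]) = pure_tensor scale [g k (y l), y k]"
    using gt by (auto simp: group_type_data_def is_basis_def GL_def)
  define \<psi> where "\<psi> k v = V.representation (y ` {1..m}) v (y k)" for k v
  have lin_\<psi>: "Vector_Spaces.linear scale (*) (\<psi> k)" for k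
    unfolding \<psi>_def[abs_def] using y by (intro V.linear_representation)
  have \<psi>_y: "\<psi> k (y l) = (if k = l then 1 else 0)" if "k \<in> {1..m}" "l \<in> {1..m}" for k l
    using that y by (auto simp: \<psi>_def V.representation_basis dest: inj_onD)
  have lin_rules: "f (scale a v + w) = a * f v + f w" "f 0 = 0"
    if "Vector_Spaces.linear scale (*) f" for f a v w
  proof -
    have f: "f (scale a v) = a * f v" "f (v + w) = f v + f w" for a v w
      using that by (simp_all add: Vector_Spaces.linear_def module_hom_iff)
    show "f (scale a v + w) = a * f v + f w" by (simp add: f)
    show "f 0 = 0" using f(1)[of 0 0] by simp
  qed
  have g_rules: "g k (scale a v + w) = scale a (g k v) + g k w" "g k 0 = 0"
    if "k \<in> {1..m}" for k a v w
  proof -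
    have f: "g k (scale a v) = scale a (g k v)" "g k (v + w) = g k v + g k w" for a v w
      using g[OF that] by (simp_all add: Vector_Spaces.linear_def module_hom_iff)
    show "g k (scale a v + w) = scale a (g k v) + g k w" by (simp add: f)
    show "g k 0 = 0" using f(1)[of 0 0] by simp
  qed
  have c_slot1: "c (pure_tensor scale [scale a v + v', w])
      = tscale a (c (pure_tensor scale [v, w])) + c (pure_tensor scale [v', w])" for a v v' w
    using pure_tensor_linear_slot[OF vector_space_scale, of "[]" a v v' "[w]"]
    by (simp add: c_add c_scale pure_tensor_2_in tensor_power_def tens.span_scale
        pure_tensor_2_in[unfolded tensor_power_def])
  have c_slot2: "c (pure_tensor scale [w, scale a v + v'])
      = tscale a (c (pure_tensor scale [w, v])) + c (pure_tensor scale [w, v'])" for a v v' w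
    using pure_tensor_linear_slot[OF vector_space_scale, of "[w]" a v v' "[]"]
    by (simp add: c_add c_scale pure_tensor_2_in tensor_power_def tens.span_scale
        pure_tensor_2_in[unfolded tensor_power_def])
  have c_0: "c (pure_tensor scale [0, w]) = 0" "c (pure_tensor scale [w, 0]) = 0" for w
    using c_slot1[of 1 0 0 w] c_slot2[of w 1 0 0] by simp_all
  \<comment> \<open>both sides are bilinear in \<open>v\<close> and \<open>w\<close>, so it suffices to compare them on the basis \<open>y\<close>\<close>
  have key: "c (pure_tensor scale [v, w]) [\<phi>, \<psi> k] = \<psi> k v * \<phi> (g k w)"
    if k: "k \<in> {1..m}" and \<phi>: "Vector_Spaces.linear scale (*) \<phi>" for k \<phi> v w
  proof -
    have "v \<in> V.span (y ` {1..m})" "w \<in> V.span (y ` {1..m})" using y by auto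
    then show ?thesis
    proof (induction arbitrary: w rule: V.span_induct_alt)
      case base
      then show ?case by (simp add: c_0 zero_fun_apply lin_rules[OF lin_\<psi>])
    next
      case (step a v v')
      then obtain l where l: "l \<in> {1..m}" "v = y l" by auto
      have "c (pure_tensor scale [v, w]) [\<phi>, \<psi> k] = \<psi> k v * \<phi> (g k w)"
        using \<open>w \<in> V.span (y ` {1..m})\<close>
      proof (induction rule: V.span_induct_alt)
        case base
        then show ?case by (simp add: c_0 zero_fun_apply g_rules[OF k] lin_rules[OF \<phi>])
      next
        case (step b w w')
        then obtain l' where l': "l' \<in> {1..m}" "w = y l'" by auto
        have "c (pure_tensor scale [v, w]) [\<phi>, \<psi> k] = \<psi> k v * \<phi> (g k w)"
          unfolding l l' cy[OF l(1) l'(1)] using \<psi>_y[OF k l(1)] \<phi> lin_\<psi>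
          by (auto simp: pure_tensor_Cons pure_tensor_Nil)
        with step show ?case
          by (simp add: c_slot2 plus_fun_apply tscale_apply g_rules[OF k] lin_rules[OF \<phi>] distrib_left distrib_right mult_ac)
      qed
      then show ?case
        using step by (simp add: c_slot1 plus_fun_apply tscale_apply lin_rules[OF lin_\<psi>] distrib_left distrib_right mult_ac)
    qed
  qed
  have "x i \<noteq> 0" using basis(2) i V.dependent_zero by fastforce
  have "\<exists>k\<in>{1..m}. \<psi> k (x i) \<noteq> 0"
  proof (rule ccontr)
    assume "\<not> (\<exists>k\<in>{1..m}. \<psi> k (x i) \<noteq> 0)"
    then have "(\<Sum>b\<in>y ` {1..m}. scale (V.representation (y ` {1..m}) (x i) b) b) = 0"
      by (intro sum.neutral) (auto simp: \<psi>_def)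
    moreover have "(\<Sum>b\<in>y ` {1..m}. scale (V.representation (y ` {1..m}) (x i) b) b) = x i"
      using y by (intro V.sum_representation_eq) auto
    ultimately show False using \<open>x i \<noteq> 0\<close> by simp
  qed
  then obtain k where k: "k \<in> {1..m}" "\<psi> k (x i) \<noteq> 0" by blast
  have "\<phi> (g k (x j)) = q i j * \<phi> (x j)" if \<phi>: "Vector_Spaces.linear scale (*) \<phi>" for \<phi>
  proof -
    have "\<psi> k (x i) * \<phi> (g k (x j)) = c (P [i, j]) [\<phi>, \<psi> k]"
      using key[OF k(1) \<phi>] by (simp add: P_def)
    also have "\<dots> = \<psi> k (x i) * (q i j * \<phi> (x j))"
      unfolding c_letters[OF i j] using \<phi> lin_\<psi>
      by (simp add: P_def tscale_apply pure_tensor_Cons pure_tensor_Nil mult_ac)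
    finally show ?thesis using k(2) by simp
  qed
  then have *: "\<phi> (g k (x j)) = \<phi> (scale (q i j) (x j))"
    if "Vector_Spaces.linear scale (*) \<phi>" for \<phi>
    using that lin_rules(1)[OF that, of "q i j" "x j" 0] lin_rules(2)[OF that] by simp
  have "V.representation (x ` letters) (g k (x j)) b = V.representation (x ` letters) (scale (q i j) (x j)) b" for b
    using *[OF V.linear_representation[OF basis(2,3)]] .
  then have "(\<Sum>b\<in>x ` letters. scale (V.representation (x ` letters) (g k (x j)) b) b)
      = (\<Sum>b\<in>x ` letters. scale (V.representation (x ` letters) (scale (q i j) (x j)) b) b)"
    by simp
  then have "g k (x j) = scale (q i j) (x j)"
    using basis by (simp add: V.sum_representation_eq)
  with k(1) show ?thesis by blast
qed

text \<open>
  The powers of \<open>q i j\<close> are eigenvalues of the powers of an element of a finite group.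
\<close>

lemma root_of_unity:
  assumes "finite_group_type scale c" and i: "i \<in> letters" and j: "j \<in> letters"
  shows "\<exists>k>0. q i j ^ k = 1"
proof -
  from assms(1) obtain m y g where gt: "group_type_data scale c m y g"
    and fin: "finite (generate (GL scale) (g ` {1..m}))"
    unfolding finite_group_type_def by blast
  obtain l where l: "l \<in> {1..m}" "g l (x j) = scale (q i j) (x j)"
    using braiding_eigenvalue[OF gt i j] by blast
  have lin: "g l (scale a v) = scale a (g l v)" for a v
    using gt l(1) by (auto simp: group_type_data_def GL_def Vector_Spaces.linear_def module_hom_iff)
  have pow: "(g l ^^ k) (x j) = scale (q i j ^ k) (x j)" for k
    by (induction k) (simp_all add: lin l(2))
  have "g l ^^ k \<in> generate (GL scale) (g ` {1..m})" for k
  proof (induction k)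
    case 0
    show ?case using generate.one[of "GL scale" "g ` {1..m}"] by (simp add: GL_def id_def)
  next
    case (Suc k)
    then show ?case
      using generate.eng[OF generate.incl[of "g l" "g ` {1..m}" "GL scale"] Suc] l(1)
      by (simp add: GL_def del: o_apply)
  qed
  then have "finite (range (\<lambda>k. g l ^^ k))"
    by (intro finite_subset[OF _ fin]) auto
  then have "\<not> inj (\<lambda>k. g l ^^ k)"
    using finite_imageD infinite_UNIV_nat by blast
  then obtain k k' where kk: "k < k'" "g l ^^ k = g l ^^ k'"
    by (metis linorder_injI)
  have "scale (q i j ^ k) (x j) = scale (q i j ^ k') (x j)"
    by (simp only: pow[symmetric] kk(2))
  moreover have "x j \<noteq> 0" using basis(2) j V.dependent_zero by fastforce
  ultimately have "q i j ^ k = q i j ^ k'" by (simp add: V.scale_cancel_right)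
  moreover have "q i j ^ k' = q i j ^ k * q i j ^ (k' - k)"
    using kk(1) by (simp flip: power_add)
  moreover have "q i j \<noteq> 0"
    using diagonal i j by (simp add: diagonal_type_data_def)
  ultimately have "q i j ^ (k' - k) = 1"
    by (metis mult_cancel_left1 power_not_zero)
  with kk(1) show ?thesis by (intro exI[of _ "k' - k"]) simp
qed

end

section \<open>Conditions on the scalars\<close>

lemma minus_one_neq_one: "(-1::'k::field_char_0) \<noteq> 1"
  by simp

text \<open>
  The case \<open>r = 1\<close>: the equations are the vanishing of the second braided commutator of either letter
  with the other, and the conclusions are what makes the orders in the bound finite.
\<close>

lemma scalars_r1:
  fixes s t p :: "'k::field_char_0"
  assumes "p \<noteq> 1" "(1 + s) * (1 - s * p) = 0" "(1 + t) * (1 - p * t) = 0"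
  shows "s \<noteq> 1" "t \<noteq> 1" "s * p * t \<noteq> 1"
proof -
  have s: "s = -1 \<or> s * p = 1" and t: "t = -1 \<or> p * t = 1"
    using assms(2,3) by (auto simp: eq_neg_iff_add_eq_0 add.commute)
  show "s \<noteq> 1" using s assms(1) minus_one_neq_one[where 'k = 'k] by force
  show t1: "t \<noteq> 1" using t assms(1) minus_one_neq_one[where 'k = 'k] by force
  show "s * p * t \<noteq> 1"
  proof (cases "s * p = 1")
    case True
    then show ?thesis using t1 by simp
  next
    case False
    then have "s = -1" using s by blast
    then show ?thesis using t assms(1) minus_one_neq_one[where 'k = 'k]
      by (auto simp: mult.assoc)
  qed
qed

text \<open>
  The case \<open>r = 2\<close>.  The equations leave \<open>s * p = 1\<close> or \<open>s = -1\<close>, combined with \<open>p * t\<^sup>2 = 1\<close> or \<open>t\<close> a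
  primitive cube root of unity.  Using them, \<open>kappa s p t\<close> becomes
  \<open>(1 + t + t\<^sup>2) * (1 - p * t\<^sup>2) = 0\<close> if \<open>s * p = 1\<close>, it vanishes if \<open>s = -1\<close> and \<open>p * t\<^sup>2 = 1\<close>, and it is
  \<open>(1 + p) * (1 - p\<^sup>2 * t)\<close> if \<open>s = -1\<close> and \<open>t\<close> is a primitive cube root of unity; in the last
  expression \<open>1 - p\<^sup>2 * t\<close> equals \<open>- t * (p - t) * (p + t)\<close>.
\<close>

lemma scalars_r2:
  fixes s t p :: "'k::field_char_0"
  assumes p: "p \<noteq> 1" and s: "(1 + s) * (1 - s * p) = 0"
    and t: "1 + t \<noteq> 0" "1 - p * t \<noteq> 0" "(1 + t + t\<^sup>2) * (1 - p * t\<^sup>2) = 0"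
  shows "s \<noteq> 1" "t \<noteq> 1"
    and "1 + t + t\<^sup>2 = 0 \<or> 1 - s * p\<^sup>2 * t\<^sup>2 = 0 \<or> 1 + s = 0"
    and "\<not> (s = -1 \<and> 1 + t + t\<^sup>2 = 0) \<or> p = -1 \<or> p = t \<or> p = -t \<Longrightarrow>
      s * p * t \<noteq> 1 \<and> s * p\<^sup>2 * t ^ 4 \<noteq> 1 \<and> kappa s p t = 0"
    and "s = -1 \<Longrightarrow> 1 + t + t\<^sup>2 = 0 \<Longrightarrow> kappa s p t = 0 \<Longrightarrow> p = -1 \<or> p = t \<or> p = -t"
proof -
  have s': "s = -1 \<or> s * p = 1" and t': "1 + t + t\<^sup>2 = 0 \<or> p * t\<^sup>2 = 1"
    using s t(3) by (auto simp: eq_neg_iff_add_eq_0 add.commute)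
  show "s \<noteq> 1" using s' p minus_one_neq_one[where 'k = 'k] by force
  have three: "(3::'k) \<noteq> 0" by simp
  show t1: "t \<noteq> 1"
  proof
    assume "t = 1"
    with t' p show False using three by (auto simp: power2_eq_square)
  qed
  have cube: "t ^ 3 = 1" if "1 + t + t\<^sup>2 = 0"
    using that by algebra
  have sq: "t\<^sup>2 \<noteq> 1"
  proof
    assume "t\<^sup>2 = 1"
    then have "(t - 1) * (t + 1) = 0" by algebra
    with t1 t(1) show False by (simp add: add.commute)
  qed
  show "1 + t + t\<^sup>2 = 0 \<or> 1 - s * p\<^sup>2 * t\<^sup>2 = 0 \<or> 1 + s = 0"
  proof (cases "s * p = 1 \<and> p * t\<^sup>2 = 1")
    case True
    then have "1 - s * p\<^sup>2 * t\<^sup>2 = 0" by algebra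
    then show ?thesis by blast
  qed (use s' t' in auto)
  show "s * p * t \<noteq> 1 \<and> s * p\<^sup>2 * t ^ 4 \<noteq> 1 \<and> kappa s p t = 0"
    if cond: "\<not> (s = -1 \<and> 1 + t + t\<^sup>2 = 0) \<or> p = -1 \<or> p = t \<or> p = -t"
  proof -
    consider "s * p = 1" | "s = -1" "p * t\<^sup>2 = 1"
      | "s = -1" "1 + t + t\<^sup>2 = 0" "p = -1 \<or> p = t \<or> p = -t"
      using s' t' cond by blast
    then show ?thesis
    proof cases
      case 1
      have "s * p\<^sup>2 * t ^ 4 \<noteq> 1"
      proof
        assume a: "s * p\<^sup>2 * t ^ 4 = 1"
        from t' show False
        proof
          assume "1 + t + t\<^sup>2 = 0"
          with a 1 cube have "p * t = 1" by algebra
          with t(2) show False by simp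
        next
          assume "p * t\<^sup>2 = 1"
          with a 1 have "t\<^sup>2 = 1" by algebra
          with sq show False by simp
        qed
      qed
      moreover have "kappa s p t = (1 + t + t\<^sup>2) * (1 - p * t\<^sup>2)"
        unfolding kappa_def using 1 by algebra
      ultimately show ?thesis using 1 t1 t(3) by simp
    next
      case 2
      have "s * p * t \<noteq> 1"
      proof
        assume "s * p * t = 1"
        with 2 have "1 + t = 0" by algebra
        with t(1) show False by simp
      qed
      moreover have "s * p\<^sup>2 * t ^ 4 = -1" using 2 by algebra
      moreover have "kappa s p t = 0"
      proof -
        \<comment> \<open>the factor clears the denominator of \<open>p = 1 / t\<^sup>2\<close>\<close>
        have "t * t * kappa s p t = 0"
          unfolding kappa_def using 2 by algebra
        moreover have "t \<noteq> 0" using 2(2) by auto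
        ultimately show ?thesis by simp
      qed
      ultimately show ?thesis using minus_one_neq_one[where 'k = 'k] by simp
    next
      case 3
      note case3 = 3
      note c = cube[OF 3(2)]
      have k: "kappa s p t = (1 + p) * (1 - p\<^sup>2 * t)"
        unfolding kappa_def using 3(1,2) c by algebra
      have "t \<noteq> 0" using c by auto
      have pp: "p = -1 \<or> p\<^sup>2 * t = 1"
        using 3(3) c by (auto simp: power2_eq_square power3_eq_cube)
      have kz: "kappa s p t = 0" unfolding k using pp by auto
      have n1: "s * p * t \<noteq> 1"
      proof
        assume a: "s * p * t = 1"
        from 3(3) consider "p = -1" | "p = t" | "p = -t" by blast
        then show False
        proof cases
          case 1 with a case3(1) t1 show False by simp
        next
          case 2 with a case3(1,2) have "t = 0" by algebra
          with \<open>t \<noteq> 0\<close> show False by simp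
        next
          case 3 with a case3(1) sq show False by (simp add: power2_eq_square)
        qed
      qed
      have n2: "s * p\<^sup>2 * t ^ 4 \<noteq> 1"
      proof
        assume a: "s * p\<^sup>2 * t ^ 4 = 1"
        from pp show False
        proof
          assume "p = -1"
          with a 3(1) c have "1 + t = 0" by algebra
          with t(1) show False by simp
        next
          assume "p\<^sup>2 * t = 1"
          with a 3(1) c have "(-1::'k) = 1" by algebra
          then show False by simp
        qed
      qed
      show ?thesis using kz n1 n2 by simp
    qed
  qed
  show "p = -1 \<or> p = t \<or> p = -t" if k: "s = -1" "1 + t + t\<^sup>2 = 0" "kappa s p t = 0"
  proof -
    have "(1 + p) * ((p - t) * (p + t)) = 0"
      using k cube[OF k(2)] unfolding kappa_def by algebra
    then show ?thesis by (auto simp: eq_neg_iff_add_eq_0 add.commute)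
  qed
qed

section \<open>The dimension estimate\<close>

theorem proposition2p11:
  fixes scale :: "'k::{alg_closed_field, field_char_0} \<Rightarrow> 'v::ab_group_add \<Rightarrow> 'v"
    and c :: "('v, 'k) tensor \<Rightarrow> ('v, 'k) tensor"
    and x :: "nat \<Rightarrow> 'v"
    and q :: "nat \<Rightarrow> nat \<Rightarrow> 'k"
    and r :: nat
    and N M :: "nat \<Rightarrow> enat"
    and bound :: enat
  assumes bp: "braided_pair scale c"
    and dim2: "vector_space.dim scale (UNIV :: 'v set) = 2"
    and fgt: "finite_group_type scale c"
    and diag: "diagonal_type_data scale c 2 x q"
    and nilp: "nilpotency_order (nichols_Ad scale c (nichols_of_vector scale c (x 2)))
                 (nichols_of_vector scale c (x 1)) (r + 1)"
    and N: "\<And>j. N j = root_order (q j j)"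
    and M: "\<And>i. M i = root_order (q 1 1 * (q 1 2 * q 2 1) ^ i * q 2 2 ^ (i\<^sup>2))"
    and bound: "bound = N 1 * N 2 * (\<Prod>i\<in>{1..r}. M i)"
  shows "nichols_dim scale c \<ge> bound \<and>
    (nilpotency_order (nichols_Ad scale c (nichols_of_vector scale c (x 1)))
       (nichols_of_vector scale c (x 2)) 2 \<longrightarrow>
      (r = 1 \<longrightarrow> finite_eq (nichols_dim scale c) bound) \<and>
      (r = 2 \<and> (root_order (q 1 1) \<noteq> 2 \<or> root_order (q 2 2) \<noteq> 3) \<longrightarrow>
         finite_eq (nichols_dim scale c) bound) \<and>
      (r = 2 \<and> root_order (q 1 1) = 2 \<and> root_order (q 2 2) = 3 \<longrightarrow>
         (finite_eq (nichols_dim scale c) bound \<longleftrightarrow>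
            q 1 2 * q 2 1 = -1 \<or> q 1 2 * q 2 1 = q 2 2 \<or> q 1 2 * q 2 1 = - q 2 2)))"
proof -
  interpret diagonal_braiding q scale c 2 x
    using bp diag by unfold_locales
  define s p t where "s = q 1 1" "p = q 1 2 * q 2 1" "t = q 2 2"
  note spt = s_p_t_def
  define d where "d = nichols_dim scale c"
  have letters: "{1..2::nat} = {1, 2}" by auto
  have ne: "(1::nat) \<noteq> 2" "(2::nat) \<noteq> 1" by simp_all
  have d: "d = sdim B" by (simp add: d_def nichols_dim_eq_sdim)
  have indep_iff: "has_indep B m \<longleftrightarrow> has_indep (nich {1, 2}) m" for m
    using has_indep_nichols[of m] by (simp only: letters)
  have ad: "ad 1 2 r \<noteq> 0" "ad 1 2 (Suc r) = 0"
    using nilp nilpotency_order_iff_ad[of 1 2 r] by simp_all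
  have ad_coeff: "ad_coeff 1 2 i \<noteq> 0" if "i < r" for i
    using ad_coeff_nonzero_if_ad_nonzero[OF ne(1) ad(1) that] .
  have ad_coeff_r: "ad_coeff 1 2 r = 0"
    using ad ad_Suc_eq_0_iff[OF ne(1)] by blast
  have M_ad_diag: "M i = root_order (ad_diag 1 2 i)" for i
    by (simp add: M ad_diag_def)
  have N_M: "N 1 = M 0" by (simp add: N M)
  \<comment> \<open>the self-braiding of \<open>x 1\<close> is the case \<open>i = 0\<close> of the scalars in \<open>M\<close>\<close>
  have bound': "bound = (\<Prod>j\<le>Suc r. if j \<le> r then M j else N 2)"
  proof -
    have "(\<Prod>j\<le>r. M j) = M 0 * (\<Prod>j\<in>{1..r}. M j)"
      by (simp add: prod.atLeast_Suc_atMost atMost_atLeast0)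
    then show ?thesis by (simp add: bound N_M[unfolded One_nat_def] mult_ac)
  qed
  have ge: "bound \<le> d"
    unfolding bound'
  proof (rule enat_prod_le)
    show "1 \<le> (if j \<le> r then M j else N 2)" for j
      by (simp add: M N root_order_ge_1)
    fix m assume m: "\<And>j. j \<in> {..Suc r} \<Longrightarrow> enat (m j) \<le> (if j \<le> r then M j else N 2)"
    have "has_indep (nich {1, 2}) (m (Suc r) * (\<Prod>j\<le>r. m j))"
    proof (rule pbw_independent[OF ne(1) ad_coeff])
      show "qnum (ad_diag 1 2 j) e \<noteq> 0" if "j \<le> r" "0 < e" "e < m j" for j e
        using qnum_nonzero_below_root_order[of "m j" "ad_diag 1 2 j" e] m[of j] that by (simp add: M_ad_diag)
      show "qnum (q 2 2) e \<noteq> 0" if "0 < e" "e < m (Suc r)" for e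
        using qnum_nonzero_below_root_order[of "m (Suc r)" "q 2 2" e] m[of "Suc r"] that
        by (simp add: N)
    qed
    then show "enat (\<Prod>j\<le>Suc r. m j) \<le> d"
      unfolding d using has_indep_le_sdim[of B] by (simp add: indep_iff mult.commute)
  qed simp
  have roots: "\<exists>k>0. s ^ k = 1" "\<exists>k>0. p ^ k = 1" "\<exists>k>0. t ^ k = 1"
    unfolding spt by (intro root_of_unity_mult root_of_unity[OF fgt]; simp)+
  have zqs: "ad_diag 1 2 0 = s" "ad_diag 1 2 1 = s * p * t" "ad_diag 1 2 2 = s * p\<^sup>2 * t ^ 4"
    by (simp_all add: ad_diag_def spt)
  have Ns: "N (Suc 0) = root_order s" "N 2 = root_order t"
    by (simp_all add: N spt)
  have eq_case: "finite_eq d bound"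
    if r: "r = 1 \<or> r = 2 \<and> s * p\<^sup>2 * t ^ 4 \<noteq> 1" and ad_comm: "ad_comm 1 2 0 = 0" "ad_comm 1 2 1 = 0"
      and ne1: "s \<noteq> 1" "t \<noteq> 1" "s * p * t \<noteq> 1"
  proof -
    obtain m0 where m0: "root_order s = enat m0"
      using finite_root_order[OF roots(1) ne1(1)] .
    obtain n where n: "root_order t = enat n"
      using finite_root_order[OF roots(3) ne1(2)] .
    obtain m1 where m1: "root_order (s * p * t) = enat m1"
      using finite_root_order[OF root_of_unity_mult[OF root_of_unity_mult[OF roots(1,2)] roots(3)] ne1(3)] .
    obtain m2 where m2: "r = 1 \<and> m2 = 1 \<or> r = 2 \<and> root_order (s * p\<^sup>2 * t ^ 4) = enat m2"
      using r finite_root_order[OF root_of_unity_mult[OF root_of_unity_mult[OF roots(1)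
            root_of_unity_power[OF roots(2)]] root_of_unity_power[OF roots(3)]]] by metis
    \<comment> \<open>for \<open>r = 1\<close> the element \<open>ad 1 2 2\<close> is zero and only its exponent \<open>0\<close> is counted, so \<open>m2 = 1\<close>\<close>
    define m where "m j = (if j = 0 then m0 else if j = 1 then m1 else m2)" for j :: nat
    have bnd: "bound = enat (n * (m 0 * m 1 * m 2))"
      using m2
    proof
      assume "r = 1 \<and> m2 = 1"
      then show ?thesis
        using m0 m1 n by (simp add: bound Ns M_ad_diag zqs[unfolded One_nat_def] m_def mult_ac)
    next
      assume r2: "r = 2 \<and> root_order (s * p\<^sup>2 * t ^ 4) = enat m2"
      have "{1..2::nat} = {1, 2}" by auto
      then show ?thesis
        using r2 m0 m1 n by (simp add: bound Ns M_ad_diag zqs[unfolded One_nat_def] m_def mult_ac)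
    qed
    have "has_indep B k \<Longrightarrow> k \<le> n * (m 0 * m 1 * m 2)" for k
      unfolding indep_iff
    proof (rule has_indep_le_pbw[OF ne(1) ad_comm])
      have "ad 1 2 2 = 0" if "r = 1"
        using ad(2) that by (simp add: numeral_2_eq_2)
      then show "root_order (ad_diag 1 2 2) = enat (m 2) \<or> ad 1 2 2 = 0 \<and> m 2 = 1"
        using m2 by (auto simp: zqs[unfolded One_nat_def] m_def)
      have "ad 1 2 (Suc 2) = 0"
        using ad(2) r ad_Suc_eq_0_iff[OF ne(1), of 2] by (auto simp: numeral_2_eq_2)
      then show "ad 1 2 3 = 0" by simp
    qed (use m0 m1 n in \<open>simp_all add: zqs[unfolded One_nat_def] m_def spt[symmetric]\<close>)
    then have "d \<le> bound"
      unfolding d bnd by (rule sdim_le[OF subspace_nichols])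
    with ge bnd show ?thesis by (simp add: finite_eq_def)
  qed
  have main: "(r = 1 \<longrightarrow> finite_eq d bound) \<and>
      (r = 2 \<and> (root_order s \<noteq> 2 \<or> root_order t \<noteq> 3) \<longrightarrow> finite_eq d bound) \<and>
      (r = 2 \<and> root_order s = 2 \<and> root_order t = 3 \<longrightarrow>
        (finite_eq d bound \<longleftrightarrow> p = -1 \<or> p = t \<or> p = - t))"
    if nil: "nilpotency_order (nichols_Ad scale c (nichols_of_vector scale c (x 1)))
       (nichols_of_vector scale c (x 2)) 2"
  proof -
    have z': "ad 2 1 1 \<noteq> 0" "ad 2 1 (Suc 1) = 0"
      using nil nilpotency_order_iff_ad[of 2 1 1, unfolded one_add_one] by simp_all
    then have zc': "ad_coeff 2 1 0 \<noteq> 0" "ad_coeff 2 1 1 = 0"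
      using ad_coeff_nonzero_if_ad_nonzero[OF ne(2) z'(1), of 0] ad_Suc_eq_0_iff[OF ne(2), of 1] by auto
    have p1: "p \<noteq> 1" and s1: "(1 + s) * (1 - s * p) = 0"
      using zc' by (auto simp: ad_coeff_def qnum_Suc spt mult_ac)
    have u0: "ad_comm 1 2 0 = 0" by (rule ad_comm_0_eq_0[OF ne(1) zc'(2)])
    have r1: "finite_eq d bound" if r: "r = 1"
    proof -
      have "(1 + t) * (1 - p * t) = 0"
        using ad_coeff_r r by (simp add: ad_coeff_def qnum_Suc spt)
      from scalars_r1[OF p1 s1 this] have ne1: "s \<noteq> 1" "t \<noteq> 1" "s * p * t \<noteq> 1" by blast+
      have "ad 1 2 2 = 0" using ad(2) r by (simp add: numeral_2_eq_2)
      then have "ad_comm 1 2 1 = 0" by (simp add: ad_comm_def numeral_2_eq_2)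
      with ne1 u0 r show ?thesis by (intro eq_case) auto
    qed
    have r2: "(\<not> (s = -1 \<and> 1 + t + t\<^sup>2 = 0) \<longrightarrow> finite_eq d bound) \<and>
        (s = -1 \<and> 1 + t + t\<^sup>2 = 0 \<longrightarrow> (finite_eq d bound \<longleftrightarrow> p = -1 \<or> p = t \<or> p = - t))"
      if r: "r = 2"
    proof -
      have c01: "ad_coeff 1 2 0 \<noteq> 0" "ad_coeff 1 2 1 \<noteq> 0" using ad_coeff r by auto
      have t1: "1 + t \<noteq> 0" "1 - p * t \<noteq> 0"
        using c01(2) by (auto simp: ad_coeff_def qnum_Suc spt)
      have t2: "(1 + t + t\<^sup>2) * (1 - p * t\<^sup>2) = 0"
        using ad_coeff_r r by (simp add: ad_coeff_def qnum_Suc spt numeral_2_eq_2)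
      note sc = scalars_r2[OF p1 s1 t1 t2]
      have kap: "kappa (q 1 1) (q 1 2 * q 2 1) (q 2 2) = kappa s p t" by (simp add: spt)
      have eq: "finite_eq d bound"
        if "\<not> (s = -1 \<and> 1 + t + t\<^sup>2 = 0) \<or> p = -1 \<or> p = t \<or> p = -t"
      proof (rule eq_case[OF _ u0])
        show "ad_comm 1 2 1 = 0"
          by (rule ad_comm_1_eq_0[OF ne(1)]) (use sc(3) sc(4)[OF that] kap in \<open>simp_all add: spt\<close>)
      qed (use sc(1,2) sc(4)[OF that] r in auto)
      have "\<not> finite_eq d bound" if k: "kappa s p t \<noteq> 0"
      proof
        assume fe: "finite_eq d bound"
        then obtain b where b: "bound = enat b" "d = enat b"
          unfolding finite_eq_def by (cases bound) auto
        have prod: "bound = M 0 * N 2 * (M 1 * M 2)"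
        proof -
          have "{1..2::nat} = {1, 2}" by auto
          then show ?thesis using r by (simp add: bound N_M[unfolded One_nat_def])
        qed
        have nz: "M j \<noteq> 0" "N j \<noteq> 0" for j
          unfolding M N by (metis not_one_le_zero root_order_ge_1)+
        have fin: "M 0 \<noteq> \<infinity>" "M 1 \<noteq> \<infinity>" "M 2 \<noteq> \<infinity>" "N 2 \<noteq> \<infinity>"
        proof -
          have "M 0 * N 2 * (M 1 * M 2) \<noteq> \<infinity>" using b(1) prod by simp
          then show "M 0 \<noteq> \<infinity>" "M 1 \<noteq> \<infinity>" "M 2 \<noteq> \<infinity>" "N 2 \<noteq> \<infinity>"
            using nz by (auto simp: imult_is_infinity)
        qed
        have en: "y = enat (the_enat y)" if "y \<noteq> \<infinity>" for y
          using that by (cases y) auto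
        define m where "m j = the_enat (M j)" for j
        define n where "n = the_enat (N 2)"
        have m: "M j = enat (m j)" if "j \<le> 2" for j
        proof -
          have "j = 0 \<or> j = 1 \<or> j = 2" using that by auto
          then show ?thesis using fin en unfolding m_def by auto
        qed
        have n: "N 2 = enat n" unfolding n_def by (rule en[OF fin(4)])
        have "has_indep (nich {1, 2}) ((m 2 * n + 1) * (m 0 * m 1))"
        proof (rule pbw_independent_strict[OF ne(1) c01])
          show "kappa (q 1 1) (q 1 2 * q 2 1) (q 2 2) \<noteq> 0" using k kap by simp
          show "qnum (ad_diag 1 2 j) e \<noteq> 0" if "j \<le> 2" "0 < e" "e < m j" for j e
            using qnum_nonzero_below_root_order[of "m j" "ad_diag 1 2 j" e] m[OF that(1)] that
            by (simp add: M_ad_diag)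
          show "qnum (q 2 2) e \<noteq> 0" if "0 < e" "e < n" for e
            using qnum_nonzero_below_root_order[of n "q 2 2" e] n that by (simp add: N)
        qed
        \<comment> \<open>this exceeds the bound by \<open>m 0 * m 1\<close>\<close>
        then have "(m 2 * n + 1) * (m 0 * m 1) \<le> b"
          using has_indep_le_sdim[of B] b(2) d by (simp add: indep_iff)
        moreover have "b = m 0 * n * (m 1 * m 2)"
          using b(1) m[of 0] m[of 1] m[of 2] n unfolding prod by simp
        moreover have "m 0 > 0" "m 1 > 0"
          using nz m[of 0] m[of 1] by (auto simp: zero_enat_def[symmetric] intro: Nat.gr0I)
        ultimately show False by (auto simp: algebra_simps)
      qed
      with eq sc(5) show ?thesis by blast
    qed
    show ?thesis using r1 r2 by (auto simp: root_order_eq_2 root_order_eq_3)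
  qed
  show ?thesis
    using ge main unfolding d_def spt by blast
qed

end
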